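(* Let $t \in \mathbb{N}$ be squarefree, and let $\tau: \mathbb{Z} \to \{0,1\}$ be defined by $\tau(n)=1$ if $n$ is a perfect square (of an integer) and $\tau(n)=0$ otherwise. Let $r$ be the rank of the elliptic curve $E_t: y^2 = x^3-t^2x$ over $\mathbb{Q}$. For real $X > 1$, define the shifted partial sum \[ S_t(X) := \sum_{m=1}^{X} \sum_{n=1}^{X} \tau(m+n)\, \tau(m-n)\, \tau(m)\, \tau(tn), \] where $m,n$ run over integers in $[1,X]$. Then the sum \[ C_t := \sum_{h_i \in \mathcal{H}(t)} \frac{1}{h_i} \] converges, and \[ S_t(X) = C_t X^{1/2} + O_t\big((\log X)^{r/2}\big) \quad \text{as } X\to\infty . \]
   Context: A primitive right triangle is a right triangle with positive integer side lengths $a<b<c$ (so $a^2+b^2=c^2$) that are pairwise coprime; its area $ab/2$ is an integer. The squarefree part of a positive integer $N$ is the unique squarefree positive integer $s$ such that $N = s k^2$ for some positive integer $k$. $\mathcal{H}(t)$ denotes the collection of hypotenuses $h_i$ of pairwise dissimilar primitive right triangles whose area has squarefree part $t$: there is one entry $h_i$ (the hypotenuse $c$) for each such triangle, so a hypotenuse shared by several dissimilar such triangles is counted with multiplicity. The notation $O_t$ means the implied constant may depend on $t$. *)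

theory Defs
  imports
    "HOL-Analysis.Analysis"
    "HOL-Library.Landau_Symbols"
    "HOL-Algebra.FiniteProduct"
    "HOL-Computational_Algebra.Nth_Powers"
    "HOL-Computational_Algebra.Squarefree"
begin

datatype 'a ec_point = Infinity | Affine 'a 'a

text \<open>The chord-and-tangent law on \<open>y\<^sup>2 = x\<^sup>3 + a x + b\<close>; the coefficient \<open>b\<close> does not
  enter the formulas.\<close>

fun ec_add :: "'a::field_char_0 \<Rightarrow> 'a ec_point \<Rightarrow> 'a ec_point \<Rightarrow> 'a ec_point" where
  "ec_add a Infinity Q = Q"
| "ec_add a (Affine x y) Infinity = Affine x y"
| "ec_add a (Affine x1 y1) (Affine x2 y2) =
     (if x1 = x2 \<and> y1 = - y2 then Infinity
      else let s = (if x1 = x2 then (3 * x1^2 + a) / (2 * y1) else (y2 - y1) / (x2 - x1));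
               x3 = s^2 - x1 - x2
           in Affine x3 (s * (x1 - x3) - y1))"

definition ec_group :: "'a::field_char_0 \<Rightarrow> 'a \<Rightarrow> 'a ec_point monoid" where
  "ec_group a b =
     \<lparr>carrier = insert Infinity {Affine x y | x y. y^2 = x^3 + a * x + b},
      mult = ec_add a, one = Infinity\<rparr>"

definition int_independent :: "('g, 'm) monoid_scheme \<Rightarrow> 'g set \<Rightarrow> bool" where
  "int_independent G S \<longleftrightarrow> finite S \<and> S \<subseteq> carrier G \<and>
     (\<forall>c :: 'g \<Rightarrow> int. finprod G (\<lambda>P. P [^]\<^bsub>G\<^esub> c P) S = \<one>\<^bsub>G\<^esub> \<longrightarrow> (\<forall>P\<in>S. c P = 0))"

text \<open>The rank of an abelian group: the largest number of elements that are linearly independent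
  over the integers. It is meaningful only if this number is bounded, which for the group of
  rational points of an elliptic curve is part of Mordell's theorem.\<close>

definition group_rank :: "('g, 'm) monoid_scheme \<Rightarrow> nat" where
  "group_rank G = (GREATEST n. \<exists>S. int_independent G S \<and> card S = n)"

definition congruent_curve :: "nat \<Rightarrow> rat ec_point monoid" where
  "congruent_curve t = ec_group (- (of_nat t ^ 2)) 0"

text \<open>Because of the ordering of the sides and primitivity, distinct triples are dissimilar
  triangles, and every similarity class of integer right triangles contains exactly one of them.
  The hypotenuses, with multiplicity, are the third components of the elements of this set.\<close>

definition primitive_triangles :: "nat \<Rightarrow> (nat \<times> nat \<times> nat) set" where
  "primitive_triangles t =
     {(a, b, c). 0 < a \<and> a < b \<and> b < c \<and> a^2 + b^2 = c^2 \<and>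
        coprime a b \<and> coprime a c \<and> coprime b c \<and> squarefree_part (a * b div 2) = t}"

definition recip_hyp :: "nat \<times> nat \<times> nat \<Rightarrow> real" where
  "recip_hyp = (\<lambda>(a, b, c). 1 / real c)"

definition tau :: "int \<Rightarrow> nat" where
  "tau n = (if is_square n then 1 else 0)"

definition shifted_sum :: "nat \<Rightarrow> real \<Rightarrow> nat" where
  "shifted_sum t X =
     (\<Sum>m = 1..\<lfloor>X\<rfloor>. \<Sum>n = 1..\<lfloor>X\<rfloor>. tau (m + n) * tau (m - n) * tau m * tau (int t * n))"

end

theory Submission
  imports Defs "HOL-Real_Asymp.Real_Asymp"
begin

text \<open>
  A nonzero term of the sum is an arithmetic progression \<open>m - n, m, m + n\<close> of squares with difference \<open>n = t v\<^sup>2\<close>,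
  that is, a right triangle with hypotenuse \<open>\<surd>m\<close> whose area has squarefree part \<open>t\<close>. Grouping by similarity
  classes, the sum is \<open>\<Sum> \<lfloor>\<surd>X / h\<rfloor>\<close> over the primitive hypotenuses \<open>h \<le> \<surd>X\<close>, and everything follows from the
  bound \<open>O((log Y)\<^bsup>r/2\<^esup>)\<close> for the number of hypotenuses \<open>h \<le> Y\<close>.

  The three squares are rational points of the intersection of quadrics \<open>c\<^sup>2 = 1 - t s\<^sup>2\<close>, \<open>d\<^sup>2 = 1 - 2 t s\<^sup>2\<close>.
  It is isomorphic to \<open>E\<^sub>t\<close>, but its addition law (that of the Jacobi functions sn, cn, dn) has no exceptional
  cases over the rationals, so that associativity is a polynomial identity, and the hypotenuse is
  essentially the height of the point. The parallelogram inequality for heights and a 2-descent show that a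
  subgroup \<open>H\<close> generated by \<open>r\<close> independent points satisfies \<open>N(b) \<le> 2\<^sup>r N(b / 2 + C)\<close>, where \<open>N(b)\<close> counts points with
  square root of the logarithmic height at most \<open>b\<close>; hence \<open>N(b) = O(b\<^sup>r)\<close>. For maximal \<open>r\<close> some fixed multiple of
  every rational point lies in \<open>H\<close>.
\<close>

section \<open>The Jacobi quadric model\<close>

text \<open>The addition law is total because d^2 = 1 - 2 t s^2 >= 0 keeps its denominator at or
  above 1/2, and the map from E_t is total because 2 is not a rational square. Halving in the full
  group would give as exponent the binary logarithm of the number of cosets of twice the group; the
  rational 2-torsion makes this larger than r. A subgroup generated by r independent points is
  covered by 2^r cosets of its double, hence the detour through H. The cruder count in the full
  group still has a use: it bounds the size of independent sets, so that the \<open>GREATEST\<close>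
  in \<open>group_rank\<close> is attained. The exponent r/2 arises because a hypotenuse up to Y
  corresponds to a root height up to about sqrt (log Y). In the final sum each floor costs at most
  1, so the error from the floors is the count itself; the reciprocals of the hypotenuses beyond Y
  sum to O((log Y)^(r/2) / Y), which is of the same order after multiplication by Y = sqrt
  X.\<close>

definition jacobi :: "rat \<Rightarrow> (rat \<times> rat \<times> rat) set" where
  "jacobi t = {(s, c, d). c\<^sup>2 = 1 - t * s\<^sup>2 \<and> d\<^sup>2 = 1 - 2 * t * s\<^sup>2}"

text \<open>Put sn = sqrt t * s, cn = c, dn = d: this is the factor 1 - k^2 sn(u)^2 sn(v)^2 of
  Jacobi's addition theorem for k^2 = 2, and \<open>jacobi_add\<close> is that theorem.\<close>

definition jacobi_den :: "rat \<Rightarrow> rat \<Rightarrow> rat \<Rightarrow> rat" where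
  "jacobi_den t s1 s2 = 1 - 2 * t\<^sup>2 * s1\<^sup>2 * s2\<^sup>2"

fun jacobi_add :: "rat \<Rightarrow> rat \<times> rat \<times> rat \<Rightarrow> rat \<times> rat \<times> rat \<Rightarrow> rat \<times> rat \<times> rat" where
  "jacobi_add t (s1, c1, d1) (s2, c2, d2) =
     ((s1 * c2 * d2 + s2 * c1 * d1) / jacobi_den t s1 s2,
      (c1 * c2 - t * s1 * s2 * d1 * d2) / jacobi_den t s1 s2,
      (d1 * d2 - 2 * t * s1 * s2 * c1 * c2) / jacobi_den t s1 s2)"

fun jacobi_minus :: "rat \<times> rat \<times> rat \<Rightarrow> rat \<times> rat \<times> rat" where
  "jacobi_minus (s, c, d) = (- s, c, d)"

text \<open>Rewrite rules that eliminate the squares of c and d coordinates from normalised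
  polynomials. The second form covers a square followed by further factors in a product nested to
  the right.\<close>

lemma square_rewrites:
  fixes x y z :: "'a::comm_ring_1"
  assumes "x\<^sup>2 = y"
  shows "x * x = y" "x * (x * z) = y * z"
  using assms by (simp_all add: power2_eq_square flip: mult.assoc)

lemma divide_power2_eq:
  fixes x y z k :: "'a::field"
  assumes "z \<noteq> 0" "x\<^sup>2 = z\<^sup>2 - k * y\<^sup>2"
  shows "(x / z)\<^sup>2 = 1 - k * (y / z)\<^sup>2"
  using assms by (simp add: power_divide field_simps)

lemma jacobi_cases:
  obtains s c d where "P = (s, c, d)"
    "P \<in> jacobi t \<Longrightarrow> c\<^sup>2 = 1 - t * s\<^sup>2" "P \<in> jacobi t \<Longrightarrow> d\<^sup>2 = 1 - 2 * t * s\<^sup>2"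
  by (cases P) (auto simp: jacobi_def)

text \<open>Since d^2 = 1 - 2 t s^2 is nonnegative, both numbers 2 t s^2 are at most 1, and the
  subtracted term is half their product.\<close>

lemma jacobi_den_pos:
  assumes "t > 0" "(s1, c1, d1) \<in> jacobi t" "(s2, c2, d2) \<in> jacobi t"
  shows "jacobi_den t s1 s2 \<ge> 1/2"
proof -
  have "d1\<^sup>2 = 1 - 2 * t * s1\<^sup>2" "d2\<^sup>2 = 1 - 2 * t * s2\<^sup>2"
    using assms by (auto simp: jacobi_def)
  hence a: "2 * t * s1\<^sup>2 \<le> 1" "2 * t * s2\<^sup>2 \<le> 1"
    by (metis diff_ge_0_iff_ge zero_le_power2)+
  have "(2 * t * s1\<^sup>2) * (2 * t * s2\<^sup>2) \<le> 1 * 1"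
    using a assms(1) by (intro mult_mono) auto
  thus ?thesis unfolding jacobi_den_def by (simp add: power2_eq_square algebra_simps)
qed

lemma jacobi_add_closed:
  assumes "t > 0" "P \<in> jacobi t" "Q \<in> jacobi t"
  shows "jacobi_add t P Q \<in> jacobi t"
proof -
  obtain s1 c1 d1 where P: "P = (s1, c1, d1)" "c1\<^sup>2 = 1 - t * s1\<^sup>2" "d1\<^sup>2 = 1 - 2 * t * s1\<^sup>2"
    using assms(2) jacobi_cases by metis
  obtain s2 c2 d2 where Q: "Q = (s2, c2, d2)" "c2\<^sup>2 = 1 - t * s2\<^sup>2" "d2\<^sup>2 = 1 - 2 * t * s2\<^sup>2"
    using assms(3) jacobi_cases by metis
  note reds = square_rewrites[OF P(2)] square_rewrites[OF P(3)]
    square_rewrites[OF Q(2)] square_rewrites[OF Q(3)]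
  have D: "jacobi_den t s1 s2 \<noteq> 0"
    using jacobi_den_pos[OF assms(1), of s1 c1 d1 s2 c2 d2] assms P(1) Q(1) by auto
  have 1: "(c1 * c2 - t * s1 * s2 * d1 * d2)\<^sup>2 =
      (jacobi_den t s1 s2)\<^sup>2 - t * (s1 * c2 * d2 + s2 * c1 * d1)\<^sup>2"
    unfolding jacobi_den_def by (simp add: reds power2_eq_square algebra_simps)
  have 2: "(d1 * d2 - 2 * t * s1 * s2 * c1 * c2)\<^sup>2 =
      (jacobi_den t s1 s2)\<^sup>2 - 2 * t * (s1 * c2 * d2 + s2 * c1 * d1)\<^sup>2"
    unfolding jacobi_den_def by (simp add: reds power2_eq_square algebra_simps)
  show ?thesis
    unfolding P(1) Q(1) jacobi_add.simps jacobi_def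
    using divide_power2_eq[OF D 1] divide_power2_eq[OF D 2] by blast
qed

lemma jacobi_add_commute: "jacobi_add t P Q = jacobi_add t Q P"
  by (cases P; cases Q) (simp add: jacobi_den_def algebra_simps)

lemma jacobi_zero: "(0, 1, 1) \<in> jacobi t"
  by (simp add: jacobi_def)

lemma jacobi_add_zero: "jacobi_add t P (0, 1, 1) = P"
  by (cases P) (simp add: jacobi_den_def)

lemma jacobi_minus_closed: "P \<in> jacobi t \<Longrightarrow> jacobi_minus P \<in> jacobi t"
  by (cases P) (simp add: jacobi_def)

lemma jacobi_add_minus:
  assumes "t > 0" "P \<in> jacobi t"
  shows "jacobi_add t P (jacobi_minus P) = (0, 1, 1)"
proof -
  obtain s c d where P: "P = (s, c, d)" "c\<^sup>2 = 1 - t * s\<^sup>2" "d\<^sup>2 = 1 - 2 * t * s\<^sup>2"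
    using assms(2) jacobi_cases by metis
  note reds = square_rewrites[OF P(2)] square_rewrites[OF P(3)]
  have D: "jacobi_den t s (- s) \<noteq> 0"
    using jacobi_den_pos[OF assms(1), of s c d "- s" c d] assms P(1) jacobi_minus_closed[of P t] by auto
  have "c * c - t * s * (- s) * d * d = jacobi_den t s (- s)"
       "d * d - 2 * t * s * (- s) * c * c = jacobi_den t s (- s)"
    unfolding jacobi_den_def by (simp_all add: reds power2_eq_square algebra_simps)
  thus ?thesis using D by (simp add: P(1))
qed

text \<open>Both sides become fractions over \<open>F\<close> and \<open>G\<close>.
  Cross-multiplied, each coordinate is a polynomial identity that holds once the squares of all c
  and d are expressed by s.\<close>

lemma jacobi_add_assoc:
  assumes "t > 0" "P \<in> jacobi t" "Q \<in> jacobi t" "R \<in> jacobi t"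
  shows "jacobi_add t (jacobi_add t P Q) R = jacobi_add t P (jacobi_add t Q R)"
proof -
  obtain s1 c1 d1 where P: "P = (s1, c1, d1)" "c1\<^sup>2 = 1 - t * s1\<^sup>2" "d1\<^sup>2 = 1 - 2 * t * s1\<^sup>2"
    using assms(2) jacobi_cases by metis
  obtain s2 c2 d2 where Q: "Q = (s2, c2, d2)" "c2\<^sup>2 = 1 - t * s2\<^sup>2" "d2\<^sup>2 = 1 - 2 * t * s2\<^sup>2"
    using assms(3) jacobi_cases by metis
  obtain s3 c3 d3 where R: "R = (s3, c3, d3)" "c3\<^sup>2 = 1 - t * s3\<^sup>2" "d3\<^sup>2 = 1 - 2 * t * s3\<^sup>2"
    using assms(4) jacobi_cases by metis
  note reds = square_rewrites[OF P(2)] square_rewrites[OF P(3)] square_rewrites[OF Q(2)]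
    square_rewrites[OF Q(3)] square_rewrites[OF R(2)] square_rewrites[OF R(3)]
  define D E where "D = jacobi_den t s1 s2" and "E = jacobi_den t s2 s3"
  define s4 c4 d4 where s4: "s4 = s1 * c2 * d2 + s2 * c1 * d1"
    and c4: "c4 = c1 * c2 - t * s1 * s2 * d1 * d2" and d4: "d4 = d1 * d2 - 2 * t * s1 * s2 * c1 * c2"
  define s5 c5 d5 where s5: "s5 = s2 * c3 * d3 + s3 * c2 * d2"
    and c5: "c5 = c2 * c3 - t * s2 * s3 * d2 * d3" and d5: "d5 = d2 * d3 - 2 * t * s2 * s3 * c2 * c3"
  have PQ: "jacobi_add t P Q = (s4 / D, c4 / D, d4 / D)"
    and QR: "jacobi_add t Q R = (s5 / E, c5 / E, d5 / E)"
    by (simp_all add: P(1) Q(1) R(1) D_def E_def s4 c4 d4 s5 c5 d5)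
  have D0: "D \<noteq> 0" "E \<noteq> 0"
    using jacobi_den_pos[OF assms(1), of s1 c1 d1 s2 c2 d2] 
      jacobi_den_pos[OF assms(1), of s2 c2 d2 s3 c3 d3] assms unfolding D_def E_def P Q R by auto
  \<comment> \<open>The outer denominators, multiplied by \<open>D^2\<close> and \<open>E^2\<close>.
    They are nonzero because the inner sums lie on the quadric again.\<close>
  define F G where "F = D\<^sup>2 - 2 * t\<^sup>2 * s4\<^sup>2 * s3\<^sup>2" and "G = E\<^sup>2 - 2 * t\<^sup>2 * s1\<^sup>2 * s5\<^sup>2"
  have F: "jacobi_den t (s4 / D) s3 = F / D\<^sup>2" and G: "jacobi_den t s1 (s5 / E) = G / E\<^sup>2"
    using D0 by (simp_all add: F_def G_def jacobi_den_def field_simps)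
  have "jacobi_add t P Q \<in> jacobi t" "jacobi_add t Q R \<in> jacobi t"
    using assms by (simp_all add: jacobi_add_closed)
  hence FG: "F \<noteq> 0" "G \<noteq> 0"
    using jacobi_den_pos[OF assms(1), of "s4/D" "c4/D" "d4/D" s3 c3 d3] 
      jacobi_den_pos[OF assms(1), of s1 c1 d1 "s5/E" "c5/E" "d5/E"] assms F G PQ QR P R by auto
  note unf = F_def G_def D_def E_def jacobi_den_def s4 c4 d4 s5 c5 d5
  have 1: "(s4 * D * c3 * d3 + s3 * c4 * d4) * G = (s1 * c5 * d5 + s5 * E * c1 * d1) * F"
    unfolding unf by (simp add: reds power2_eq_square algebra_simps)
  have 2: "(c4 * D * c3 - t * s4 * s3 * d4 * d3) * G = (c1 * c5 * E - t * s1 * s5 * d1 * d5) * F"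
    unfolding unf by (simp add: reds power2_eq_square algebra_simps)
  have 3: "(d4 * D * d3 - 2 * t * s4 * s3 * c4 * c3) * G = (d1 * d5 * E - 2 * t * s1 * s5 * c1 * c5) * F"
    unfolding unf by (simp add: reds power2_eq_square algebra_simps)
  have "jacobi_add t (jacobi_add t P Q) R = 
     ((s4 * D * c3 * d3 + s3 * c4 * d4) / F, (c4 * D * c3 - t * s4 * s3 * d4 * d3) / F, 
       (d4 * D * d3 - 2 * t * s4 * s3 * c4 * c3) / F)"
    unfolding PQ R jacobi_add.simps F using D0 FG by (simp add: field_simps power2_eq_square)
  also have "\<dots> = ((s1 * c5 * d5 + s5 * E * c1 * d1) / G, (c1 * c5 * E - t * s1 * s5 * d1 * d5) / G,
       (d1 * d5 * E - 2 * t * s1 * s5 * c1 * c5) / G)"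
    using 1 2 3 FG by (simp add: frac_eq_eq)
  also have "\<dots> = jacobi_add t P (jacobi_add t Q R)"
    unfolding QR P jacobi_add.simps G using D0 FG by (simp add: field_simps power2_eq_square)
  finally show ?thesis .
qed

section \<open>Isomorphism with the congruent number curve\<close>

lemma rat_power2_ne_2: "(r::rat)\<^sup>2 \<noteq> 2"
proof
  assume r: "r\<^sup>2 = 2"
  obtain p q where pq: "quotient_of r = (p, q)" by (cases "quotient_of r")
  hence q: "q > 0" and cop: "coprime p q" and "r = of_int p / of_int q"
    using quotient_of_denom_pos quotient_of_coprime quotient_of_div by blast+
  with r have "(of_int (p\<^sup>2) :: rat) = of_int (2 * q\<^sup>2)"
    by (simp add: field_simps)
  hence eq: "p\<^sup>2 = 2 * q\<^sup>2" by (simp only: of_int_eq_iff)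
  hence "even (p\<^sup>2)" by simp
  hence "even p" by simp
  then obtain k where "p = 2 * k" by (elim evenE)
  with eq have "q\<^sup>2 = 2 * k\<^sup>2" by (simp add: power_mult_distrib)
  hence "even (q\<^sup>2)" by simp
  hence "even q" by simp
  with \<open>even p\<close> cop show False by auto
qed

text \<open>This is (x + t)^2 - 2 t^2. Its zeros -t + t sqrt 2 and -t - t sqrt 2 are irrational, so
  the map below has no poles at rational points.\<close>

definition curve_den :: "rat \<Rightarrow> rat \<Rightarrow> rat" where
  "curve_den t x = x\<^sup>2 + 2 * t * x - t\<^sup>2"

lemma curve_den_nonzero:
  assumes "t \<noteq> 0"
  shows "curve_den t x \<noteq> 0"
proof
  assume "curve_den t x = 0"
  hence "(x + t)\<^sup>2 = 2 * t\<^sup>2" by (simp add: curve_den_def power2_eq_square algebra_simps)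
  hence "((x + t) / t)\<^sup>2 = 2" using assms by (simp add: power_divide)
  thus False using rat_power2_ne_2 by blast
qed

text \<open>The squares of x^2 - 2 t x - t^2, x^2 + t^2 and x^2 + 2 t x - t^2 form an arithmetic
  progression with difference t (2 y)^2; dividing by the largest root gives a point of the
  quadric.\<close>

fun to_jacobi :: "rat \<Rightarrow> rat ec_point \<Rightarrow> rat \<times> rat \<times> rat" where
  "to_jacobi t Infinity = (0, 1, 1)"
| "to_jacobi t (Affine x y) =
     (2 * y / curve_den t x, (x\<^sup>2 + t\<^sup>2) / curve_den t x, (x\<^sup>2 - 2 * t * x - t\<^sup>2) / curve_den t x)"

text \<open>On the image of \<open>to_jacobi\<close>, 1 - d = 4 t x / \<open>curve_den t x\<close>
  and 1 + 2 c + d = 4 x^2 / \<open>curve_den t x\<close>, and the quotient recovers x. If d = 1,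
  then s = 0, and the sign of c separates the point at infinity from (0, 0).\<close>

fun from_jacobi :: "rat \<Rightarrow> rat \<times> rat \<times> rat \<Rightarrow> rat ec_point" where
  "from_jacobi t (s, c, d) =
     (if d = 1 then if c = 1 then Infinity else Affine 0 0
      else Affine (t * (1 + 2 * c + d) / (1 - d)) (2 * s * t\<^sup>2 * (1 + 2 * c + d) / (1 - d)\<^sup>2))"

definition curve :: "rat \<Rightarrow> rat ec_point set" where
  "curve t = insert Infinity {Affine x y | x y. y\<^sup>2 = x ^ 3 - t\<^sup>2 * x}"

lemma Affine_in_curve [simp]: "Affine x y \<in> curve t \<longleftrightarrow> y\<^sup>2 = x ^ 3 - t\<^sup>2 * x"
  and Infinity_in_curve [simp]: "Infinity \<in> curve t"
  by (auto simp: curve_def)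

lemma to_jacobi_closed:
  assumes "t > 0" "P \<in> curve t"
  shows "to_jacobi t P \<in> jacobi t"
proof (cases P)
  case Infinity
  thus ?thesis by (simp add: jacobi_zero)
next
  case (Affine x y)
  hence y: "y\<^sup>2 = x ^ 3 - t\<^sup>2 * x" using assms by simp
  have D: "curve_den t x \<noteq> 0" using curve_den_nonzero assms by simp
  have "(x\<^sup>2 + t\<^sup>2)\<^sup>2 = (curve_den t x)\<^sup>2 - t * (2 * y)\<^sup>2"
    "(x\<^sup>2 - 2 * t * x - t\<^sup>2)\<^sup>2 = (curve_den t x)\<^sup>2 - 2 * t * (2 * y)\<^sup>2"
    unfolding curve_den_def power_mult_distrib y
    by (simp_all add: power2_eq_square power3_eq_cube algebra_simps)
  from this[THEN divide_power2_eq[OF D]] show ?thesis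
    unfolding Affine to_jacobi.simps jacobi_def by blast
qed

lemma from_to_jacobi:
  assumes "t > 0" "P \<in> curve t"
  shows "from_jacobi t (to_jacobi t P) = P"
proof (cases P)
  case (Affine x y)
  hence y: "y\<^sup>2 = x ^ 3 - t\<^sup>2 * x" using assms by simp
  have D: "curve_den t x \<noteq> 0" using curve_den_nonzero assms by simp
  define d where "d = (x\<^sup>2 - 2 * t * x - t\<^sup>2) / curve_den t x"
  define c where "c = (x\<^sup>2 + t\<^sup>2) / curve_den t x"
  have d: "1 - d = 4 * t * x / curve_den t x"
    using D by (simp add: d_def field_simps) (simp add: curve_den_def)
  have "(1 + 2 * c + d) * curve_den t x = curve_den t x + 2 * (c * curve_den t x) + d * curve_den t x"
    by (simp add: algebra_simps)
  also have "\<dots> = 4 * x\<^sup>2"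
    using D by (simp add: c_def d_def) (simp add: curve_den_def)
  finally have e: "1 + 2 * c + d = 4 * x\<^sup>2 / curve_den t x"
    using D by (simp add: field_simps)
  show ?thesis
  proof (cases "x = 0")
    case True
    hence "y = 0" "d = 1" "c = -1" using y assms by (simp_all add: c_def d_def curve_den_def)
    thus ?thesis using True assms by (simp add: Affine curve_den_def)
  next
    case False
    hence "d \<noteq> 1" using d D assms by auto
    moreover have "t * (1 + 2 * c + d) / (1 - d) = x"
      using False D assms unfolding d e by (simp add: power2_eq_square)
    moreover have "2 * (2 * y / curve_den t x) * t\<^sup>2 * (1 + 2 * c + d) / (1 - d)\<^sup>2 = y"
      using False D assms unfolding d e by (simp add: power2_eq_square)
    ultimately show ?thesis by (simp add: Affine flip: c_def d_def)
  qed
qed simp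

lemma from_jacobi_closed:
  assumes "t > 0" "P \<in> jacobi t"
  shows "from_jacobi t P \<in> curve t" and "to_jacobi t (from_jacobi t P) = P"
proof -
  obtain s c d where P: "P = (s, c, d)" "c\<^sup>2 = 1 - t * s\<^sup>2" "d\<^sup>2 = 1 - 2 * t * s\<^sup>2"
    using assms(2) jacobi_cases by metis
  have "from_jacobi t P \<in> curve t \<and> to_jacobi t (from_jacobi t P) = P"
  proof (cases "d = 1")
    case True
    hence "s = 0" using P assms by auto
    moreover from this have "c = 1 \<or> c = -1" using P by (simp add: power2_eq_1_iff)
    ultimately show ?thesis using True P assms by (auto simp: curve_den_def)
  next
    case False
    define e where "e = 1 + 2 * c + d"
    define x where "x = t * e / (1 - d)"
    define y where "y = 2 * s * t\<^sup>2 * e / (1 - d)\<^sup>2"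
    have cd: "2 * c\<^sup>2 = 1 + d\<^sup>2" "2 * t * s\<^sup>2 = 1 - d\<^sup>2" using P by auto
    \<comment> \<open>Here e - (1 + d) = 2 c and 4 c^2 = (1 + d)^2 + (1 - d)^2. The relation makes
      \<open>curve_den t x\<close> a multiple of e, so that e is nonzero.\<close>
    have e2: "e\<^sup>2 = 2 * (1 + d) * e + (1 - d)\<^sup>2"
      using cd(1) by (simp add: e_def power2_eq_square algebra_simps)
    have d1: "1 - d \<noteq> 0" using False by simp
    have xd: "x * (1 - d) = t * e" using d1 by (simp add: x_def)
    have "curve_den t x * (1 - d)\<^sup>2 =
        (x * (1 - d))\<^sup>2 + 2 * t * (x * (1 - d)) * (1 - d) - (t * (1 - d))\<^sup>2"
      by (simp add: curve_den_def power2_eq_square algebra_simps)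
    also have "\<dots> = t\<^sup>2 * (e\<^sup>2 + 2 * e * (1 - d) - (1 - d)\<^sup>2)"
      unfolding xd by (simp add: power2_eq_square algebra_simps)
    also have "\<dots> = 4 * t\<^sup>2 * e" unfolding e2 by (simp add: algebra_simps)
    finally have D: "curve_den t x = 4 * t\<^sup>2 * e / (1 - d)\<^sup>2"
      using d1 by (simp add: field_simps)
    moreover have D0: "curve_den t x \<noteq> 0" using curve_den_nonzero assms by simp
    ultimately have e0: "e \<noteq> 0" by auto
    have i: "2 * y / curve_den t x = s"
      unfolding D y_def using d1 e0 assms by (simp add: power2_eq_square)
    have "(x\<^sup>2 + t\<^sup>2) * (1 - d)\<^sup>2 = (x * (1 - d))\<^sup>2 + (t * (1 - d))\<^sup>2"
      by (simp add: power2_eq_square algebra_simps)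
    hence xt: "(x\<^sup>2 + t\<^sup>2) * (1 - d)\<^sup>2 = t\<^sup>2 * (e\<^sup>2 + (1 - d)\<^sup>2)"
      unfolding xd by (simp add: power2_eq_square algebra_simps)
    have ii: "(x\<^sup>2 + t\<^sup>2) = c * curve_den t x"
    proof -
      have "e\<^sup>2 + (1 - d)\<^sup>2 = 4 * c * e"
        using cd(1) by (simp add: e_def power2_eq_square algebra_simps)
      thus ?thesis using xt d1 unfolding D by (simp add: field_simps)
    qed
    have "(x\<^sup>2 - 2 * t * x - t\<^sup>2) * (1 - d)\<^sup>2 =
        (x * (1 - d))\<^sup>2 - 2 * t * (x * (1 - d)) * (1 - d) - (t * (1 - d))\<^sup>2"
      by (simp add: power2_eq_square algebra_simps)
    hence "(x\<^sup>2 - 2 * t * x - t\<^sup>2) * (1 - d)\<^sup>2 = t\<^sup>2 * (e\<^sup>2 - 2 * e * (1 - d) - (1 - d)\<^sup>2)"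
      unfolding xd by (simp add: power2_eq_square algebra_simps)
    also have "\<dots> = d * (4 * t\<^sup>2 * e)"
      unfolding e2 by (simp add: algebra_simps)
    finally have iii: "(x\<^sup>2 - 2 * t * x - t\<^sup>2) = d * curve_den t x"
      using d1 unfolding D by (simp add: field_simps)
    have iv: "y\<^sup>2 = x ^ 3 - t\<^sup>2 * x"
    proof -
      have "y * (1 - d)\<^sup>2 = 2 * s * t\<^sup>2 * e"
        using d1 by (simp add: y_def)
      hence "(y * (1 - d)\<^sup>2)\<^sup>2 = (2 * t * s\<^sup>2) * (2 * t ^ 3 * e\<^sup>2)"
        by (simp add: power2_eq_square power3_eq_cube)
      hence "y\<^sup>2 * (1 - d) ^ 4 = (2 * t * s\<^sup>2) * (2 * t ^ 3 * e\<^sup>2)"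
        by (simp add: power_mult_distrib)
      also have "\<dots> = (1 - d) * t ^ 3 * e * (2 * (1 + d) * e)"
        unfolding cd(2) by (simp add: power2_eq_square algebra_simps)
      also have "2 * (1 + d) * e = e\<^sup>2 - (1 - d)\<^sup>2" using e2 by simp
      also have "(1 - d) * t ^ 3 * e * (e\<^sup>2 - (1 - d)\<^sup>2) = (x ^ 3 - t\<^sup>2 * x) * (1 - d) ^ 4"
      proof -
        have "(1 - d) * t ^ 3 * e * (e\<^sup>2 - (1 - d)\<^sup>2) =
            (1 - d) * (t * e) ^ 3 - (1 - d) ^ 3 * t\<^sup>2 * (t * e)"
          by (simp add: power2_eq_square power3_eq_cube algebra_simps)
        thus ?thesis unfolding xd[symmetric]
          by (simp add: power_mult_distrib) (simp add: power4_eq_xxxx power3_eq_cube algebra_simps)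
      qed
      finally show ?thesis using d1 by simp
    qed
    have "from_jacobi t P = Affine x y"
      using False by (simp add: P(1) x_def y_def e_def)
    thus ?thesis using P(1) D0 i ii iii iv by simp
  qed
  thus "from_jacobi t P \<in> curve t" "to_jacobi t (from_jacobi t P) = P" by auto
qed

text \<open>A line of slope m / e yields a sum with coordinates of the shape X / e^2 and Y / e^3;
  the image is written here without these inner denominators.\<close>

lemma to_jacobi_chord_formula:
  assumes "t \<noteq> 0" "e \<noteq> 0"
  shows "to_jacobi t (Affine (X / e\<^sup>2) (Y / e ^ 3)) =
    (2 * Y * e / (X\<^sup>2 + 2 * t * X * e\<^sup>2 - t\<^sup>2 * e ^ 4),
     (X\<^sup>2 + t\<^sup>2 * e ^ 4) / (X\<^sup>2 + 2 * t * X * e\<^sup>2 - t\<^sup>2 * e ^ 4),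
     (X\<^sup>2 - 2 * t * X * e\<^sup>2 - t\<^sup>2 * e ^ 4) / (X\<^sup>2 + 2 * t * X * e\<^sup>2 - t\<^sup>2 * e ^ 4))"
    and "X\<^sup>2 + 2 * t * X * e\<^sup>2 - t\<^sup>2 * e ^ 4 \<noteq> 0"
proof -
  define D where "D = curve_den t (X / e\<^sup>2)"
  define x y where "x = X / e\<^sup>2" and "y = Y / e ^ 3"
  have X: "X = x * e\<^sup>2" and Y: "Y = y * e ^ 3" using assms by (simp_all add: x_def y_def)
  have D: "X\<^sup>2 + 2 * t * X * e\<^sup>2 - t\<^sup>2 * e ^ 4 = D * e ^ 4"
    unfolding D_def curve_den_def x_def[symmetric] unfolding X
    by (simp add: power2_eq_square power4_eq_xxxx algebra_simps)
  have 1: "2 * Y * e = 2 * y * e ^ 4" "X\<^sup>2 + t\<^sup>2 * e ^ 4 = (x\<^sup>2 + t\<^sup>2) * e ^ 4"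
    "X\<^sup>2 - 2 * t * X * e\<^sup>2 - t\<^sup>2 * e ^ 4 = (x\<^sup>2 - 2 * t * x - t\<^sup>2) * e ^ 4"
    unfolding X Y by (simp_all add: power2_eq_square power3_eq_cube power4_eq_xxxx algebra_simps)
  show "X\<^sup>2 + 2 * t * X * e\<^sup>2 - t\<^sup>2 * e ^ 4 \<noteq> 0"
    unfolding D using assms curve_den_nonzero by (simp add: D_def)
  show "to_jacobi t (Affine (X / e\<^sup>2) (Y / e ^ 3)) =
    (2 * Y * e / (X\<^sup>2 + 2 * t * X * e\<^sup>2 - t\<^sup>2 * e ^ 4),
     (X\<^sup>2 + t\<^sup>2 * e ^ 4) / (X\<^sup>2 + 2 * t * X * e\<^sup>2 - t\<^sup>2 * e ^ 4),
     (X\<^sup>2 - 2 * t * X * e\<^sup>2 - t\<^sup>2 * e ^ 4) / (X\<^sup>2 + 2 * t * X * e\<^sup>2 - t\<^sup>2 * e ^ 4))"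
    unfolding D 1 x_def[symmetric] y_def[symmetric] to_jacobi.simps
    using assms by (simp add: D_def flip: x_def)
qed

lemma jacobi_add_fractions:
  assumes "D1 \<noteq> 0" "D2 \<noteq> 0"
  shows "jacobi_add t (s1 / D1, c1 / D1, d1 / D1) (s2 / D2, c2 / D2, d2 / D2) =
    ((s1 * D1 * c2 * d2 + s2 * D2 * c1 * d1) / (D1\<^sup>2 * D2\<^sup>2 - 2 * t\<^sup>2 * s1\<^sup>2 * s2\<^sup>2),
     (c1 * D1 * c2 * D2 - t * s1 * s2 * d1 * d2) / (D1\<^sup>2 * D2\<^sup>2 - 2 * t\<^sup>2 * s1\<^sup>2 * s2\<^sup>2),
     (d1 * D1 * d2 * D2 - 2 * t * s1 * s2 * c1 * c2) / (D1\<^sup>2 * D2\<^sup>2 - 2 * t\<^sup>2 * s1\<^sup>2 * s2\<^sup>2))"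
proof -
  define x1 y1 z1 where d1: "x1 = s1 / D1" "y1 = c1 / D1" "z1 = d1 / D1"
  define x2 y2 z2 where d2: "x2 = s2 / D2" "y2 = c2 / D2" "z2 = d2 / D2"
  have e: "s1 = x1 * D1" "c1 = y1 * D1" "d1 = z1 * D1" "s2 = x2 * D2" "c2 = y2 * D2" "d2 = z2 * D2"
    using assms by (simp_all add: d1 d2)
  have D: "D1\<^sup>2 * D2\<^sup>2 - 2 * t\<^sup>2 * s1\<^sup>2 * s2\<^sup>2 = jacobi_den t x1 x2 * (D1\<^sup>2 * D2\<^sup>2)"
    unfolding e jacobi_den_def by (simp add: power2_eq_square algebra_simps)
  have n: "s1 * D1 * c2 * d2 + s2 * D2 * c1 * d1 = (x1 * y2 * z2 + x2 * y1 * z1) * (D1\<^sup>2 * D2\<^sup>2)"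
    "c1 * D1 * c2 * D2 - t * s1 * s2 * d1 * d2 = (y1 * y2 - t * x1 * x2 * z1 * z2) * (D1\<^sup>2 * D2\<^sup>2)"
    "d1 * D1 * d2 * D2 - 2 * t * s1 * s2 * c1 * c2 = (z1 * z2 - 2 * t * x1 * x2 * y1 * y2) * (D1\<^sup>2 * D2\<^sup>2)"
    unfolding e by (simp_all add: power2_eq_square algebra_simps)
  show ?thesis
    unfolding D n d1[symmetric] d2[symmetric] jacobi_add.simps using assms by simp
qed

text \<open>With \<open>e = x2 - x1\<close>, the numbers \<open>X / e\<^sup>2\<close> and \<open>X' / e\<^sup>2\<close> are the \<open>x\<close>-coordinates of \<open>P + Q\<close> and \<open>P - Q\<close>.
  The biquadratic forms of the addition law are the products of the coordinates of \<open>P + Q\<close> with the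
  denominator belonging to \<open>P - Q\<close>.\<close>

lemma chord_identities:
  fixes t x1 x2 y1 y2 :: rat
  defines "e \<equiv> x2 - x1" and "m \<equiv> y2 - y1"
  defines "X \<equiv> m\<^sup>2 - (x1 + x2) * e\<^sup>2" and "X' \<equiv> (x1 + x2) * (x1 * x2 - t\<^sup>2) + 2 * (y1 * y2)"
  defines "Y \<equiv> m * (x1 * e\<^sup>2 - X) - y1 * e ^ 3"
  defines "V' \<equiv> X'\<^sup>2 + 2 * t * X' * e\<^sup>2 - t\<^sup>2 * e ^ 4"
  assumes y1: "y1\<^sup>2 = x1 ^ 3 - t\<^sup>2 * x1" and y2: "y2\<^sup>2 = x2 ^ 3 - t\<^sup>2 * x2"
  shows "(X\<^sup>2 + 2 * t * X * e\<^sup>2 - t\<^sup>2 * e ^ 4) * V' =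
      e ^ 4 * ((curve_den t x1)\<^sup>2 * (curve_den t x2)\<^sup>2 - 2 * t\<^sup>2 * (2 * y1)\<^sup>2 * (2 * y2)\<^sup>2)"
    and "(2 * Y * e) * V' =
      e ^ 4 * (2 * y1 * curve_den t x1 * (x2\<^sup>2 + t\<^sup>2) * (x2\<^sup>2 - 2 * t * x2 - t\<^sup>2) +
       2 * y2 * curve_den t x2 * (x1\<^sup>2 + t\<^sup>2) * (x1\<^sup>2 - 2 * t * x1 - t\<^sup>2))"
    and "(X\<^sup>2 + t\<^sup>2 * e ^ 4) * V' =
      e ^ 4 * ((x1\<^sup>2 + t\<^sup>2) * curve_den t x1 * (x2\<^sup>2 + t\<^sup>2) * curve_den t x2 -
       t * (2 * y1) * (2 * y2) * (x1\<^sup>2 - 2 * t * x1 - t\<^sup>2) * (x2\<^sup>2 - 2 * t * x2 - t\<^sup>2))"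
    and "(X\<^sup>2 - 2 * t * X * e\<^sup>2 - t\<^sup>2 * e ^ 4) * V' =
      e ^ 4 * ((x1\<^sup>2 - 2 * t * x1 - t\<^sup>2) * curve_den t x1 * (x2\<^sup>2 - 2 * t * x2 - t\<^sup>2) * curve_den t x2 -
       2 * t * (2 * y1) * (2 * y2) * (x1\<^sup>2 + t\<^sup>2) * (x2\<^sup>2 + t\<^sup>2))"
proof -
  define n q w where "n = (x1 + x2) * (x1 * x2 - t\<^sup>2)" and "q = x1 * x2 + t\<^sup>2" and "w = y1 * y2"
  have X: "X = n - 2 * w"
  proof -
    have "X = y1\<^sup>2 + y2\<^sup>2 - 2 * w - (x1 + x2) * e\<^sup>2"
      unfolding X_def m_def w_def by algebra
    also have "\<dots> = n - 2 * w" unfolding y1 y2 n_def e_def by algebra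
    finally show ?thesis .
  qed
  have X': "X' = n + 2 * w" by (simp add: X'_def n_def w_def)
  have w2: "w\<^sup>2 = (x1 ^ 3 - t\<^sup>2 * x1) * (x2 ^ 3 - t\<^sup>2 * x2)"
    by (simp add: w_def power_mult_distrib y1 y2)
  \<comment> \<open>The classical product formula: the x-coordinates of P + Q and P - Q multiply to
    (x1 x2 + t^2)^2 / (x2 - x1)^2. Together with X + X' = 2 n it reduces the products below to
    polynomials in t, x1, x2 and w.\<close>
  have XX': "X * X' = e\<^sup>2 * q\<^sup>2"
  proof -
    have "X * X' = n\<^sup>2 - 4 * w\<^sup>2" unfolding X X' by algebra
    also have "\<dots> = e\<^sup>2 * q\<^sup>2" unfolding w2 n_def e_def q_def by algebra
    finally show ?thesis .
  qed
  have "(X\<^sup>2 + 2 * t * X * e\<^sup>2 - t\<^sup>2 * e ^ 4) * V' =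
    (X * X')\<^sup>2 + 2 * t * e\<^sup>2 * (X * X') * (X + X') + 4 * t\<^sup>2 * e ^ 4 * (X * X')
     - t\<^sup>2 * e ^ 4 * ((X + X')\<^sup>2 - 2 * (X * X')) - 2 * t ^ 3 * e ^ 6 * (X + X') + t ^ 4 * e ^ 8"
    unfolding V'_def by algebra
  also have "\<dots> = e ^ 4 * (q ^ 4 + 4 * t * q\<^sup>2 * n + 4 * t\<^sup>2 * e\<^sup>2 * q\<^sup>2
     - t\<^sup>2 * (4 * n\<^sup>2 - 2 * e\<^sup>2 * q\<^sup>2) - 4 * t ^ 3 * e\<^sup>2 * n + t ^ 4 * e ^ 4)"
    unfolding XX' unfolding X X' by algebra
  also have "q ^ 4 + 4 * t * q\<^sup>2 * n + 4 * t\<^sup>2 * e\<^sup>2 * q\<^sup>2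
     - t\<^sup>2 * (4 * n\<^sup>2 - 2 * e\<^sup>2 * q\<^sup>2) - 4 * t ^ 3 * e\<^sup>2 * n + t ^ 4 * e ^ 4 =
     (curve_den t x1)\<^sup>2 * (curve_den t x2)\<^sup>2 - 32 * t\<^sup>2 * ((x1 ^ 3 - t\<^sup>2 * x1) * (x2 ^ 3 - t\<^sup>2 * x2))"
    unfolding q_def n_def e_def curve_den_def by algebra
  also have "32 * t\<^sup>2 * ((x1 ^ 3 - t\<^sup>2 * x1) * (x2 ^ 3 - t\<^sup>2 * x2)) = 2 * t\<^sup>2 * (2 * y1)\<^sup>2 * (2 * y2)\<^sup>2"
    unfolding power_mult_distrib y1 y2 by algebra
  finally show "(X\<^sup>2 + 2 * t * X * e\<^sup>2 - t\<^sup>2 * e ^ 4) * V' =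
      e ^ 4 * ((curve_den t x1)\<^sup>2 * (curve_den t x2)\<^sup>2 - 2 * t\<^sup>2 * (2 * y1)\<^sup>2 * (2 * y2)\<^sup>2)"
    .
  have "(X\<^sup>2 + t\<^sup>2 * e ^ 4) * V' =
    (X * X')\<^sup>2 + 2 * t * e\<^sup>2 * (X * X') * X + t\<^sup>2 * e ^ 4 * (X'\<^sup>2 - X\<^sup>2) + 2 * t ^ 3 * e ^ 6 * X' - t ^ 4 * e ^ 8"
    unfolding V'_def by algebra
  also have "\<dots> = e ^ 4 * (q ^ 4 + 2 * t * q\<^sup>2 * (n - 2 * w) + 8 * t\<^sup>2 * n * w + 2 * t ^ 3 * e\<^sup>2 * (n + 2 * w) - t ^ 4 * e ^ 4)"
    unfolding XX' unfolding X X' by algebra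
  also have "q ^ 4 + 2 * t * q\<^sup>2 * (n - 2 * w) + 8 * t\<^sup>2 * n * w + 2 * t ^ 3 * e\<^sup>2 * (n + 2 * w) - t ^ 4 * e ^ 4 =
    (x1\<^sup>2 + t\<^sup>2) * curve_den t x1 * (x2\<^sup>2 + t\<^sup>2) * curve_den t x2 -
       t * (2 * y1) * (2 * y2) * (x1\<^sup>2 - 2 * t * x1 - t\<^sup>2) * (x2\<^sup>2 - 2 * t * x2 - t\<^sup>2)"
    unfolding q_def n_def e_def curve_den_def w_def by algebra
  finally show "(X\<^sup>2 + t\<^sup>2 * e ^ 4) * V' =
      e ^ 4 * ((x1\<^sup>2 + t\<^sup>2) * curve_den t x1 * (x2\<^sup>2 + t\<^sup>2) * curve_den t x2 -
       t * (2 * y1) * (2 * y2) * (x1\<^sup>2 - 2 * t * x1 - t\<^sup>2) * (x2\<^sup>2 - 2 * t * x2 - t\<^sup>2))" .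
  have "(X\<^sup>2 - 2 * t * X * e\<^sup>2 - t\<^sup>2 * e ^ 4) * V' =
    (X * X')\<^sup>2 + 2 * t * e\<^sup>2 * (X * X') * (X - X') - 4 * t\<^sup>2 * e ^ 4 * (X * X')
     - t\<^sup>2 * e ^ 4 * ((X + X')\<^sup>2 - 2 * (X * X')) - 2 * t ^ 3 * e ^ 6 * (X' - X) + t ^ 4 * e ^ 8"
    unfolding V'_def by algebra
  also have "\<dots> = e ^ 4 * (q ^ 4 - 8 * t * q\<^sup>2 * w - 4 * t\<^sup>2 * e\<^sup>2 * q\<^sup>2
     - t\<^sup>2 * (4 * n\<^sup>2 - 2 * e\<^sup>2 * q\<^sup>2) - 8 * t ^ 3 * e\<^sup>2 * w + t ^ 4 * e ^ 4)"
    unfolding XX' unfolding X X' by algebra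
  also have "q ^ 4 - 8 * t * q\<^sup>2 * w - 4 * t\<^sup>2 * e\<^sup>2 * q\<^sup>2
     - t\<^sup>2 * (4 * n\<^sup>2 - 2 * e\<^sup>2 * q\<^sup>2) - 8 * t ^ 3 * e\<^sup>2 * w + t ^ 4 * e ^ 4 =
     (x1\<^sup>2 - 2 * t * x1 - t\<^sup>2) * curve_den t x1 * (x2\<^sup>2 - 2 * t * x2 - t\<^sup>2) * curve_den t x2 -
       2 * t * (2 * y1) * (2 * y2) * (x1\<^sup>2 + t\<^sup>2) * (x2\<^sup>2 + t\<^sup>2)"
    unfolding q_def n_def e_def curve_den_def w_def by algebra
  finally show "(X\<^sup>2 - 2 * t * X * e\<^sup>2 - t\<^sup>2 * e ^ 4) * V' =
      e ^ 4 * ((x1\<^sup>2 - 2 * t * x1 - t\<^sup>2) * curve_den t x1 * (x2\<^sup>2 - 2 * t * x2 - t\<^sup>2) * curve_den t x2 -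
       2 * t * (2 * y1) * (2 * y2) * (x1\<^sup>2 + t\<^sup>2) * (x2\<^sup>2 + t\<^sup>2))" .
  \<comment> \<open>Modulo the curve equations Y is linear in y1, y2 and V' is linear in w = y1 y2.
    Hence the product splits into a multiple of y1 and a multiple of y2, each settled by a
    polynomial identity in t, x1, x2.\<close>
  define f1 f2 where f: "f1 = x1 ^ 3 - t\<^sup>2 * x1" "f2 = x2 ^ 3 - t\<^sup>2 * x2"
  define \<alpha> \<beta> where \<alpha>: "\<alpha> = x2 ^ 3 + 3 * x1 * x2\<^sup>2 - t\<^sup>2 * (x1 + 3 * x2)"
    and \<beta>: "\<beta> = x1 ^ 3 + 3 * x1\<^sup>2 * x2 - t\<^sup>2 * (3 * x1 + x2)"
  define A B where A: "A = n\<^sup>2 + 4 * (f1 * f2) + 2 * t * n * e\<^sup>2 - t\<^sup>2 * e ^ 4"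
    and B: "B = 4 * n + 4 * t * e\<^sup>2"
  have Y: "Y = \<alpha> * y1 - \<beta> * y2"
  proof -
    have "Y = (y2 - y1) * (x1 * e\<^sup>2 - n) + 2 * y1 * y2\<^sup>2 - 2 * y1\<^sup>2 * y2 - y1 * e ^ 3"
      unfolding Y_def X m_def w_def by algebra
    also have "\<dots> = \<alpha> * y1 - \<beta> * y2" unfolding y1 y2 n_def e_def \<alpha> \<beta> by algebra
    finally show ?thesis .
  qed
  have V': "V' = A + B * w"
  proof -
    have "V' = n\<^sup>2 + 4 * w\<^sup>2 + 2 * t * n * e\<^sup>2 - t\<^sup>2 * e ^ 4 + B * w"
      unfolding V'_def X' B by algebra
    thus ?thesis by (simp add: w2 A f)
  qed
  have "(2 * Y * e) * V' = y1 * (2 * e * (\<alpha> * A)) - y2 * (2 * e * (\<beta> * A))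
      + 2 * e * \<alpha> * B * y1\<^sup>2 * y2 - 2 * e * \<beta> * B * y2\<^sup>2 * y1"
    unfolding Y V' w_def by algebra
  also have "\<dots> = y1 * (2 * e * (\<alpha> * A - \<beta> * B * f2)) + y2 * (2 * e * (\<alpha> * B * f1 - \<beta> * A))"
    unfolding y1 y2 f[symmetric] by algebra
  also have "2 * e * (\<alpha> * A - \<beta> * B * f2) =
      e ^ 4 * (2 * curve_den t x1 * (x2\<^sup>2 + t\<^sup>2) * (x2\<^sup>2 - 2 * t * x2 - t\<^sup>2))"
    unfolding \<alpha> \<beta> A B n_def e_def f curve_den_def by algebra
  also have "2 * e * (\<alpha> * B * f1 - \<beta> * A) =
      e ^ 4 * (2 * curve_den t x2 * (x1\<^sup>2 + t\<^sup>2) * (x1\<^sup>2 - 2 * t * x1 - t\<^sup>2))"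
    unfolding \<alpha> \<beta> A B n_def e_def f curve_den_def by algebra
  finally show "(2 * Y * e) * V' =
      e ^ 4 * (2 * y1 * curve_den t x1 * (x2\<^sup>2 + t\<^sup>2) * (x2\<^sup>2 - 2 * t * x2 - t\<^sup>2) +
       2 * y2 * curve_den t x2 * (x1\<^sup>2 + t\<^sup>2) * (x1\<^sup>2 - 2 * t * x1 - t\<^sup>2))"
    by (simp add: algebra_simps)
qed

text \<open>For a tangent P - Q is the point at infinity, so the forms agree without the factors V'
  and e^4 of the chord case. All rests on X = (x^2 + t^2)^2.\<close>

lemma tangent_identities:
  fixes t x y :: rat
  defines "e \<equiv> 2 * y" and "m \<equiv> 3 * x\<^sup>2 - t\<^sup>2"
  defines "X \<equiv> m\<^sup>2 - (x + x) * e\<^sup>2"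
  defines "Y \<equiv> m * (x * e\<^sup>2 - X) - y * e ^ 3"
  assumes y: "y\<^sup>2 = x ^ 3 - t\<^sup>2 * x"
  shows "X\<^sup>2 + 2 * t * X * e\<^sup>2 - t\<^sup>2 * e ^ 4 =
      (curve_den t x)\<^sup>2 * (curve_den t x)\<^sup>2 - 2 * t\<^sup>2 * (2 * y)\<^sup>2 * (2 * y)\<^sup>2"
    and "2 * Y * e = 2 * y * curve_den t x * (x\<^sup>2 + t\<^sup>2) * (x\<^sup>2 - 2 * t * x - t\<^sup>2) +
       2 * y * curve_den t x * (x\<^sup>2 + t\<^sup>2) * (x\<^sup>2 - 2 * t * x - t\<^sup>2)"
    and "X\<^sup>2 + t\<^sup>2 * e ^ 4 = (x\<^sup>2 + t\<^sup>2) * curve_den t x * (x\<^sup>2 + t\<^sup>2) * curve_den t x -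
       t * (2 * y) * (2 * y) * (x\<^sup>2 - 2 * t * x - t\<^sup>2) * (x\<^sup>2 - 2 * t * x - t\<^sup>2)"
    and "X\<^sup>2 - 2 * t * X * e\<^sup>2 - t\<^sup>2 * e ^ 4 =
      (x\<^sup>2 - 2 * t * x - t\<^sup>2) * curve_den t x * (x\<^sup>2 - 2 * t * x - t\<^sup>2) * curve_den t x -
       2 * t * (2 * y) * (2 * y) * (x\<^sup>2 + t\<^sup>2) * (x\<^sup>2 + t\<^sup>2)"
proof -
  define f where f: "f = x ^ 3 - t\<^sup>2 * x"
  have y2: "y * y = f" using y f by (simp add: power2_eq_square)
  have e2: "e\<^sup>2 = 4 * f" using y f by (simp add: e_def power_mult_distrib)
  have e4: "e ^ 4 = 16 * f\<^sup>2"
  proof -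
    have "e ^ 4 = (e\<^sup>2)\<^sup>2" by simp
    thus ?thesis unfolding e2 by (simp add: power_mult_distrib)
  qed
  have X: "X = (x\<^sup>2 + t\<^sup>2)\<^sup>2" unfolding X_def m_def e2 f by algebra
  show "X\<^sup>2 + 2 * t * X * e\<^sup>2 - t\<^sup>2 * e ^ 4 =
      (curve_den t x)\<^sup>2 * (curve_den t x)\<^sup>2 - 2 * t\<^sup>2 * (2 * y)\<^sup>2 * (2 * y)\<^sup>2"
    unfolding X e4 unfolding e_def[symmetric] e2 unfolding f curve_den_def by algebra
  have "2 * Y * e = 2 * y * (2 * (m * (x * e\<^sup>2 - X)) - e ^ 4)"
    unfolding Y_def e_def by algebra
  also have "\<dots> = 2 * y * (2 * (curve_den t x * (x\<^sup>2 + t\<^sup>2) * (x\<^sup>2 - 2 * t * x - t\<^sup>2)))"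
    unfolding X e2 e4 unfolding m_def f curve_den_def by algebra
  finally show "2 * Y * e = 2 * y * curve_den t x * (x\<^sup>2 + t\<^sup>2) * (x\<^sup>2 - 2 * t * x - t\<^sup>2) +
       2 * y * curve_den t x * (x\<^sup>2 + t\<^sup>2) * (x\<^sup>2 - 2 * t * x - t\<^sup>2)"
    by (simp add: mult.assoc)
  have "X\<^sup>2 + t\<^sup>2 * e ^ 4 = (x\<^sup>2 + t\<^sup>2)\<^sup>2 * (curve_den t x)\<^sup>2 - 4 * t * f * (x\<^sup>2 - 2 * t * x - t\<^sup>2)\<^sup>2"
    unfolding X e4 f curve_den_def by algebra
  thus "X\<^sup>2 + t\<^sup>2 * e ^ 4 = (x\<^sup>2 + t\<^sup>2) * curve_den t x * (x\<^sup>2 + t\<^sup>2) * curve_den t x -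
       t * (2 * y) * (2 * y) * (x\<^sup>2 - 2 * t * x - t\<^sup>2) * (x\<^sup>2 - 2 * t * x - t\<^sup>2)"
    unfolding y2[symmetric] by algebra
  have "X\<^sup>2 - 2 * t * X * e\<^sup>2 - t\<^sup>2 * e ^ 4 =
      (x\<^sup>2 - 2 * t * x - t\<^sup>2)\<^sup>2 * (curve_den t x)\<^sup>2 - 8 * t * f * (x\<^sup>2 + t\<^sup>2)\<^sup>2"
    unfolding X e2 e4 f curve_den_def by algebra
  thus "X\<^sup>2 - 2 * t * X * e\<^sup>2 - t\<^sup>2 * e ^ 4 =
      (x\<^sup>2 - 2 * t * x - t\<^sup>2) * curve_den t x * (x\<^sup>2 - 2 * t * x - t\<^sup>2) * curve_den t x -
       2 * t * (2 * y) * (2 * y) * (x\<^sup>2 + t\<^sup>2) * (x\<^sup>2 + t\<^sup>2)"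
    unfolding y2[symmetric] by algebra
qed

lemma to_jacobi_chord:
  assumes t: "t > 0" and P: "Affine x1 y1 \<in> curve t" and Q: "Affine x2 y2 \<in> curve t"
    and e: "e \<noteq> 0" and line: "e = x2 - x1 \<and> m = y2 - y1 \<or>
      x2 = x1 \<and> y2 = y1 \<and> e = 2 * y1 \<and> m = 3 * x1\<^sup>2 - t\<^sup>2"
    and x3: "x3 = (m / e)\<^sup>2 - x1 - x2" and y3: "y3 = m / e * (x1 - x3) - y1"
  shows "to_jacobi t (Affine x3 y3) = jacobi_add t (to_jacobi t (Affine x1 y1)) (to_jacobi t (Affine x2 y2))"
proof -
  have y: "y1\<^sup>2 = x1 ^ 3 - t\<^sup>2 * x1" "y2\<^sup>2 = x2 ^ 3 - t\<^sup>2 * x2" using P Q by simp_all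
  define X where "X = m\<^sup>2 - (x1 + x2) * e\<^sup>2"
  define Y where "Y = m * (x1 * e\<^sup>2 - X) - y1 * e ^ 3"
  have X: "x3 = X / e\<^sup>2"
    using e by (simp add: x3 X_def field_simps)
  have Y: "y3 = Y / e ^ 3"
    using e unfolding y3 X by (simp add: Y_def field_simps power2_eq_square power3_eq_cube)
  define D1 D2 where D: "D1 = curve_den t x1" "D2 = curve_den t x2"
  have D0: "D1 \<noteq> 0" "D2 \<noteq> 0" using curve_den_nonzero t by (simp_all add: D)
  define F where "F = D1\<^sup>2 * D2\<^sup>2 - 2 * t\<^sup>2 * (2 * y1)\<^sup>2 * (2 * y2)\<^sup>2"
  have "F = jacobi_den t (2 * y1 / D1) (2 * y2 / D2) * (D1\<^sup>2 * D2\<^sup>2)"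
    using D0 by (simp add: F_def jacobi_den_def power_divide left_diff_distrib)
  hence F0: "F \<noteq> 0"
    using jacobi_den_pos[OF t to_jacobi_closed[OF t P, unfolded to_jacobi.simps]
        to_jacobi_closed[OF t Q, unfolded to_jacobi.simps]] D0 by (auto simp: D)
  \<comment> \<open>The two coordinate triples are proportional. For a chord k is e^4 and l is the
    form V' of P - Q; for a tangent both are 1.\<close>
  have "\<exists>k l. k \<noteq> 0 \<and> 
    (X\<^sup>2 + 2 * t * X * e\<^sup>2 - t\<^sup>2 * e ^ 4) * l = k * F \<and>
    (2 * Y * e) * l = k * (2 * y1 * D1 * (x2\<^sup>2 + t\<^sup>2) * (x2\<^sup>2 - 2 * t * x2 - t\<^sup>2) +
       2 * y2 * D2 * (x1\<^sup>2 + t\<^sup>2) * (x1\<^sup>2 - 2 * t * x1 - t\<^sup>2)) \<and>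
    (X\<^sup>2 + t\<^sup>2 * e ^ 4) * l = k * ((x1\<^sup>2 + t\<^sup>2) * D1 * (x2\<^sup>2 + t\<^sup>2) * D2 -
       t * (2 * y1) * (2 * y2) * (x1\<^sup>2 - 2 * t * x1 - t\<^sup>2) * (x2\<^sup>2 - 2 * t * x2 - t\<^sup>2)) \<and>
    (X\<^sup>2 - 2 * t * X * e\<^sup>2 - t\<^sup>2 * e ^ 4) * l =
      k * ((x1\<^sup>2 - 2 * t * x1 - t\<^sup>2) * D1 * (x2\<^sup>2 - 2 * t * x2 - t\<^sup>2) * D2 -
       2 * t * (2 * y1) * (2 * y2) * (x1\<^sup>2 + t\<^sup>2) * (x2\<^sup>2 + t\<^sup>2))"
    using line
  proof (elim disjE conjE)
    assume "e = x2 - x1" "m = y2 - y1"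
    thus ?thesis
      using chord_identities[OF y] e unfolding X_def Y_def F_def D
      by (intro exI[of _ "e ^ 4"] exI conjI) (assumption | simp)+
  next
    assume *: "x2 = x1" "y2 = y1" "e = 2 * y1" "m = 3 * x1\<^sup>2 - t\<^sup>2"
    show ?thesis
      using tangent_identities[OF y(1)] unfolding X_def Y_def F_def D *
      by (intro exI[of _ 1]) simp
  qed
  then obtain k l where k: "k \<noteq> 0" and
    1: "(X\<^sup>2 + 2 * t * X * e\<^sup>2 - t\<^sup>2 * e ^ 4) * l = k * F" and
    2: "(2 * Y * e) * l = k * (2 * y1 * D1 * (x2\<^sup>2 + t\<^sup>2) * (x2\<^sup>2 - 2 * t * x2 - t\<^sup>2) +
       2 * y2 * D2 * (x1\<^sup>2 + t\<^sup>2) * (x1\<^sup>2 - 2 * t * x1 - t\<^sup>2))" and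
    3: "(X\<^sup>2 + t\<^sup>2 * e ^ 4) * l = k * ((x1\<^sup>2 + t\<^sup>2) * D1 * (x2\<^sup>2 + t\<^sup>2) * D2 -
       t * (2 * y1) * (2 * y2) * (x1\<^sup>2 - 2 * t * x1 - t\<^sup>2) * (x2\<^sup>2 - 2 * t * x2 - t\<^sup>2))" and
    4: "(X\<^sup>2 - 2 * t * X * e\<^sup>2 - t\<^sup>2 * e ^ 4) * l =
      k * ((x1\<^sup>2 - 2 * t * x1 - t\<^sup>2) * D1 * (x2\<^sup>2 - 2 * t * x2 - t\<^sup>2) * D2 -
       2 * t * (2 * y1) * (2 * y2) * (x1\<^sup>2 + t\<^sup>2) * (x2\<^sup>2 + t\<^sup>2))"
    by blast
  have l: "l \<noteq> 0" using 1 k F0 by auto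
  have frac: "a / b = c / d" if "a * l = k * c" "b * l = k * d" for a b c d
  proof -
    have "a / b = (a * l) / (b * l)" using l by simp
    also have "\<dots> = c / d" unfolding that using k by simp
    finally show ?thesis .
  qed
  show ?thesis
    unfolding X Y to_jacobi_chord_formula(1)[OF less_imp_neq[OF t, symmetric] e]
    unfolding to_jacobi.simps(2) D[symmetric] jacobi_add_fractions[OF D0] F_def[symmetric]
    by (simp only: frac[OF 2 1] frac[OF 3 1] frac[OF 4 1])
qed

text \<open>Closure under chord and tangent addition is inherited from the quadric model.\<close>

lemma affine_on_curve_of_to_jacobi:
  assumes "t > 0" "to_jacobi t (Affine x y) \<in> jacobi t"
  shows "Affine x y \<in> curve t"
proof -
  have D: "curve_den t x \<noteq> 0" using curve_den_nonzero assms by simp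
  have "((x\<^sup>2 + t\<^sup>2) / curve_den t x)\<^sup>2 = 1 - t * (2 * y / curve_den t x)\<^sup>2"
    using assms(2) by (simp add: jacobi_def)
  hence "(x\<^sup>2 + t\<^sup>2)\<^sup>2 = (curve_den t x)\<^sup>2 - 4 * t * y\<^sup>2"
    using D by (simp add: power_divide power_mult_distrib field_simps)
  hence "4 * t * y\<^sup>2 = 4 * t * (x ^ 3 - t\<^sup>2 * x)"
    unfolding curve_den_def by algebra
  thus ?thesis using assms(1) by simp
qed

lemma ec_add_to_jacobi:
  assumes t: "t > 0" and P: "P \<in> curve t" and Q: "Q \<in> curve t"
  shows "ec_add (- (t\<^sup>2)) P Q \<in> curve t \<and>
    to_jacobi t (ec_add (- (t\<^sup>2)) P Q) = jacobi_add t (to_jacobi t P) (to_jacobi t Q)"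
proof (cases "P = Infinity \<or> Q = Infinity")
  case True
  thus ?thesis
  proof
    assume "P = Infinity"
    thus ?thesis using Q jacobi_add_zero jacobi_add_commute[of t "(0, 1, 1)"] by simp
  next
    assume "Q = Infinity"
    moreover have "ec_add (- (t\<^sup>2)) P Infinity = P" by (cases P) auto
    ultimately show ?thesis using P jacobi_add_zero by simp
  qed
next
  case False
  then obtain x1 y1 x2 y2 where PQ: "P = Affine x1 y1" "Q = Affine x2 y2"
    by (meson ec_point.exhaust)
  show ?thesis
  proof (cases "x1 = x2 \<and> y1 = - y2")
    case True
    have "to_jacobi t Q = jacobi_minus (to_jacobi t P)" using True by (simp add: PQ)
    thus ?thesis using True jacobi_add_minus[OF t to_jacobi_closed[OF t P]]
      by (simp add: PQ del: jacobi_add.simps)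
  next
    case neq: False
    \<comment> \<open>Two points with equal x that are not opposite coincide and have y different
      from 0, so the slope is that of the tangent.\<close>
    define m e where "m = (if x1 = x2 then 3 * x1\<^sup>2 - t\<^sup>2 else y2 - y1)"
      and "e = (if x1 = x2 then 2 * y1 else x2 - x1)"
    define x3 where "x3 = (m / e)\<^sup>2 - x1 - x2"
    have y: "y1 = y2 \<and> y1 \<noteq> 0" if "x1 = x2"
    proof -
      have "y1\<^sup>2 = y2\<^sup>2" using that P Q by (simp add: PQ)
      thus ?thesis using neq that by (auto simp: power2_eq_iff)
    qed
    hence e: "e \<noteq> 0" by (auto simp: e_def)
    have sum: "ec_add (- (t\<^sup>2)) P Q = Affine x3 (m / e * (x1 - x3) - y1)"
      using neq by (auto simp: PQ x3_def m_def e_def Let_def)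
    have "e = x2 - x1 \<and> m = y2 - y1 \<or> x2 = x1 \<and> y2 = y1 \<and> e = 2 * y1 \<and> m = 3 * x1\<^sup>2 - t\<^sup>2"
      using y by (auto simp: m_def e_def)
    from to_jacobi_chord[OF t P[unfolded PQ] Q[unfolded PQ] e this x3_def refl]
    have hom: "to_jacobi t (ec_add (- (t\<^sup>2)) P Q) = jacobi_add t (to_jacobi t P) (to_jacobi t Q)"
      unfolding sum unfolding PQ .
    hence "to_jacobi t (ec_add (- (t\<^sup>2)) P Q) \<in> jacobi t"
      using jacobi_add_closed[OF t] to_jacobi_closed[OF t] P Q by simp
    with hom show ?thesis using affine_on_curve_of_to_jacobi[OF t] unfolding sum by blast
  qed
qed

lemma to_jacobi_eq_iff:
  assumes "t > 0" "P \<in> curve t" "Q \<in> curve t"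
  shows "to_jacobi t P = to_jacobi t Q \<longleftrightarrow> P = Q"
  using from_to_jacobi[OF assms(1)] assms by metis

abbreviation congruent_rat_curve :: "rat \<Rightarrow> rat ec_point monoid" where
  "congruent_rat_curve t \<equiv> ec_group (- (t\<^sup>2)) 0"

lemma ec_group_sel:
  "carrier (congruent_rat_curve t) = curve t"
  "mult (congruent_rat_curve t) = ec_add (- (t\<^sup>2))"
  "one (congruent_rat_curve t) = Infinity"
  by (auto simp: ec_group_def curve_def)

text \<open>All axioms are pulled back along the injective map \<open>to_jacobi\<close>, so
  associativity of \<open>ec_add\<close> requires no distinction between chords and
  tangents.\<close>

lemma comm_group_congruent_curve:
  assumes t: "t > 0"
  shows "comm_group (congruent_rat_curve t)"
proof (rule comm_groupI; unfold ec_group_sel)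
  note closed = to_jacobi_closed[OF t] and hom = ec_add_to_jacobi[OF t]
    and inj = to_jacobi_eq_iff[OF t, THEN iffD1]
  fix P assume P: "P \<in> curve t"
  define Q where "Q = from_jacobi t (jacobi_minus (to_jacobi t P))"
  have mem: "jacobi_minus (to_jacobi t P) \<in> jacobi t"
    using closed P jacobi_minus_closed by blast
  have Q: "Q \<in> curve t" "to_jacobi t Q = jacobi_minus (to_jacobi t P)"
    using from_jacobi_closed[OF t mem] by (auto simp: Q_def)
  have "to_jacobi t (ec_add (- (t\<^sup>2)) Q P) = to_jacobi t Infinity"
    using hom[OF Q(1) P] Q(2) jacobi_add_minus[OF t closed[OF P]] jacobi_add_commute by simp
  hence "ec_add (- (t\<^sup>2)) Q P = Infinity"
    by (intro inj) (use hom P Q in simp_all)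
  thus "\<exists>Q\<in>curve t. ec_add (- (t\<^sup>2)) Q P = Infinity" using Q(1) by blast
  show "ec_add (- (t\<^sup>2)) Infinity P = P" by simp
  fix Q assume Q: "Q \<in> curve t"
  show "ec_add (- (t\<^sup>2)) P Q \<in> curve t" using hom P Q by blast
  have "to_jacobi t (ec_add (- (t\<^sup>2)) P Q) = to_jacobi t (ec_add (- (t\<^sup>2)) Q P)"
    using hom P Q jacobi_add_commute by simp
  thus "ec_add (- (t\<^sup>2)) P Q = ec_add (- (t\<^sup>2)) Q P"
    by (intro inj) (use hom P Q in simp_all)
  fix R assume R: "R \<in> curve t"
  have "to_jacobi t (ec_add (- (t\<^sup>2)) (ec_add (- (t\<^sup>2)) P Q) R) =
        to_jacobi t (ec_add (- (t\<^sup>2)) P (ec_add (- (t\<^sup>2)) Q R))"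
    using hom P Q R jacobi_add_assoc[OF t] closed by simp
  thus "ec_add (- (t\<^sup>2)) (ec_add (- (t\<^sup>2)) P Q) R = ec_add (- (t\<^sup>2)) P (ec_add (- (t\<^sup>2)) Q R)"
    by (intro inj) (use hom P Q R in simp_all)
qed simp

section \<open>Counting points in groups with a height\<close>

text \<open>The decrements b j - b (j + 1) shrink by at most M per step. A large first decrement D
  would therefore push the sequence below 0: nonnegativity forces D <= b 1 / j + M (j + 1) / 2 for
  every positive j.\<close>

lemma sqrt_le_of_bounded_second_difference:
  fixes b :: "nat \<Rightarrow> real"
  assumes nonneg: "\<And>j. b j \<ge> 0" and M: "M \<ge> 0"
    and conv: "\<And>j. b j + b (Suc (Suc j)) \<le> 2 * b (Suc j) + M"
  shows "sqrt (b 0) \<le> sqrt (b 1) + 1 + M"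
proof -
  define D where "D = b 0 - b 1"
  have diff: "b j - b (Suc j) \<ge> D - real j * M" for j
  proof (induction j)
    case (Suc j)
    thus ?case using conv[of j] by (simp add: algebra_simps)
  qed (simp add: D_def)
  have low: "b (Suc j) \<le> b 1 - real j * D + M * real j * (real j + 1) / 2" for j
  proof (induction j)
    case (Suc j)
    thus ?case using diff[of "Suc j"] by (simp add: algebra_simps add_divide_distrib)
  qed simp
  define y where "y = sqrt (b 1)"
  have y: "y \<ge> 0" "b 1 = y\<^sup>2" using nonneg by (simp_all add: y_def)
  \<comment> \<open>Taking j close to sqrt (b 1) balances the two terms of the bound for D.\<close>
  define j where "j = nat \<lfloor>y\<rfloor> + 1"
  have j: "y \<le> real j" "real j \<le> y + 1" "real j > 0"
    using y by (simp_all add: j_def) linarith+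
  have "real j * D \<le> b 1 + M * real j * (real j + 1) / 2"
    using low[of j] nonneg[of "Suc j"] by simp
  also have "b 1 \<le> real j * y"
    using j y by (simp add: power2_eq_square mult_right_mono)
  also have "M * real j * (real j + 1) / 2 \<le> M * real j * (y + 2) / 2"
    using j M by (intro divide_right_mono mult_left_mono) auto
  finally have "real j * D \<le> real j * (y + M * (y + 2) / 2)"
    by (simp add: algebra_simps)
  hence "D \<le> y + M * (y + 2) / 2" using j(3) by simp
  hence "b 0 \<le> y\<^sup>2 + y + M * (y + 2) / 2" using y by (simp add: D_def)
  also have "\<dots> \<le> (y + 1 + M)\<^sup>2"
    using y(1) M by (simp add: power2_eq_square algebra_simps)
  finally have "sqrt (b 0) \<le> y + 1 + M"
    using y(1) M by (simp add: real_le_lsqrt)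
  thus ?thesis by (simp add: y_def)
qed

text \<open>The map b / 2 + C fixes 2 C and sends 2 C + 2^(n+1) to 2 C + 2^n. After n steps the
  factor is (2^m)^n = (2^n)^m, with 2^n at most 2 (1 + b).\<close>

lemma polynomial_growth_of_halving:
  fixes N :: "real \<Rightarrow> real"
  assumes mono: "\<And>a b. a \<le> b \<Longrightarrow> N a \<le> N b" and nonneg: "\<And>a. N a \<ge> 0"
    and halve: "\<And>b. N b \<le> 2 ^ m * N (b / 2 + C)" and C: "C \<ge> 0" and b: "b \<ge> 0"
  shows "N b \<le> 2 ^ m * N (2 * C + 1) * (1 + b) ^ m"
proof -
  have it: "N (2 * C + 2 ^ n) \<le> (2 ^ m) ^ n * N (2 * C + 1)" for n
  proof (induction n)
    case (Suc n)
    have "N (2 * C + 2 ^ Suc n) \<le> 2 ^ m * N (2 * C + 2 ^ n)"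
      using halve[of "2 * C + 2 ^ Suc n"] by (simp add: algebra_simps add_divide_distrib)
    also have "\<dots> \<le> 2 ^ m * ((2 ^ m) ^ n * N (2 * C + 1))"
      using Suc by simp
    finally show ?case by simp
  qed simp
  obtain n :: nat where n: "b \<le> 2 ^ n" "2 ^ n \<le> 2 * (1 + b)"
  proof -
    define n where "n = (LEAST n. b \<le> 2 ^ n)"
    obtain k :: nat where "b < 2 ^ k" using real_arch_pow[of 2 b] by auto
    hence 1: "b \<le> 2 ^ n" unfolding n_def by (rule LeastI[of _ k, OF less_imp_le])
    have "2 ^ n \<le> 2 * (1 + b)"
    proof (cases n)
      case (Suc l)
      hence "\<not> b \<le> 2 ^ l" unfolding n_def by (intro not_less_Least) simp
      thus ?thesis using Suc b by simp
    qed (use b in simp)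
    with 1 that show ?thesis by blast
  qed
  have "N b \<le> N (2 * C + 2 ^ n)" using n C by (intro mono) simp
  also have "\<dots> \<le> (2 ^ n) ^ m * N (2 * C + 1)" using it[of n] by (simp add: mult.commute flip: power_mult)
  also have "\<dots> \<le> (2 * (1 + b)) ^ m * N (2 * C + 1)"
    using n nonneg by (intro mult_right_mono power_mono) auto
  finally show ?thesis by (simp only: power_mult_distrib ac_simps)
qed

lemma card_le_of_fibres:
  assumes "finite A" "\<And>y. y \<in> f ` A \<Longrightarrow> card {x \<in> A. f x = y} \<le> k"
  shows "card A \<le> k * card (f ` A)"
proof -
  have "card A = (\<Sum>y\<in>f ` A. card {x \<in> A. f x = y})"
    using sum.image_gen[OF assms(1), of "\<lambda>_. 1 :: nat" f] by simp
  also have "\<dots> \<le> (\<Sum>y\<in>f ` A. k)" using assms(2) by (intro sum_mono) auto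
  finally show ?thesis by (simp add: mult.commute)
qed

section \<open>Integer combinations and independence in an abelian group\<close>

context comm_group
begin

definition combination :: "'a set \<Rightarrow> ('a \<Rightarrow> int) \<Rightarrow> 'a" where
  "combination S c = finprod G (\<lambda>P. P [^] c P) S"

lemma combination_closed [simp]: "S \<subseteq> carrier G \<Longrightarrow> combination S c \<in> carrier G"
  unfolding combination_def by (intro finprod_closed) auto

lemma combination_cong:
  assumes "S \<subseteq> carrier G" "\<And>P. P \<in> S \<Longrightarrow> c P = d P"
  shows "combination S c = combination S d"
  unfolding combination_def using assms by (intro finprod_cong) (auto simp: simp_implies_def)

lemma combination_mult:
  assumes "S \<subseteq> carrier G"
  shows "combination S c \<otimes> combination S d = combination S (\<lambda>P. c P + d P)"
proof -
  have "combination S (\<lambda>P. c P + d P) = finprod G (\<lambda>P. P [^] c P \<otimes> P [^] d P) S"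
    unfolding combination_def using assms
    by (intro finprod_cong) (auto simp: simp_implies_def int_pow_mult)
  also have "\<dots> = combination S c \<otimes> combination S d"
    unfolding combination_def using assms by (intro finprod_multf) auto
  finally show ?thesis by simp
qed

lemma combination_zero [simp]: "combination S (\<lambda>_. 0) = \<one>"
  by (simp add: combination_def)

lemma combination_inv:
  assumes "S \<subseteq> carrier G"
  shows "inv (combination S c) = combination S (\<lambda>P. - c P)"
  using combination_mult[OF assms, of "\<lambda>P. - c P" c] assms
  by (intro inv_equality) auto

lemma combination_insert:
  assumes "finite S" "S \<subseteq> carrier G" "P \<in> carrier G" "P \<notin> S"
  shows "combination (insert P S) c = P [^] c P \<otimes> combination S c"
  unfolding combination_def using assms by (intro finprod_insert) auto

lemma int_independent_iff:
  "int_independent G S \<longleftrightarrow> finite S \<and> S \<subseteq> carrier G \<and>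
     (\<forall>c. combination S c = \<one> \<longrightarrow> (\<forall>P\<in>S. c P = 0))"
  by (simp add: int_independent_def combination_def)

lemma combination_inject:
  assumes "int_independent G S" "combination S c = combination S d" "P \<in> S"
  shows "c P = d P"
proof -
  have S: "S \<subseteq> carrier G" using assms by (simp add: int_independent_iff)
  have "combination S (\<lambda>P. c P - d P) = combination S c \<otimes> inv (combination S d)"
    using combination_mult[OF S, of c "\<lambda>P. - d P"] combination_inv[OF S, of d] by simp
  also have "\<dots> = \<one>" using assms(2) S by simp
  finally have "c P - d P = 0"
    using assms(1,3) unfolding int_independent_iff by blast
  thus ?thesis by simp
qed

end

text \<open>\<open>h\<close> is a logarithmic height that satisfies the upper half of the approximate parallelogram
  law, but the lower half only on the diagonal; this already suffices to count points without
  passing to the canonical height.\<close>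

locale height_group = comm_group +
  fixes h :: "'a \<Rightarrow> real" and \<kappa> :: real and R :: "'a set"
  assumes height_nonneg: "P \<in> carrier G \<Longrightarrow> 0 \<le> h P"
    and northcott: "finite {P \<in> carrier G. h P \<le> B}"
    and parallelogram: "\<lbrakk>P \<in> carrier G; Q \<in> carrier G\<rbrakk> \<Longrightarrow>
      h (P \<otimes> Q) + h (P \<otimes> inv Q) \<le> 2 * h P + 2 * h Q"
    and height_double: "P \<in> carrier G \<Longrightarrow> 4 * h P \<le> h (P \<otimes> P) + \<kappa>"
    and finite_cosets: "finite R" and cosets_closed: "R \<subseteq> carrier G"
    and halve: "P \<in> carrier G \<Longrightarrow> \<exists>Q\<in>carrier G. \<exists>\<rho>\<in>R. P = Q \<otimes> Q \<otimes> \<rho>"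
begin

section \<open>Translation and halving of root heights\<close>

definition root_height :: "'a \<Rightarrow> real" where
  "root_height P = sqrt (h P)"

lemma root_height_nonneg: "P \<in> carrier G \<Longrightarrow> 0 \<le> root_height P"
  by (simp add: root_height_def height_nonneg)

lemma kappa_nonneg: "0 \<le> \<kappa>"
  using height_double[of \<one>] height_nonneg[of \<one>] by simp

lemma finite_root_height: "finite {P \<in> carrier G. root_height P \<le> b}"
proof (rule finite_subset)
  show "{P \<in> carrier G. root_height P \<le> b} \<subseteq> {P \<in> carrier G. h P \<le> b\<^sup>2}"
    by (auto simp: root_height_def dest: sqrt_le_D)
qed (rule northcott)

text \<open>Along P + Q, P, P - Q, P - 2 Q, ... the parallelogram inequality bounds the second
  differences of h by 2 h(Q). The sequence lemma turns this one-sided information into a bounded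
  change of the root height.\<close>

lemma root_height_mult:
  assumes P: "P \<in> carrier G" and Q: "Q \<in> carrier G"
  shows "root_height (P \<otimes> Q) \<le> root_height P + (1 + 2 * h Q)"
proof -
  define b where "b j = h (P \<otimes> Q \<otimes> inv Q [^] j)" for j :: nat
  have "sqrt (b 0) \<le> sqrt (b 1) + 1 + 2 * h Q"
  proof (rule sqrt_le_of_bounded_second_difference)
    fix j
    let ?X = "P \<otimes> Q \<otimes> inv Q [^] Suc j"
    have "?X \<otimes> inv Q = P \<otimes> Q \<otimes> inv Q [^] Suc (Suc j)"
      using P Q by (simp add: m_assoc)
    moreover have "?X \<otimes> Q = P \<otimes> Q \<otimes> inv Q [^] j"
      using P Q by (simp add: m_assoc)
    ultimately show "b j + b (Suc (Suc j)) \<le> 2 * b (Suc j) + 2 * h Q"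
      using parallelogram[of ?X Q] P Q by (simp add: b_def)
  qed (use P Q height_nonneg in \<open>simp_all add: b_def\<close>)
  moreover have "P \<otimes> Q \<otimes> inv Q = P" using P Q by (simp add: m_assoc)
  ultimately show ?thesis using P Q by (simp add: b_def root_height_def)
qed

lemma root_height_mult_pow:
  assumes "P \<in> carrier G" "Q \<in> carrier G"
  shows "root_height (P \<otimes> Q [^] n) \<le> root_height P + real n * (1 + 2 * h Q)"
proof (induction n)
  case (Suc n)
  have "P \<otimes> Q [^] Suc n = P \<otimes> Q [^] n \<otimes> Q" using assms by (simp add: m_assoc)
  thus ?case using root_height_mult[of "P \<otimes> Q [^] n" Q] assms Suc by (simp add: algebra_simps)
qed (use assms in simp)

text \<open>Take roots in 4 h(Q) <= h(2 Q) + \<kappa>, and reach 2 Q from 2 Q + \<rho> by a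
  translation with the inverse of \<rho>.\<close>

lemma root_height_halve:
  assumes Q: "Q \<in> carrier G" and r: "\<rho> \<in> carrier G"
  shows "root_height Q \<le> root_height (Q \<otimes> Q \<otimes> \<rho>) / 2 + (1 + 2 * h (inv \<rho>) + sqrt \<kappa>) / 2"
proof -
  have "2 * root_height Q = sqrt (4 * h Q)"
    by (simp add: root_height_def real_sqrt_mult)
  also have "\<dots> \<le> sqrt (h (Q \<otimes> Q) + \<kappa>)" using height_double[OF Q] by simp
  also have "\<dots> \<le> root_height (Q \<otimes> Q) + sqrt \<kappa>"
    unfolding root_height_def using height_nonneg Q kappa_nonneg by (intro sqrt_add_le_add_sqrt) auto
  also have "Q \<otimes> Q = Q \<otimes> Q \<otimes> \<rho> \<otimes> inv \<rho>" using Q r by (simp add: m_assoc)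
  also have "root_height \<dots> \<le> root_height (Q \<otimes> Q \<otimes> \<rho>) + (1 + 2 * h (inv \<rho>))"
    using Q r by (intro root_height_mult) auto
  finally show ?thesis by (simp add: field_simps)
qed

text \<open>A sum in place of a maximum: the summands are nonnegative, so it dominates the constant
  of \<open>root_height_halve\<close> for each representative.\<close>

definition descent_const :: "'a set \<Rightarrow> real" where
  "descent_const R' = (\<Sum>\<rho>\<in>R'. (1 + 2 * h (inv \<rho>) + sqrt \<kappa>) / 2)"

lemma descent_const_nonneg: "R' \<subseteq> carrier G \<Longrightarrow> 0 \<le> descent_const R'"
  unfolding descent_const_def using kappa_nonneg
  by (intro sum_nonneg divide_nonneg_nonneg add_nonneg_nonneg) (auto intro!: height_nonneg)

lemma root_height_descent:
  assumes "finite R'" "R' \<subseteq> carrier G" "\<rho> \<in> R'" "Q \<in> carrier G"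
  shows "root_height Q \<le> root_height (Q \<otimes> Q \<otimes> \<rho>) / 2 + descent_const R'"
proof -
  have "(1 + 2 * h (inv \<rho>) + sqrt \<kappa>) / 2 \<le> descent_const R'"
    unfolding descent_const_def using assms kappa_nonneg
    by (intro member_le_sum divide_nonneg_nonneg add_nonneg_nonneg) (auto intro!: height_nonneg)
  moreover have "\<rho> \<in> carrier G" using assms by blast
  note root_height_halve[OF assms(4) this]
  ultimately show ?thesis by linarith
qed

text \<open>Halving a point of A stays in A and roughly halves the root height, with at most 2^m
  choices of \<rho>. It is applied to the whole group, to bound the rank, and to the span of
  independent points, where m is their number.\<close>

lemma count_of_halving:
  assumes A: "A \<subseteq> carrier G" and R': "finite R'" "R' \<subseteq> carrier G" "card R' \<le> 2 ^ m"
    and halve: "\<And>P. P \<in> A \<Longrightarrow> \<exists>Q\<in>A. \<exists>\<rho>\<in>R'. P = Q \<otimes> Q \<otimes> \<rho>"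
  shows "\<exists>K\<ge>0. \<forall>b\<ge>0. real (card {P \<in> A. root_height P \<le> b}) \<le> K * (1 + b) ^ m"
proof -
  define N where "N b = real (card {P \<in> A. root_height P \<le> b})" for b
  let ?C = "descent_const R'"
  have fin: "finite {P \<in> A. root_height P \<le> b}" for b
    by (rule finite_subset[OF _ finite_root_height[of b]]) (use A in auto)
  have mono: "N a \<le> N b" if "a \<le> b" for a b
    unfolding N_def using that fin by (auto intro!: card_mono)
  have "N b \<le> 2 ^ m * N (b / 2 + ?C)" for b
  proof -
    let ?B = "{P \<in> A. root_height P \<le> b / 2 + ?C}"
    have "{P \<in> A. root_height P \<le> b} \<subseteq> (\<lambda>(Q, \<rho>). Q \<otimes> Q \<otimes> \<rho>) ` (?B \<times> R')"
    proof
      fix P assume P: "P \<in> {P \<in> A. root_height P \<le> b}"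
      hence "P \<in> A" by blast
      then obtain Q \<rho> where Q: "Q \<in> A" "\<rho> \<in> R'" "P = Q \<otimes> Q \<otimes> \<rho>"
        using halve by blast
      with root_height_descent[OF R'(1,2), of \<rho> Q] A P have "Q \<in> ?B" by auto
      with Q show "P \<in> (\<lambda>(Q, \<rho>). Q \<otimes> Q \<otimes> \<rho>) ` (?B \<times> R')" by auto
    qed
    hence "card {P \<in> A. root_height P \<le> b} \<le> card (?B \<times> R')"
      using fin R'(1) by (intro surj_card_le) auto
    also have "\<dots> \<le> card ?B * 2 ^ m" using R'(3) by (simp add: card_cartesian_product)
    finally have "real (card {P \<in> A. root_height P \<le> b}) \<le> real (card ?B * 2 ^ m)"
      by (rule of_nat_mono)
    thus ?thesis unfolding N_def by (simp add: mult.commute)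
  qed
  from polynomial_growth_of_halving[of N m ?C, OF mono _ this descent_const_nonneg[OF R'(2)]]
  have "N b \<le> 2 ^ m * N (2 * ?C + 1) * (1 + b) ^ m" if "b \<ge> 0" for b
    using that by (simp add: N_def)
  moreover have "2 ^ m * N (2 * ?C + 1) \<ge> 0" by (simp add: N_def)
  ultimately show ?thesis unfolding N_def by blast
qed

text \<open>Linear growth in M: a box of coefficients of side M lands in a ball of radius
  O(M).\<close>

lemma root_height_combination:
  assumes "finite S" "S \<subseteq> carrier G" "\<And>P. P \<in> S \<Longrightarrow> 0 \<le> c P \<and> c P \<le> int M"
  shows "root_height (combination S c) \<le> root_height \<one> + real M * (\<Sum>P\<in>S. 1 + 2 * h P)"
  using assms
proof (induction S rule: finite_induct)
  case empty
  thus ?case by (simp add: combination_def)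
next
  case (insert P S)
  have P: "P \<in> carrier G" "0 \<le> h P" using insert.prems height_nonneg by auto
  have "P [^] c P = P [^] nat (c P)"
    using insert.prems by (simp flip: int_pow_int)
  hence eq: "combination (insert P S) c = combination S c \<otimes> P [^] nat (c P)"
    using insert by (simp add: combination_insert m_comm)
  have "root_height (combination (insert P S) c) \<le>
      root_height (combination S c) + real (nat (c P)) * (1 + 2 * h P)"
    unfolding eq using insert.prems by (intro root_height_mult_pow) auto
  also have "real (nat (c P)) * (1 + 2 * h P) \<le> real M * (1 + 2 * h P)"
    using insert.prems(2)[of P] P by (intro mult_right_mono) auto
  finally show ?case using insert by (simp add: algebra_simps)
qed

text \<open>The (M + 1)^(card S) combinations with coefficients from 0 to M are distinct and have
  root height O(M), whereas only O(M^m) points do. This fails for large M if card S > m.\<close>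

lemma independent_card_le:
  assumes S: "int_independent G S" and m: "card R \<le> 2 ^ m"
  shows "card S \<le> m"
proof (rule ccontr)
  assume "\<not> card S \<le> m"
  hence n: "Suc m \<le> card S" by simp
  have S': "finite S" "S \<subseteq> carrier G" using S by (auto simp: int_independent_iff)
  obtain K where K: "K \<ge> 0"
    "\<And>b. b \<ge> 0 \<Longrightarrow> real (card {P \<in> carrier G. root_height P \<le> b}) \<le> K * (1 + b) ^ m"
    using count_of_halving[OF subset_refl finite_cosets cosets_closed m halve] by blast
  define l where "l = (\<Sum>P\<in>S. 1 + 2 * h P)"
  define w where "w = root_height \<one>"
  have "0 \<le> 1 + 2 * h P" if "P \<in> S" for P
    using height_nonneg[of P] that S'(2) by auto
  hence l: "l \<ge> 0" unfolding l_def by (intro sum_nonneg)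
  have w: "w \<ge> 0" by (simp add: w_def root_height_nonneg)
  have bound: "real (Suc M) \<le> K * (1 + w + l) ^ m" for M
  proof -
    let ?F = "PiE S (\<lambda>_. {0..int M})"
    let ?B = "{P \<in> carrier G. root_height P \<le> w + real M * l}"
    have inj: "inj_on (combination S) ?F"
    proof (rule inj_onI)
      fix c d assume cd: "c \<in> ?F" "d \<in> ?F" "combination S c = combination S d"
      show "c = d" using combination_inject[OF S cd(3)] cd(1,2) by (intro PiE_ext) auto
    qed
    have "combination S ` ?F \<subseteq> ?B"
    proof (intro subsetI, elim imageE)
      fix P c assume P: "P = combination S c" and c: "c \<in> ?F"
      have "root_height (combination S c) \<le> w + real M * l"
        unfolding w_def l_def using c by (intro root_height_combination[OF S']) auto
      thus "P \<in> ?B" using P S' by simp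
    qed
    hence "card ?F \<le> card ?B"
      using card_inj_on_le[OF inj _ finite_root_height] by blast
    moreover have "card ?F = Suc M ^ card S" using S' by (simp add: card_PiE nat_add_distrib)
    ultimately have "real (Suc M) ^ card S \<le> real (card ?B)"
      by (metis of_nat_le_iff of_nat_power)
    also have "\<dots> \<le> K * (1 + (w + real M * l)) ^ m" using w l by (intro K) simp
    also have "\<dots> \<le> K * (real (Suc M) * (1 + w + l)) ^ m"
      using K(1) w l by (intro mult_left_mono power_mono) (auto simp: algebra_simps)
    finally have "real (Suc M) ^ card S \<le> K * (1 + w + l) ^ m * real (Suc M) ^ m"
      by (simp only: power_mult_distrib ac_simps)
    moreover have "real (Suc M) ^ Suc m \<le> real (Suc M) ^ card S"
      using n by (intro power_increasing) auto
    ultimately have "real (Suc M) * real (Suc M) ^ m \<le> K * (1 + w + l) ^ m * real (Suc M) ^ m"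
      unfolding power_Suc by linarith
    thus ?thesis by (rule mult_right_le_imp_le) simp
  qed
  obtain M :: nat where "K * (1 + w + l) ^ m < real M" using reals_Archimedean2 by blast
  with bound[of M] show False by simp
qed

text \<open>\<open>GREATEST\<close> is attained because the sizes of independent sets are bounded;
  \<open>card R\<close> is such a bound, as n <= 2^n.\<close>

lemma group_rank_props:
  shows "\<exists>S. int_independent G S \<and> card S = group_rank G"
    and "int_independent G S \<Longrightarrow> card S \<le> group_rank G"
proof -
  have m: "card R \<le> 2 ^ card R" by (simp add: less_imp_le)
  let ?P = "\<lambda>n. \<exists>S. int_independent G S \<and> card S = n"
  have bdd: "\<forall>n. ?P n \<longrightarrow> n \<le> card R" using independent_card_le[OF _ m] by blast
  have "?P 0" by (rule exI[of _ "{}"]) (simp add: int_independent_iff)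
  thus "\<exists>S. int_independent G S \<and> card S = group_rank G"
    unfolding group_rank_def using bdd by (intro GreatestI_nat[of ?P 0 "card R"]) auto
  show "card S \<le> group_rank G" if "int_independent G S"
    unfolding group_rank_def using bdd that by (intro Greatest_le_nat[of ?P _ "card R"]) auto
qed

section \<open>The span of a maximal independent set and the count of all points\<close>

definition span :: "'a set \<Rightarrow> 'a set" where
  "span S = range (combination S)"

lemma span_closed: "S \<subseteq> carrier G \<Longrightarrow> span S \<subseteq> carrier G"
  by (auto simp: span_def)

lemma span_mult: "S \<subseteq> carrier G \<Longrightarrow> P \<in> span S \<Longrightarrow> Q \<in> span S \<Longrightarrow> P \<otimes> Q \<in> span S"
  by (auto simp: span_def combination_mult)

lemma span_inv: "S \<subseteq> carrier G \<Longrightarrow> P \<in> span S \<Longrightarrow> inv P \<in> span S"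
  by (auto simp: span_def combination_inv)

lemma span_pow: "S \<subseteq> carrier G \<Longrightarrow> P \<in> span S \<Longrightarrow> P [^] (n::nat) \<in> span S"
proof (induction n)
  case 0
  show ?case by (auto simp: span_def intro: range_eqI[of _ _ "\<lambda>_. 0"])
qed (auto simp: span_mult)

text \<open>Dividing each coefficient by 2 with remainder writes every element as q + q + e, where e
  has coefficients 0 or 1. So 2^(card S) representatives suffice, and torsion of the ambient group
  does not enter the exponent.\<close>

lemma count_span:
  assumes S: "finite S" "S \<subseteq> carrier G"
  shows "\<exists>K\<ge>0. \<forall>b\<ge>0. real (card {P \<in> span S. root_height P \<le> b}) \<le> K * (1 + b) ^ card S"
proof (rule count_of_halving)
  let ?E = "PiE S (\<lambda>_. {0, 1 :: int})"
  show "span S \<subseteq> carrier G" "combination S ` ?E \<subseteq> carrier G"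
    using S by (auto simp: span_def)
  show "finite (combination S ` ?E)" using S by (intro finite_imageI finite_PiE) auto
  have "card (combination S ` ?E) \<le> card ?E"
    using S by (intro card_image_le finite_PiE) auto
  thus "card (combination S ` ?E) \<le> 2 ^ card S" using S by (simp add: card_PiE numeral_2_eq_2)
  fix P assume "P \<in> span S"
  then obtain c where P: "P = combination S c" by (auto simp: span_def)
  define q where "q = combination S (\<lambda>P. c P div 2)"
  define e where "e = combination S (restrict (\<lambda>P. c P mod 2) S)"
  have "q \<otimes> q = combination S (\<lambda>P. c P div 2 + c P div 2)"
    using S by (simp add: q_def combination_mult)
  hence "q \<otimes> q \<otimes> e = combination S (\<lambda>P. c P div 2 + c P div 2 + restrict (\<lambda>P. c P mod 2) S P)"
    using S by (simp add: e_def combination_mult)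
  also have "\<dots> = P"
    unfolding P using S by (intro combination_cong) auto
  finally have "P = q \<otimes> q \<otimes> e" by simp
  moreover have "q \<in> span S" by (simp add: q_def span_def)
  moreover have "e \<in> combination S ` ?E"
    unfolding e_def by (intro imageI) (auto simp: PiE_iff extensional_def)
  ultimately show "\<exists>Q\<in>span S. \<exists>\<rho>\<in>combination S ` ?E. P = Q \<otimes> Q \<otimes> \<rho>" by blast
qed

text \<open>By maximality P satisfies a relation with S, and independence of S makes the coefficient
  of P nonzero. Points of S are treated apart, since inserting them does not enlarge the
  set.\<close>

lemma multiple_in_span:
  assumes S: "int_independent G S" "card S = group_rank G" and P: "P \<in> carrier G"
  shows "\<exists>n>0. P [^] (n::nat) \<in> span S"
proof (cases "P \<in> S")
  case True
  have S': "finite S" "S \<subseteq> carrier G" using S by (auto simp: int_independent_iff)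
  define c where "c = (\<lambda>Q. if Q = P then 1 else 0 :: int)"
  have "combination S c = finprod G (\<lambda>Q. if P = Q then Q else \<one>) S"
    unfolding combination_def using S'
    by (intro finprod_cong) (auto simp: simp_implies_def c_def)
  also have "\<dots> = P" using finprod_singleton[OF True S'(1), of "\<lambda>Q. Q"] S'(2) by auto
  finally have "P [^] (1::nat) \<in> span S" using P by (auto simp: span_def intro: range_eqI[of _ _ c])
  thus ?thesis by blast
next
  case False
  have S': "finite S" "S \<subseteq> carrier G" using S by (auto simp: int_independent_iff)
  have "\<not> int_independent G (insert P S)"
    using group_rank_props(2)[of "insert P S"] False S'(1) S(2) by auto
  then obtain c where c: "combination (insert P S) c = \<one>" "\<not> (\<forall>Q\<in>insert P S. c Q = 0)"
    using S' P unfolding int_independent_iff by auto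
  have eq: "P [^] c P \<otimes> combination S c = \<one>"
    using c(1) False S' P by (simp add: combination_insert)
  have "c P \<noteq> 0"
  proof
    assume "c P = 0"
    hence "combination S c = \<one>" using eq S' by simp
    thus False using \<open>c P = 0\<close> c(2) S(1) unfolding int_independent_iff by blast
  qed
  have "P [^] c P = inv (combination S c)"
    using eq S' P by (metis combination_closed int_pow_closed inv_equality)
  hence mem: "P [^] c P \<in> span S" using span_inv[OF S'(2)] by (simp add: span_def)
  have "P [^] int (nat \<bar>c P\<bar>) \<in> span S"
  proof (cases "c P \<ge> 0")
    case True
    thus ?thesis using mem by simp
  next
    case False
    hence "P [^] int (nat \<bar>c P\<bar>) = inv (P [^] c P)" using P by (simp add: int_pow_neg)
    thus ?thesis using span_inv[OF S'(2) mem] by simp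
  qed
  hence "P [^] nat \<bar>c P\<bar> \<in> span S" by (simp only: int_pow_int)
  thus ?thesis using \<open>c P \<noteq> 0\<close> by (intro exI[of _ "nat \<bar>c P\<bar>"]) auto
qed

text \<open>Descent builds every point from finitely many small points and representatives by the
  operation Q + Q + \<rho>, under which the property is closed for fixed n. The finite set needs
  only the product of its exponents.\<close>

lemma uniform_multiple_in_span:
  assumes S: "int_independent G S" "card S = group_rank G"
  shows "\<exists>n>0. \<forall>P\<in>carrier G. P [^] (n::nat) \<in> span S"
proof -
  have S': "finite S" "S \<subseteq> carrier G" using S by (auto simp: int_independent_iff)
  let ?C = "descent_const R"
  \<comment> \<open>2 C is fixed by b / 2 + C, so halving takes radius 2 C + 2^(k+1) to 2 C + 2^k
    and ends at 2 C + 1.\<close>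
  define F where "F = {P \<in> carrier G. root_height P \<le> 2 * ?C + 1} \<union> R"
  have "finite F" "F \<subseteq> carrier G"
    using finite_root_height finite_cosets cosets_closed by (auto simp: F_def)
  hence "\<exists>n>0. \<forall>P\<in>F. P [^] (n::nat) \<in> span S"
  proof (induction F rule: finite_induct)
    case (insert P F)
    then obtain n where n: "n > 0" "\<forall>P\<in>F. P [^] (n::nat) \<in> span S" by auto
    obtain k where k: "k > 0" "P [^] (k::nat) \<in> span S"
      using multiple_in_span[OF S] insert.prems by auto
    have "Q [^] (n * k) \<in> span S" if "Q \<in> insert P F" for Q
    proof (cases "Q = P")
      case True
      thus ?thesis using span_pow[OF S'(2) k(2), of n] insert.prems by (simp add: nat_pow_pow mult.commute)
    next
      case False
      hence "Q [^] n \<in> span S" "Q \<in> carrier G" using that n insert.prems by auto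
      thus ?thesis using span_pow[OF S'(2), of "Q [^] n" k] by (simp add: nat_pow_pow)
    qed
    thus ?case using n k by (intro exI[of _ "n * k"]) auto
  qed auto
  then obtain n where n: "n > 0" "\<And>P. P \<in> F \<Longrightarrow> P [^] (n::nat) \<in> span S" by blast
  have "P [^] n \<in> span S" if "P \<in> carrier G" "root_height P \<le> 2 * ?C + 2 ^ k" for P k
    using that
  proof (induction k arbitrary: P)
    case 0
    thus ?case using n by (simp add: F_def)
  next
    case (Suc k)
    obtain Q \<rho> where Q: "Q \<in> carrier G" "\<rho> \<in> R" "P = Q \<otimes> Q \<otimes> \<rho>" using halve Suc.prems by blast
    have "root_height Q \<le> 2 * ?C + 2 ^ k"
      using root_height_descent[OF finite_cosets cosets_closed Q(2,1)] Suc.prems(2) Q(3) by simp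
    hence "Q [^] n \<in> span S" using Suc.IH Q by blast
    moreover have "\<rho> [^] n \<in> span S" using Q n by (simp add: F_def)
    moreover have "P [^] n = Q [^] n \<otimes> Q [^] n \<otimes> \<rho> [^] n"
      using Q cosets_closed by (auto simp: nat_pow_distrib)
    ultimately show ?case using span_mult[OF S'(2)] by simp
  qed
  moreover have "\<exists>k. root_height P \<le> 2 * ?C + 2 ^ k" for P
  proof -
    obtain k :: nat where "root_height P < 2 ^ k" using real_arch_pow[of 2] by auto
    thus ?thesis using descent_const_nonneg[OF cosets_closed] by (intro exI[of _ k]) simp
  qed
  ultimately show ?thesis using n(1) by blast
qed

text \<open>The multiples of P have a largest height M; doubling the multiple that attains it gives
  4 M <= M + \<kappa>.\<close>

lemma height_torsion_le:
  assumes P: "P \<in> carrier G" and n: "n > 0" "P [^] (n::nat) = \<one>"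
  shows "h P \<le> \<kappa> / 3"
proof -
  have mod: "P [^] k = P [^] (k mod n)" for k :: nat
  proof -
    have "P [^] k = P [^] (n * (k div n) + k mod n)" by simp
    also have "\<dots> = P [^] (n * (k div n)) \<otimes> P [^] (k mod n)" using P by (simp only: nat_pow_mult)
    also have "P [^] (n * (k div n)) = (P [^] n) [^] (k div n)" using P by (simp add: nat_pow_pow)
    finally show ?thesis using P n by simp
  qed
  define M where "M = Max ((\<lambda>k. h (P [^] k)) ` {..<n})"
  have le: "h (P [^] k) \<le> M" for k :: nat
  proof -
    have "h (P [^] (k mod n)) \<le> M" unfolding M_def using n(1) by (intro Max_ge) auto
    thus ?thesis using mod[of k] by simp
  qed
  have "M \<in> (\<lambda>k. h (P [^] k)) ` {..<n}" unfolding M_def using n by (intro Max_in) auto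
  then obtain k :: nat where k: "M = h (P [^] k)" by auto
  have "4 * M \<le> h (P [^] k \<otimes> P [^] k) + \<kappa>" unfolding k using P by (intro height_double) auto
  also have "P [^] k \<otimes> P [^] k = P [^] (k + k)" using P by (simp add: nat_pow_mult)
  also have "h (P [^] (k + k)) \<le> M" by (rule le)
  finally have "M \<le> \<kappa> / 3" by simp
  thus ?thesis using le[of 1] P by simp
qed

text \<open>Exponential growth in n is harmless because n is fixed in the application. The height of
  the unit accounts for n = 0.\<close>

lemma root_height_pow:
  assumes P: "P \<in> carrier G"
  shows "root_height (P [^] (n::nat)) \<le> 2 ^ n * (root_height P + root_height \<one>)"
proof -
  have "h (P [^] n) \<le> 4 ^ n * (h P + h \<one>)"
  proof (induction n)
    case (Suc n)
    have "h (P [^] Suc n) \<le> 2 * h (P [^] n) + 2 * h P"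
      using parallelogram[of "P [^] n" P] height_nonneg[of "P [^] n \<otimes> inv P"] P by simp
    also have "\<dots> \<le> 2 * (4 ^ n * (h P + h \<one>)) + 2 * (4 ^ n * (h P + h \<one>))"
    proof -
      have "1 * (h P + h \<one>) \<le> 4 ^ n * (h P + h \<one>)"
        using height_nonneg P by (intro mult_right_mono) auto
      hence "h P \<le> 4 ^ n * (h P + h \<one>)" using height_nonneg[of \<one>] by simp
      with Suc show ?thesis by linarith
    qed
    finally show ?case by (simp add: ac_simps)
  qed (use height_nonneg P in simp)
  hence "root_height (P [^] n) \<le> sqrt (4 ^ n * (h P + h \<one>))" by (simp add: root_height_def)
  also have "\<dots> = 2 ^ n * sqrt (h P + h \<one>)"
    by (simp add: real_sqrt_mult real_sqrt_power)
  also have "\<dots> \<le> 2 ^ n * (root_height P + root_height \<one>)"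
    unfolding root_height_def using height_nonneg P
    by (intro mult_left_mono sqrt_add_le_add_sqrt) auto
  finally show ?thesis .
qed

text \<open>Multiplication by a suitable n maps the group into the span and enlarges root heights by
  a bounded factor, up to a constant. Its fibres are no larger than the n-torsion, which has bounded
  height and is therefore finite.\<close>

theorem count_points:
  "\<exists>K\<ge>0. \<forall>b\<ge>0. real (card {P \<in> carrier G. root_height P \<le> b}) \<le> K * (1 + b) ^ group_rank G"
proof -
  obtain S where S: "int_independent G S" "card S = group_rank G" using group_rank_props(1) by blast
  have S': "finite S" "S \<subseteq> carrier G" using S by (auto simp: int_independent_iff)
  obtain n where n: "n > 0" "\<And>P. P \<in> carrier G \<Longrightarrow> P [^] (n::nat) \<in> span S"
    using uniform_multiple_in_span[OF S] by blast
  obtain K where K: "K \<ge> 0"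
    "\<And>b. b \<ge> 0 \<Longrightarrow> real (card {P \<in> span S. root_height P \<le> b}) \<le> K * (1 + b) ^ group_rank G"
    using count_span[OF S'] unfolding S(2) by blast
  define T where "T = {P \<in> carrier G. P [^] n = \<one>}"
  have T: "finite T"
    by (rule finite_subset[OF _ northcott[of "\<kappa> / 3"]]) (use height_torsion_le n(1) in \<open>auto simp: T_def\<close>)
  define w where "w = root_height \<one>"
  have w: "w \<ge> 0" by (simp add: w_def root_height_nonneg)
  define K' where "K' = real (card T) * (K * (2 ^ n * (1 + w)) ^ group_rank G)"
  have "real (card {P \<in> carrier G. root_height P \<le> b}) \<le> K' * (1 + b) ^ group_rank G" if b: "b \<ge> 0" for b
  proof -
    let ?A = "{P \<in> carrier G. root_height P \<le> b}" and ?f = "\<lambda>P. P [^] n"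
    let ?B = "{P \<in> span S. root_height P \<le> 2 ^ n * (b + w)}"
    have fibre: "card {P \<in> ?A. ?f P = y} \<le> card T" if "y \<in> ?f ` ?A" for y
    proof -
      from that obtain Q where Q: "Q \<in> carrier G" "y = Q [^] n" by auto
      have "inj_on (\<lambda>P. P \<otimes> inv Q) {P \<in> ?A. ?f P = y}" using Q by (auto intro!: inj_onI)
      moreover have "(\<lambda>P. P \<otimes> inv Q) ` {P \<in> ?A. ?f P = y} \<subseteq> T"
        using Q by (auto simp: T_def nat_pow_distrib nat_pow_inv)
      ultimately show ?thesis using T by (rule card_inj_on_le)
    qed
    have "?f ` ?A \<subseteq> ?B"
    proof (intro subsetI, elim imageE)
      fix Q P assume P: "Q = P [^] n" "P \<in> ?A"
      have "root_height Q \<le> 2 ^ n * (root_height P + w)"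
        using root_height_pow P by (simp add: w_def)
      also have "\<dots> \<le> 2 ^ n * (b + w)" using P by simp
      finally show "Q \<in> ?B" using P n by simp
    qed
    hence "card (?f ` ?A) \<le> card ?B"
      by (intro card_mono finite_subset[OF _ finite_root_height[of "2 ^ n * (b + w)"]])
        (use span_closed[OF S'(2)] in auto)
    moreover have "card ?A \<le> card T * card (?f ` ?A)"
      using fibre by (intro card_le_of_fibres finite_root_height)
    ultimately have "card ?A \<le> card T * card ?B"
      by (meson le_trans mult_le_mono2)
    hence "real (card ?A) \<le> real (card T) * real (card ?B)"
      unfolding of_nat_mult[symmetric] by (rule of_nat_mono)
    moreover have "real (card ?B) \<le> K * (1 + 2 ^ n * (b + w)) ^ group_rank G"
      using b w by (intro K) simp
    moreover have "\<dots> \<le> K * (2 ^ n * (1 + w) * (1 + b)) ^ group_rank G"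
    proof -
      have "1 + 2 ^ n * (b + w) \<le> 2 ^ n * (1 + (b + w))" by (simp add: algebra_simps)
      also have "\<dots> \<le> 2 ^ n * ((1 + w) * (1 + b))" using b w by (intro mult_left_mono) (auto simp: algebra_simps)
      finally show ?thesis using K(1) b w by (intro mult_left_mono power_mono) (auto simp: algebra_simps)
    qed
    ultimately have "real (card ?A) \<le> real (card T) * (K * (2 ^ n * (1 + w) * (1 + b)) ^ group_rank G)"
      by (meson mult_left_mono of_nat_0_le_iff order_trans)
    thus ?thesis by (simp add: K'_def power_mult_distrib ac_simps)
  qed
  moreover have "K' \<ge> 0" using K(1) w by (simp add: K'_def)
  ultimately show ?thesis by blast
qed

end

section \<open>Heights on the quadric model\<close>

fun denominator :: "rat \<times> rat \<times> rat \<Rightarrow> int \<Rightarrow> bool" where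
  "denominator (s, c, d) k \<longleftrightarrow> of_int k * s \<in> \<int> \<and> of_int k * c \<in> \<int> \<and> of_int k * d \<in> \<int>"

text \<open>For positive integral t the numerators of a point of the quadric are bounded by its
  least common denominator, so this is the naive projective height.\<close>

definition height :: "rat \<times> rat \<times> rat \<Rightarrow> nat" where
  "height P = (LEAST n. n > 0 \<and> denominator P (int n))"

lemma denominator_exists: "\<exists>n::nat. n > 0 \<and> denominator P (int n)"
proof -
  obtain s c d where P: "P = (s, c, d)" by (metis prod_cases3)
  have ex: "\<exists>k>0. of_int k * x \<in> \<int>" for x :: rat
  proof (intro exI conjI)
    show "snd (quotient_of x) > 0" by (rule quotient_of_denom_pos')
    have "x = of_int (fst (quotient_of x)) / of_int (snd (quotient_of x))"
      by (metis prod.collapse quotient_of_div)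
    hence "of_int (snd (quotient_of x)) * x = of_int (fst (quotient_of x))"
      using \<open>snd (quotient_of x) > 0\<close> by (simp add: field_simps)
    thus "of_int (snd (quotient_of x)) * x \<in> \<int>" by simp
  qed
  obtain k l m where k: "k > 0" "of_int k * s \<in> \<int>" and l: "l > 0" "of_int l * c \<in> \<int>"
    and m: "m > 0" "of_int m * d \<in> \<int>" using ex by metis
  have "of_int (k * l * m) * s = of_int (l * m) * (of_int k * s)"
    "of_int (k * l * m) * c = of_int (k * m) * (of_int l * c)"
    "of_int (k * l * m) * d = of_int (k * l) * (of_int m * d)" by simp_all
  hence "denominator P (k * l * m)" unfolding P denominator.simps using k l m by (metis Ints_mult Ints_of_int)
  thus ?thesis using k l m by (intro exI[of _ "nat (k * l * m)"]) simp
qed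

lemma height_pos: "height P > 0" and denominator_height: "denominator P (int (height P))"
  unfolding height_def using LeastI_ex[OF denominator_exists[of P]] by auto

text \<open>The integers that clear all denominators form an ideal; division with remainder shows
  that its least positive element generates it.\<close>

lemma denominator_iff_height_dvd: "denominator P k \<longleftrightarrow> int (height P) dvd k"
proof
  obtain s c d where P: "P = (s, c, d)" by (metis prod_cases3)
  let ?h = "int (height P)"
  {
    assume k: "denominator P k"
    have "of_int (k mod ?h) * x \<in> \<int>" if "of_int k * x \<in> \<int>" "of_int ?h * x \<in> \<int>" for x :: rat
    proof -
      have "of_int (k mod ?h) * x = of_int (k - k div ?h * ?h) * x" by (simp add: minus_div_mult_eq_mod)
      also have "\<dots> = of_int k * x - of_int (k div ?h) * (of_int ?h * x)"
        by (simp add: algebra_simps)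
      also have "\<dots> \<in> \<int>" by (rule Ints_diff[OF that(1) Ints_mult[OF Ints_of_int that(2)]])
      finally show ?thesis .
    qed
    hence "denominator P (k mod ?h)" using k denominator_height[of P] unfolding P denominator.simps by blast
    moreover have "0 \<le> k mod ?h" "k mod ?h < ?h" using height_pos[of P] by simp_all
    ultimately have "\<not> k mod ?h > 0"
      using not_less_Least[of "nat (k mod ?h)" "\<lambda>n. n > 0 \<and> denominator P (int n)"]
      unfolding height_def[of P, symmetric] by auto
    thus "?h dvd k" using \<open>0 \<le> k mod ?h\<close> by (simp add: dvd_eq_mod_eq_0)
  next
    assume "?h dvd k"
    then obtain j where j: "k = ?h * j" by auto
    have "of_int k * x \<in> \<int>" if "of_int ?h * x \<in> \<int>" for x :: rat
    proof -
      have "of_int k * x = of_int j * (of_int ?h * x)" by (simp add: j)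
      also have "\<dots> \<in> \<int>" by (rule Ints_mult[OF Ints_of_int that])
      finally show ?thesis .
    qed
    thus "denominator P k" using denominator_height[of P] unfolding P denominator.simps by blast
  }
qed

lemma height_le: "k > 0 \<Longrightarrow> denominator P k \<Longrightarrow> int (height P) \<le> k"
  by (simp add: denominator_iff_height_dvd zdvd_imp_le)

text \<open>Multiplicativity of heights under the Segre embedding. For a coordinate y of the second
  point, N y is an integer that clears the first point, hence a multiple of its height; dividing by
  that height shows that the cofactor M clears the second point.\<close>

lemma height_mult_dvd:
  assumes "\<And>x. x \<in> {1, s, c, d} \<Longrightarrow> of_int N * x \<in> \<int> \<and> of_int N * x * s' \<in> \<int> \<and>
     of_int N * x * c' \<in> \<int> \<and> of_int N * x * d' \<in> \<int>"
  shows "int (height (s, c, d)) * int (height (s', c', d')) dvd N"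
proof -
  let ?h = "int (height (s, c, d))" and ?h' = "int (height (s', c', d'))"
  have "denominator (s, c, d) N" using assms by (auto)
  hence "?h dvd N" by (simp only: denominator_iff_height_dvd)
  then obtain M where M: "N = ?h * M" by auto
  have "of_int M * x \<in> \<int>" if x: "x = s' \<or> x = c' \<or> x = d'" for x
  proof -
    have mem: "of_int N * y * x \<in> \<int>" if "y \<in> {1, s, c, d}" for y
      using assms[OF that] x by auto
    then obtain k where k: "of_int N * x = of_int k" by (metis Ints_cases insertI1 mult.right_neutral)
    have "of_int k * y \<in> \<int>" if "y \<in> {s, c, d}" for y
    proof -
      have eq: "of_int k * y = of_int N * y * x" unfolding k[symmetric] by (simp add: mult_ac)
      show ?thesis unfolding eq by (rule mem) (use that in auto)
    qed
    hence "denominator (s, c, d) k" by simp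
    hence "?h dvd k" by (simp only: denominator_iff_height_dvd)
    then obtain j where "k = ?h * j" by auto
    hence "of_int ?h * (of_int M * x) = of_int ?h * (of_int j :: rat)" using k by (simp add: M)
    hence "of_int M * x = of_int j" using height_pos[of "(s, c, d)"] by simp
    thus ?thesis by simp
  qed
  hence "denominator (s', c', d') M" by simp
  hence "?h' dvd M" by (simp only: denominator_iff_height_dvd)
  thus ?thesis unfolding M by (intro mult_dvd_mono) auto
qed

lemma height_coordinates:
  obtains p v u q :: int where "p = int (height P)" "p > 0"
    "P = (of_int v / of_int p, of_int u / of_int p, of_int q / of_int p)"
proof -
  obtain s c d where P: "P = (s, c, d)" by (metis prod_cases3)
  define p where "p = int (height P)"
  have p: "p > 0" using height_pos by (simp add: p_def)
  have "of_int p * s \<in> \<int> \<and> of_int p * c \<in> \<int> \<and> of_int p * d \<in> \<int>"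
    using denominator_height[of P] by (simp add: P p_def)
  then obtain v u q where "of_int p * s = of_int v" "of_int p * c = of_int u" "of_int p * d = of_int q"
    by (auto elim!: Ints_cases)
  hence "P = (of_int v / of_int p, of_int u / of_int p, of_int q / of_int p)"
    using p by (simp add: P field_simps)
  thus ?thesis by (rule that[OF p_def p])
qed

lemma Ints_of_int_eq: "x = of_int k \<Longrightarrow> x \<in> \<int>"
  by simp

text \<open>One factor D cancels from every product of a coordinate of P + Q with one of P - Q. The
  last three identities arise from the preceding three by changing the sign of s2.\<close>

lemma jacobi_products:
  fixes s1 c1 d1 s2 c2 d2 t :: rat
  assumes "c1\<^sup>2 = 1 - t * s1\<^sup>2" "d1\<^sup>2 = 1 - 2 * t * s1\<^sup>2" "c2\<^sup>2 = 1 - t * s2\<^sup>2" "d2\<^sup>2 = 1 - 2 * t * s2\<^sup>2"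
  defines "D \<equiv> jacobi_den t s1 s2"
  shows "(s1 * c2 * d2 + s2 * c1 * d1) * (s1 * c2 * d2 - s2 * c1 * d1) = D * (s1\<^sup>2 - s2\<^sup>2)"
    "(c1 * c2 - t * s1 * s2 * d1 * d2) * (c1 * c2 + t * s1 * s2 * d1 * d2) =
      D * (1 - t * s1\<^sup>2 - t * s2\<^sup>2 + 2 * t\<^sup>2 * s1\<^sup>2 * s2\<^sup>2)"
    "(d1 * d2 - 2 * t * s1 * s2 * c1 * c2) * (d1 * d2 + 2 * t * s1 * s2 * c1 * c2) =
      D * (1 - 2 * t * s1\<^sup>2 - 2 * t * s2\<^sup>2 + 2 * t\<^sup>2 * s1\<^sup>2 * s2\<^sup>2)"
    "(s1 * c2 * d2 + s2 * c1 * d1) * (c1 * c2 + t * s1 * s2 * d1 * d2) = D * (s1 * c1 * d2 + s2 * c2 * d1)"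
    "(s1 * c2 * d2 + s2 * c1 * d1) * (d1 * d2 + 2 * t * s1 * s2 * c1 * c2) = D * (s1 * d1 * c2 + s2 * d2 * c1)"
    "(c1 * c2 - t * s1 * s2 * d1 * d2) * (d1 * d2 + 2 * t * s1 * s2 * c1 * c2) = D * (c1 * d1 * c2 * d2 + t * s1 * s2)"
    "(s1 * c2 * d2 - s2 * c1 * d1) * (c1 * c2 - t * s1 * s2 * d1 * d2) = D * (s1 * c1 * d2 - s2 * c2 * d1)"
    "(s1 * c2 * d2 - s2 * c1 * d1) * (d1 * d2 - 2 * t * s1 * s2 * c1 * c2) = D * (s1 * d1 * c2 - s2 * d2 * c1)"
    "(c1 * c2 + t * s1 * s2 * d1 * d2) * (d1 * d2 - 2 * t * s1 * s2 * c1 * c2) = D * (c1 * d1 * c2 * d2 - t * s1 * s2)"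
proof -
  note reds = assms(1-4)[THEN square_rewrites(1)] assms(1-4)[THEN square_rewrites(2)]
  note unf = D_def jacobi_den_def
  show "(s1 * c2 * d2 + s2 * c1 * d1) * (s1 * c2 * d2 - s2 * c1 * d1) = D * (s1\<^sup>2 - s2\<^sup>2)"
    "(c1 * c2 - t * s1 * s2 * d1 * d2) * (c1 * c2 + t * s1 * s2 * d1 * d2) =
      D * (1 - t * s1\<^sup>2 - t * s2\<^sup>2 + 2 * t\<^sup>2 * s1\<^sup>2 * s2\<^sup>2)"
    "(d1 * d2 - 2 * t * s1 * s2 * c1 * c2) * (d1 * d2 + 2 * t * s1 * s2 * c1 * c2) =
      D * (1 - 2 * t * s1\<^sup>2 - 2 * t * s2\<^sup>2 + 2 * t\<^sup>2 * s1\<^sup>2 * s2\<^sup>2)"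
    "(s1 * c2 * d2 + s2 * c1 * d1) * (c1 * c2 + t * s1 * s2 * d1 * d2) = D * (s1 * c1 * d2 + s2 * c2 * d1)"
    "(s1 * c2 * d2 + s2 * c1 * d1) * (d1 * d2 + 2 * t * s1 * s2 * c1 * c2) = D * (s1 * d1 * c2 + s2 * d2 * c1)"
    "(c1 * c2 - t * s1 * s2 * d1 * d2) * (d1 * d2 + 2 * t * s1 * s2 * c1 * c2) = D * (c1 * d1 * c2 * d2 + t * s1 * s2)"
    "(s1 * c2 * d2 - s2 * c1 * d1) * (c1 * c2 - t * s1 * s2 * d1 * d2) = D * (s1 * c1 * d2 - s2 * c2 * d1)"
    "(s1 * c2 * d2 - s2 * c1 * d1) * (d1 * d2 - 2 * t * s1 * s2 * c1 * c2) = D * (s1 * d1 * c2 - s2 * d2 * c1)"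
    "(c1 * c2 + t * s1 * s2 * d1 * d2) * (d1 * d2 - 2 * t * s1 * s2 * c1 * c2) = D * (c1 * d1 * c2 * d2 - t * s1 * s2)"
    unfolding unf by (simp_all add: reds power2_eq_square algebra_simps)
qed

text \<open>All products of a coordinate of \<open>P + Q\<close> with one of \<open>P - Q\<close> have the same denominator as the
  coordinates of \<open>P + Q\<close> alone. The height is the denominator, so this is the parallelogram inequality.\<close>

lemma height_parallelogram:
  fixes N :: nat
  assumes N: "N > 0" and P: "P \<in> jacobi (of_nat N)" and Q: "Q \<in> jacobi (of_nat N)"
  shows "height (jacobi_add (of_nat N) P Q) * height (jacobi_add (of_nat N) P (jacobi_minus Q)) \<le>
    (height P)\<^sup>2 * (height Q)\<^sup>2"
proof -
  define t :: rat where "t = of_nat N"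
  have t: "t > 0" using N by (simp add: t_def)
  obtain p1 v1 u1 q1 where p1: "p1 = int (height P)" "p1 > 0"
    "P = (of_int v1 / of_int p1, of_int u1 / of_int p1, of_int q1 / of_int p1)"
    using height_coordinates .
  obtain p2 v2 u2 q2 where p2: "p2 = int (height Q)" "p2 > 0"
    "Q = (of_int v2 / of_int p2, of_int u2 / of_int p2, of_int q2 / of_int p2)"
    using height_coordinates .
  define s1 c1 d1 where P_def: "s1 = (of_int v1 / of_int p1 :: rat)" "c1 = (of_int u1 / of_int p1 :: rat)"
    "d1 = (of_int q1 / of_int p1 :: rat)"
  define s2 c2 d2 where Q_def: "s2 = (of_int v2 / of_int p2 :: rat)" "c2 = (of_int u2 / of_int p2 :: rat)"
    "d2 = (of_int q2 / of_int p2 :: rat)"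
  have P': "P = (s1, c1, d1)" and Q': "Q = (s2, c2, d2)" by (simp_all add: p1(3) p2(3) P_def Q_def)
  define D where "D = jacobi_den t s1 s2"
  have D': "jacobi_den t s1 (- s2) = D" by (simp add: D_def jacobi_den_def)
  have D: "D > 0" using jacobi_den_pos[OF t, of s1 c1 d1 s2 c2 d2] P Q P' Q' by (auto simp: D_def t_def)
  have eqs: "c1\<^sup>2 = 1 - t * s1\<^sup>2" "d1\<^sup>2 = 1 - 2 * t * s1\<^sup>2" "c2\<^sup>2 = 1 - t * s2\<^sup>2" "d2\<^sup>2 = 1 - 2 * t * s2\<^sup>2"
    using P Q by (auto simp: jacobi_def P' Q' t_def)
  \<comment> \<open>\<open>D\<close> cleared of its denominators. The subtracted term is
    nonnegative, so M is at most p1^2 p2^2 and the inequality needs no additional constant.\<close>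
  define M :: int where "M = p1\<^sup>2 * p2\<^sup>2 - 2 * int N ^ 2 * v1\<^sup>2 * v2\<^sup>2"
  have pe: "of_int v1 = s1 * of_int p1" "of_int u1 = c1 * of_int p1" "of_int q1 = d1 * of_int p1"
    "of_int v2 = s2 * of_int p2" "of_int u2 = c2 * of_int p2" "of_int q2 = d2 * of_int p2"
    using p1 p2 by (simp_all add: P_def Q_def)
  have M: "of_int M = of_int (p1\<^sup>2 * p2\<^sup>2) * D"
    unfolding M_def D_def jacobi_den_def t_def
    by (simp add: pe power2_eq_square algebra_simps)
  define sp cp dp where num: "sp = s1 * c2 * d2 + s2 * c1 * d1" "cp = c1 * c2 - t * s1 * s2 * d1 * d2"
    "dp = d1 * d2 - 2 * t * s1 * s2 * c1 * c2"
  define sm cm dm where num': "sm = s1 * c2 * d2 - s2 * c1 * d1" "cm = c1 * c2 + t * s1 * s2 * d1 * d2"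
    "dm = d1 * d2 + 2 * t * s1 * s2 * c1 * c2"
  have plus: "jacobi_add t P Q = (sp / D, cp / D, dp / D)"
    by (simp add: P' Q' num D_def)
  have minus: "jacobi_add t P (jacobi_minus Q) = (sm / D, cm / D, dm / D)"
    by (simp add: P' Q' num' D_def jacobi_den_def)
  have M1: "of_int M * (x / D) = of_int (p1\<^sup>2 * p2\<^sup>2) * x" for x
    using D by (simp add: M)
  have M2: "of_int M * (x / D) * (y / D) = of_int (p1\<^sup>2 * p2\<^sup>2) * z" if "x * y = D * z" for x y z
  proof -
    have "of_int M * (x / D) * (y / D) = of_int (p1\<^sup>2 * p2\<^sup>2) * (x * y) / D"
      using D by (simp add: M)
    thus ?thesis using D by (simp add: that)
  qed
  note prods = jacobi_products[OF eqs, folded D_def num num']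
  have comm: "x * y = D * z" if "y * x = D * z" for x y z using that by (simp add: mult.commute)
  have "of_int (p1\<^sup>2 * p2\<^sup>2) * sp = of_int (v1 * p1 * u2 * q2 + v2 * p2 * u1 * q1)"
      "of_int (p1\<^sup>2 * p2\<^sup>2) * cp = of_int (u1 * p1 * u2 * p2 - int N * v1 * v2 * q1 * q2)"
      "of_int (p1\<^sup>2 * p2\<^sup>2) * dp = of_int (q1 * p1 * q2 * p2 - 2 * int N * v1 * v2 * u1 * u2)"
      "of_int (p1\<^sup>2 * p2\<^sup>2) * sm = of_int (v1 * p1 * u2 * q2 - v2 * p2 * u1 * q1)"
      "of_int (p1\<^sup>2 * p2\<^sup>2) * cm = of_int (u1 * p1 * u2 * p2 + int N * v1 * v2 * q1 * q2)"
      "of_int (p1\<^sup>2 * p2\<^sup>2) * dm = of_int (q1 * p1 * q2 * p2 + 2 * int N * v1 * v2 * u1 * u2)"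
      unfolding num num' t_def by (simp_all add: pe power2_eq_square algebra_simps)
  note i1 = this[THEN Ints_of_int_eq]
  have "of_int (p1\<^sup>2 * p2\<^sup>2) * (s1\<^sup>2 - s2\<^sup>2) = of_int (v1\<^sup>2 * p2\<^sup>2 - v2\<^sup>2 * p1\<^sup>2)"
      "of_int (p1\<^sup>2 * p2\<^sup>2) * (1 - t * s1\<^sup>2 - t * s2\<^sup>2 + 2 * t\<^sup>2 * s1\<^sup>2 * s2\<^sup>2) =
        of_int (p1\<^sup>2 * p2\<^sup>2 - int N * v1\<^sup>2 * p2\<^sup>2 - int N * v2\<^sup>2 * p1\<^sup>2 + 2 * int N ^ 2 * v1\<^sup>2 * v2\<^sup>2)"
      "of_int (p1\<^sup>2 * p2\<^sup>2) * (1 - 2 * t * s1\<^sup>2 - 2 * t * s2\<^sup>2 + 2 * t\<^sup>2 * s1\<^sup>2 * s2\<^sup>2) =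
        of_int (p1\<^sup>2 * p2\<^sup>2 - 2 * int N * v1\<^sup>2 * p2\<^sup>2 - 2 * int N * v2\<^sup>2 * p1\<^sup>2 + 2 * int N ^ 2 * v1\<^sup>2 * v2\<^sup>2)"
      "of_int (p1\<^sup>2 * p2\<^sup>2) * (s1 * c1 * d2 + s2 * c2 * d1) = of_int (v1 * u1 * q2 * p2 + v2 * u2 * q1 * p1)"
      "of_int (p1\<^sup>2 * p2\<^sup>2) * (s1 * d1 * c2 + s2 * d2 * c1) = of_int (v1 * q1 * u2 * p2 + v2 * q2 * u1 * p1)"
      "of_int (p1\<^sup>2 * p2\<^sup>2) * (c1 * d1 * c2 * d2 + t * s1 * s2) = of_int (u1 * q1 * u2 * q2 + int N * v1 * p1 * v2 * p2)"
      "of_int (p1\<^sup>2 * p2\<^sup>2) * (s1 * c1 * d2 - s2 * c2 * d1) = of_int (v1 * u1 * q2 * p2 - v2 * u2 * q1 * p1)"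
      "of_int (p1\<^sup>2 * p2\<^sup>2) * (s1 * d1 * c2 - s2 * d2 * c1) = of_int (v1 * q1 * u2 * p2 - v2 * q2 * u1 * p1)"
      "of_int (p1\<^sup>2 * p2\<^sup>2) * (c1 * d1 * c2 * d2 - t * s1 * s2) = of_int (u1 * q1 * u2 * q2 - int N * v1 * p1 * v2 * p2)"
      unfolding t_def by (simp_all add: pe power2_eq_square algebra_simps)
  note i2 = this[THEN Ints_of_int_eq]
  have "int (height (sp / D, cp / D, dp / D)) * int (height (sm / D, cm / D, dm / D)) dvd M"
  proof (rule height_mult_dvd)
    fix x assume "x \<in> {1, sp / D, cp / D, dp / D}"
    then consider "x = 1" | "x = sp / D" | "x = cp / D" | "x = dp / D" by blast
    thus "of_int M * x \<in> \<int> \<and> of_int M * x * (sm / D) \<in> \<int> \<and>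
        of_int M * x * (cm / D) \<in> \<int> \<and> of_int M * x * (dm / D) \<in> \<int>"
    proof cases
      case 1
      show ?thesis unfolding 1 mult_1_right M1 by (intro conjI Ints_of_int i1)
    next
      case 2
      show ?thesis unfolding 2 unfolding M2[OF prods(1)] M2[OF prods(4)] M2[OF prods(5)] unfolding M1
        by (intro conjI i1 i2)
    next
      case 3
      show ?thesis unfolding 3 unfolding M2[OF prods(2)] M2[OF comm[OF prods(7)]] M2[OF prods(6)] unfolding M1
        by (intro conjI i1 i2)
    next
      case 4
      show ?thesis unfolding 4 unfolding M2[OF prods(3)] M2[OF comm[OF prods(8)]] M2[OF comm[OF prods(9)]] unfolding M1
        by (intro conjI i1 i2)
    qed
  qed
  moreover have "M > 0"
  proof -
    have "(of_int M :: rat) > 0" unfolding M using D p1 p2 by simp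
    thus ?thesis by simp
  qed
  ultimately have "int (height (jacobi_add t P Q)) * int (height (jacobi_add t P (jacobi_minus Q))) \<le> M"
    unfolding plus minus by (rule zdvd_imp_le)
  also have "M \<le> p1\<^sup>2 * p2\<^sup>2" by (simp add: M_def)
  finally have "int (height (jacobi_add t P Q) * height (jacobi_add t P (jacobi_minus Q))) \<le>
      int ((height P)\<^sup>2 * (height Q)\<^sup>2)" by (simp add: p1(1) p2(1))
  thus ?thesis unfolding t_def by (simp only: of_nat_le_iff)
qed

text \<open>The primes dividing two of the projective coordinates \<open>(p, u, q)\<close> divide \<open>v\<close> as well because
  \<open>N\<close> is squarefree.\<close>

lemma primitive_coordinates:
  fixes N :: nat
  assumes N: "squarefree N" and P: "P \<in> jacobi (of_nat N)"
  obtains p v u q :: int where "p = int (height P)" "p > 0"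
    "P = (of_int v / of_int p, of_int u / of_int p, of_int q / of_int p)"
    "u\<^sup>2 = p\<^sup>2 - int N * v\<^sup>2" "q\<^sup>2 = p\<^sup>2 - 2 * int N * v\<^sup>2"
    "coprime p u" "coprime p q" "coprime u q"
proof -
  obtain p v u q where p: "p = int (height P)" "p > 0"
    "P = (of_int v / of_int p, of_int u / of_int p, of_int q / of_int p)"
    using height_coordinates .
  have "(of_int (u\<^sup>2) :: rat) = of_int (p\<^sup>2 - int N * v\<^sup>2)"
    "(of_int (q\<^sup>2) :: rat) = of_int (p\<^sup>2 - 2 * int N * v\<^sup>2)"
    using P p(2) by (auto simp: p(3) jacobi_def power_divide field_simps)
  hence eqs: "u\<^sup>2 = p\<^sup>2 - int N * v\<^sup>2" "q\<^sup>2 = p\<^sup>2 - 2 * int N * v\<^sup>2"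
    by (simp_all only: of_int_eq_iff)
  have sqfree: "squarefree (int N)"
  proof (rule squarefreeI)
    fix x :: int assume "x ^ 2 dvd int N"
    moreover have "x ^ 2 = int (nat \<bar>x\<bar> ^ 2)" by simp
    ultimately have "nat \<bar>x\<bar> ^ 2 dvd N" by (simp only: int_dvd_int_iff)
    hence "nat \<bar>x\<bar> dvd 1" using N squarefreeD by blast
    thus "x dvd 1" by (simp add: nat_abs_dvd_iff)
  qed
  have dvd_v: "l dvd v" if l: "prime l" "l\<^sup>2 dvd int N * v\<^sup>2" for l
  proof (rule ccontr)
    assume "\<not> l dvd v"
    hence "coprime (l\<^sup>2) (v\<^sup>2)" using l(1) by (simp add: prime_imp_coprime)
    hence "l\<^sup>2 dvd int N" using l(2) by (simp add: coprime_dvd_mult_left_iff)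
    hence "is_unit l" using sqfree by (rule squarefreeD[rotated])
    thus False using l(1) by (simp add: not_prime_unit)
  qed
  have no_common: "\<not> (l dvd p \<and> l dvd v \<and> l dvd u \<and> l dvd q)" if l: "prime l" for l
  proof
    assume "l dvd p \<and> l dvd v \<and> l dvd u \<and> l dvd q"
    then obtain p' v' u' q' where *: "p = l * p'" "v = l * v'" "u = l * u'" "q = l * q'"
      by (auto elim!: dvdE)
    have l0: "l > 1" using l prime_gt_1_int by blast
    have "p' > 0" using p(2) l0 * by (simp add: zero_less_mult_iff)
    have "P = (of_int v' / of_int p', of_int u' / of_int p', of_int q' / of_int p')"
      using l0 by (simp add: p(3) *)
    hence "denominator P p'" using \<open>p' > 0\<close> by simp
    hence "p \<le> p'" using height_le \<open>p' > 0\<close> p(1) by simp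
    moreover have "p' < l * p'" using l0 \<open>p' > 0\<close> by simp
    ultimately show False using * by simp
  qed
  have pow: "l\<^sup>2 dvd x\<^sup>2" if "l dvd x" for l x :: int using that by simp
  have root: "l dvd x" if "prime l" "l dvd x\<^sup>2" for l x :: int using that prime_dvd_power by blast
  have "\<not> (l dvd p \<and> l dvd u)" if l: "prime l" for l
  proof
    assume *: "l dvd p \<and> l dvd u"
    have "int N * v\<^sup>2 = p\<^sup>2 - u\<^sup>2" using eqs by simp
    hence "l\<^sup>2 dvd int N * v\<^sup>2" using * pow by (simp add: dvd_diff)
    hence "l dvd v" using dvd_v l by blast
    moreover from this have "l dvd q\<^sup>2" unfolding eqs(2) using * by (simp add: power2_eq_square)
    hence "l dvd q" using root l by blast
    ultimately show False using no_common l * by blast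
  qed
  moreover have "\<not> (l dvd u \<and> l dvd q)" if l: "prime l" for l
  proof
    assume *: "l dvd u \<and> l dvd q"
    have "int N * v\<^sup>2 = u\<^sup>2 - q\<^sup>2" using eqs by simp
    hence "l\<^sup>2 dvd int N * v\<^sup>2" using * pow by (simp add: dvd_diff)
    hence "l dvd v" using dvd_v l by blast
    moreover have "p\<^sup>2 = u\<^sup>2 + int N * v\<^sup>2" using eqs by simp
    with \<open>l dvd v\<close> * have "l dvd p\<^sup>2" by (simp add: power2_eq_square)
    hence "l dvd p" using root l by blast
    ultimately show False using no_common l * by blast
  qed
  moreover have "\<not> (l dvd p \<and> l dvd q)" if l: "prime l" for l
  proof
    assume *: "l dvd p \<and> l dvd q"
    \<comment> \<open>The case of p and q reduces to that of p and u. The prime 2 is no exception,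
      since 4 does not divide 2.\<close>
    have "2 * u\<^sup>2 = p\<^sup>2 + q\<^sup>2" using eqs by simp
    hence l2: "l\<^sup>2 dvd 2 * u\<^sup>2" using * pow by simp
    have "l dvd u"
    proof (rule ccontr)
      assume "\<not> l dvd u"
      hence "coprime (l\<^sup>2) (u\<^sup>2)" using l by (simp add: prime_imp_coprime)
      hence "l\<^sup>2 dvd 2" using l2 by (simp add: coprime_dvd_mult_left_iff)
      hence "l\<^sup>2 \<le> 2" by (rule zdvd_imp_le) simp
      moreover have "2\<^sup>2 \<le> l\<^sup>2" using prime_ge_2_int[OF l] by (intro power_mono) auto
      ultimately show False by simp
    qed
    with * have "l dvd p \<and> l dvd u" by blast
    thus False using \<open>\<And>l. prime l \<Longrightarrow> \<not> (l dvd p \<and> l dvd u)\<close> l by blast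
  qed
  moreover have "coprime x y" if "\<And>l. prime l \<Longrightarrow> \<not> (l dvd x \<and> l dvd y)" "x \<noteq> 0 \<or> y \<noteq> 0" for x y :: int
  proof (rule ccontr)
    assume "\<not> coprime x y"
    hence "\<not> is_unit (gcd x y)" by (simp add: coprime_iff_gcd_eq_1)
    moreover have "gcd x y \<noteq> 0" using that(2) by simp
    ultimately obtain l where "prime l" "l dvd gcd x y" using prime_divisor_exists by blast
    thus False using that(1) by simp
  qed
  moreover have "u \<noteq> 0 \<or> q \<noteq> 0"
  proof -
    have "2 * u\<^sup>2 = p\<^sup>2 + q\<^sup>2" using eqs by simp
    moreover have "p\<^sup>2 > 0" using p(2) by simp
    ultimately show ?thesis by auto
  qed
  ultimately show ?thesis using that[OF p eqs] p(2) by auto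
qed

text \<open>If g is the factor cancelled in 2 P, then g divides 2 p^2 u^2, 2 p^2 q^2 and 2 u^2 q^2,
  the pairwise sums of A0, A2, A3. As p, u, q are pairwise coprime, g is at most 2. The other factor
  2 comes from A0 >= p^4 / 2.\<close>

lemma height_double:
  fixes N :: nat
  assumes N: "squarefree N" and P: "P \<in> jacobi (of_nat N)"
  shows "height P ^ 4 \<le> 4 * height (jacobi_add (of_nat N) P P)"
proof -
  obtain p v u q where p: "p = int (height P)" "p > 0"
    "P = (of_int v / of_int p, of_int u / of_int p, of_int q / of_int p)"
    and eqs: "u\<^sup>2 = p\<^sup>2 - int N * v\<^sup>2" "q\<^sup>2 = p\<^sup>2 - 2 * int N * v\<^sup>2"
    and cop: "coprime p u" "coprime p q" "coprime u q"
    using primitive_coordinates[OF assms] .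
  define A0 A2 A3 where A: "A0 = p ^ 4 - 2 * int N ^ 2 * v ^ 4" "A2 = u\<^sup>2 * p\<^sup>2 - int N * v\<^sup>2 * q\<^sup>2"
    "A3 = q\<^sup>2 * p\<^sup>2 - 2 * int N * v\<^sup>2 * u\<^sup>2"
  define D where "D = jacobi_den (of_nat N) (of_int v / of_int p) (of_int v / of_int p)"
  have p0: "(of_int p :: rat) \<noteq> 0" using p by simp
  have N0: "(of_nat N :: rat) > 0" using N by (cases N) auto
  have D: "D \<ge> 1/2" unfolding D_def using jacobi_den_pos[OF N0] P p(3) by auto
  have A0: "of_int A0 = of_int (p ^ 4) * D"
    using p0 by (simp add: A D_def jacobi_den_def field_simps power2_eq_square power4_eq_xxxx)
  have "2 * A0 \<ge> p ^ 4"
  proof -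
    have "of_int (p ^ 4) * (1/2) \<le> of_int (p ^ 4) * D" using D p by (intro mult_left_mono) auto
    hence "(of_int (p ^ 4) :: rat) \<le> of_int (2 * A0)" using A0 by simp
    thus ?thesis by (simp only: of_int_le_iff)
  qed
  define S where "S = jacobi_add (of_nat N) P P"
  define A1 where "A1 = 2 * v * p * u * q"
  have S: "S = (of_int A1 / of_int A0, of_int A2 / of_int A0, of_int A3 / of_int A0)"
  proof -
    define x y z where xyz: "x = (of_int v / of_int p :: rat)" "y = (of_int u / of_int p :: rat)"
      "z = (of_int q / of_int p :: rat)"
    have e: "of_int v = x * of_int p" "of_int u = y * of_int p" "of_int q = z * of_int p"
      using p0 by (simp_all add: xyz)
    have num: "of_int A1 = of_int (p ^ 4) * (x * y * z + x * y * z)"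
      "of_int A2 = of_int (p ^ 4) * (y * y - of_nat N * x * x * z * z)"
      "of_int A3 = of_int (p ^ 4) * (z * z - 2 * of_nat N * x * x * y * y)"
      unfolding A1_def A by (simp_all add: e power2_eq_square power4_eq_xxxx algebra_simps)
    show ?thesis
      unfolding S_def p(3) xyz[symmetric] jacobi_add.simps num A0 using p0 by (simp add: D_def xyz)
  qed
  have A0_pos: "A0 > 0"
  proof -
    have "p ^ 4 > 0" using p by simp
    thus ?thesis using \<open>2 * A0 \<ge> p ^ 4\<close> by linarith
  qed
  hence "denominator S A0" by (simp add: S)
  hence "int (height S) dvd A0" by (simp only: denominator_iff_height_dvd)
  then obtain g where g: "A0 = int (height S) * g" by auto
  have hS: "int (height S) > 0" using height_pos by simp
  have g_pos: "g > 0" using A0_pos g hS by (simp add: zero_less_mult_iff)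
  have dvd: "g dvd B" if "of_int (int (height S)) * (of_int B / of_int A0 :: rat) \<in> \<int>" for B
  proof -
    obtain k where "of_int (int (height S)) * (of_int B / of_int A0 :: rat) = of_int k" using \<open>_ \<in> \<int>\<close> by (auto elim: Ints_cases)
    hence "(of_int B :: rat) = of_int (g * k)" using g_pos hS unfolding g by (simp add: field_simps)
    hence "B = g * k" by (simp only: of_int_eq_iff)
    thus ?thesis by simp
  qed
  have "g dvd A2" "g dvd A3" using denominator_height[of S] dvd by (simp_all add: S)
  moreover have "g dvd A0" by (simp add: g)
  ultimately have sums: "g dvd A0 + A2" "g dvd A0 + A3" "g dvd A2 + A3" by simp_all
  have Nv: "int N * v\<^sup>2 = p\<^sup>2 - u\<^sup>2" "q\<^sup>2 = 2 * u\<^sup>2 - p\<^sup>2" using eqs by simp_all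
  have "A0 = p ^ 4 - 2 * (int N * v\<^sup>2)\<^sup>2" "A2 = u\<^sup>2 * p\<^sup>2 - (int N * v\<^sup>2) * q\<^sup>2" "A3 = q\<^sup>2 * p\<^sup>2 - 2 * (int N * v\<^sup>2) * u\<^sup>2"
    unfolding A by (simp_all add: power_mult_distrib)
  note A' = this[unfolded Nv]
  have "A0 + A2 = 2 * (p\<^sup>2 * u\<^sup>2)" unfolding A' by algebra
  moreover have "A0 + A3 = 2 * (p\<^sup>2 * q\<^sup>2)" unfolding A' Nv by algebra
  moreover have "A2 + A3 = 2 * (u\<^sup>2 * q\<^sup>2)" unfolding A' Nv by algebra
  ultimately have g3: "g dvd 2 * (p\<^sup>2 * u\<^sup>2)" "g dvd 2 * (p\<^sup>2 * q\<^sup>2)" "g dvd 2 * (u\<^sup>2 * q\<^sup>2)"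
    using sums by simp_all
  have "g dvd gcd (2 * (p\<^sup>2 * u\<^sup>2)) (2 * (p\<^sup>2 * q\<^sup>2))" using g3 by simp
  also have "\<dots> = 2 * p\<^sup>2"
    using cop by (simp add: gcd_mult_distrib_int[symmetric] flip: mult.assoc)
  finally have "g dvd gcd (2 * p\<^sup>2) (2 * (u\<^sup>2 * q\<^sup>2))" using g3 by simp
  also have "\<dots> = 2"
    using cop by (simp add: gcd_mult_distrib_int[symmetric])
  finally have "g \<le> 2" by (rule zdvd_imp_le) simp
  hence "A0 \<le> int (height S) * 2" unfolding g using hS by simp
  hence "p ^ 4 \<le> 4 * int (height S)" using \<open>2 * A0 \<ge> p ^ 4\<close> by simp
  hence "int (height P ^ 4) \<le> int (4 * height S)" by (simp add: p(1))
  thus ?thesis unfolding S_def by (simp only: of_nat_le_iff)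
qed

lemma finite_height_le:
  fixes N :: nat
  assumes N: "N > 0"
  shows "finite {P \<in> jacobi (of_nat N). height P \<le> B}"
proof (rule finite_subset)
  let ?I = "{- int B..int B}"
  let ?f = "\<lambda>(p, v, u, q). (of_int v / of_int p, of_int u / of_int p, of_int q / of_int p) :: rat \<times> rat \<times> rat"
  show "finite (?f ` (?I \<times> ?I \<times> ?I \<times> ?I))" by simp
  show "{P \<in> jacobi (of_nat N). height P \<le> B} \<subseteq> ?f ` (?I \<times> ?I \<times> ?I \<times> ?I)"
  proof
    fix P assume "P \<in> {P \<in> jacobi (of_nat N). height P \<le> B}"
    hence P: "P \<in> jacobi (of_nat N)" "height P \<le> B" by auto
    obtain p v u q where p: "p = int (height P)" "p > 0"
      "P = (of_int v / of_int p, of_int u / of_int p, of_int q / of_int p)"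
      using height_coordinates .
    have "(of_int (u\<^sup>2) :: rat) = of_int (p\<^sup>2 - int N * v\<^sup>2)"
      "(of_int (q\<^sup>2) :: rat) = of_int (p\<^sup>2 - 2 * int N * v\<^sup>2)"
      using P(1) p(2) by (auto simp: p(3) jacobi_def power_divide field_simps)
    hence eqs: "u\<^sup>2 = p\<^sup>2 - int N * v\<^sup>2" "q\<^sup>2 = p\<^sup>2 - 2 * int N * v\<^sup>2"
      by (simp_all only: of_int_eq_iff)
    have "1 * v\<^sup>2 \<le> int N * v\<^sup>2" using N by (intro mult_right_mono) auto
    hence "v\<^sup>2 \<le> p\<^sup>2" "u\<^sup>2 \<le> p\<^sup>2" "q\<^sup>2 \<le> p\<^sup>2"
      using eqs zero_le_power2[of u] zero_le_power2[of v] by linarith+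
    hence "\<bar>v\<bar> \<le> p" "\<bar>u\<bar> \<le> p" "\<bar>q\<bar> \<le> p" using p(2) by (simp_all add: abs_le_square_iff[symmetric])
    moreover have "p \<le> int B" using P(2) p(1) by simp
    ultimately have "(p, v, u, q) \<in> ?I \<times> ?I \<times> ?I \<times> ?I" using p(2) by auto
    thus "P \<in> ?f ` (?I \<times> ?I \<times> ?I \<times> ?I)" by (rule image_eqI[rotated]) (simp add: p(3))
  qed
qed

section \<open>Two-descent\<close>

text \<open>A prime of odd multiplicity in A either divides B as well, hence l, or has the same odd
  multiplicity in k w^2, hence divides k.\<close>

lemma squarefree_part_dvd:
  fixes A B k l w :: int
  assumes AB: "A * B = k * w\<^sup>2" and nz: "k \<noteq> 0" "w \<noteq> 0" "l \<noteq> 0"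
    and common: "\<And>p. prime p \<Longrightarrow> p dvd A \<Longrightarrow> p dvd B \<Longrightarrow> p dvd l"
  shows "squarefree_part A dvd k * l"
proof -
  have AB0: "A \<noteq> 0" "B \<noteq> 0" using AB nz by auto
  have "multiplicity p (squarefree_part A) \<le> multiplicity p (k * l)" if p: "prime p" for p
  proof (cases "even (multiplicity p A)")
    case True
    thus ?thesis using p by (simp add: prime_multiplicity_squarefree_part)
  next
    case odd: False
    hence "p dvd A" using not_dvd_imp_multiplicity_0 by fastforce
    have "p dvd k * l"
    proof (cases "p dvd B")
      case True
      thus ?thesis using common p \<open>p dvd A\<close> by simp
    next
      case False
      have "multiplicity p (A * B) = multiplicity p A"
        using p AB0 False
        by (subst prime_elem_multiplicity_mult_distrib) (auto simp: not_dvd_imp_multiplicity_0)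
      moreover have "multiplicity p (k * w\<^sup>2) = multiplicity p k + 2 * multiplicity p w"
        using p nz
        by (subst prime_elem_multiplicity_mult_distrib) (auto simp: prime_elem_multiplicity_power_distrib)
      ultimately have "multiplicity p A = multiplicity p k + 2 * multiplicity p w" using AB by simp
      hence "odd (multiplicity p k)" using odd by simp
      hence "p dvd k" using not_dvd_imp_multiplicity_0 by fastforce
      thus ?thesis by simp
    qed
    hence "multiplicity p (k * l) \<ge> 1"
      using p nz by (intro multiplicity_geI) (auto simp: not_prime_unit)
    thus ?thesis using p prime_multiplicity_squarefree_part_le_Suc_0[OF p, of A] by simp
  qed
  thus ?thesis using nz by (subst prime_multiplicity_le_imp_dvd) auto
qed

text \<open>The classes of the functions \<open>c + d\<close>, \<open>1 + c\<close>, \<open>1 + d\<close> modulo squares, up to a common factor.\<close>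

fun descent_class :: "rat \<times> rat \<times> rat \<Rightarrow> int \<times> int \<times> int" where
  "descent_class (s, c, d) =
     (let p = int (height (s, c, d)); u = \<lfloor>of_int p * c\<rfloor>; q = \<lfloor>of_int p * d\<rfloor>
      in (squarefree_part (u + q), squarefree_part (p + u), squarefree_part (p + q)))"

text \<open>The classes are finite in number because (u + q)(u - q), (p + u)(p - u) and (p + q)(p -
  q) are N or 2 N times v^2, and the prime 2 is the only possible common factor within each pair.
  The same p multiplies all three functions, so it becomes a square in a product of two of
  them.\<close>

lemma descent_class_props:
  fixes N :: nat
  assumes N: "squarefree N" and P: "(s, c, d) \<in> jacobi (of_nat N)" and s: "s \<noteq> 0"
    and cl: "descent_class (s, c, d) = (k1, k2, k3)"
  shows "\<exists>p e1 e2 e3 :: rat. p \<noteq> 0 \<and> p * (c + d) = of_int k1 * e1\<^sup>2 \<and>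
      p * (1 + c) = of_int k2 * e2\<^sup>2 \<and> p * (1 + d) = of_int k3 * e3\<^sup>2"
    and "{k1, k2, k3} \<subseteq> {k. k dvd 4 * int N}"
proof -
  obtain p v u q where p: "p = int (height (s, c, d))" "p > 0"
    "(s, c, d) = (of_int v / of_int p, of_int u / of_int p, of_int q / of_int p)"
    and eqs: "u\<^sup>2 = p\<^sup>2 - int N * v\<^sup>2" "q\<^sup>2 = p\<^sup>2 - 2 * int N * v\<^sup>2"
    and cop: "coprime p u" "coprime p q" "coprime u q"
    using primitive_coordinates[OF N P] .
  have pc: "of_int p * c = of_int u" "of_int p * d = of_int q" using p by simp_all
  hence k: "k1 = squarefree_part (u + q)" "k2 = squarefree_part (p + u)" "k3 = squarefree_part (p + q)"
    using cl by (simp_all add: p(1)[symmetric] Let_def)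
  have decomp: "(of_int x :: rat) = of_int (squarefree_part x) * (of_int (square_part x))\<^sup>2" for x :: int
    using squarefree_decompose[of x] by (metis of_int_mult of_int_power)
  show "\<exists>p e1 e2 e3 :: rat. p \<noteq> 0 \<and> p * (c + d) = of_int k1 * e1\<^sup>2 \<and>
      p * (1 + c) = of_int k2 * e2\<^sup>2 \<and> p * (1 + d) = of_int k3 * e3\<^sup>2"
  proof (intro exI conjI)
    show "(of_int p :: rat) \<noteq> 0" using p by simp
    show "of_int p * (c + d) = of_int k1 * (of_int (square_part (u + q)))\<^sup>2"
      "of_int p * (1 + c) = of_int k2 * (of_int (square_part (p + u)))\<^sup>2"
      "of_int p * (1 + d) = of_int k3 * (of_int (square_part (p + q)))\<^sup>2"
      unfolding k decomp[symmetric] by (simp_all add: distrib_left pc)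
  qed
  have v: "v \<noteq> 0" using s p by auto
  have N0: "int N \<noteq> 0" using N by (cases N) auto
  have two: "l dvd 2" if "prime l" "l dvd x + y" "l dvd x - y" "coprime x y" for l x y :: int
  proof -
    have "l dvd (x + y) + (x - y)" "l dvd (x + y) - (x - y)" 
      by (rule dvd_add[OF that(2,3)] dvd_diff[OF that(2,3)])+
    hence "l dvd 2 * x" "l dvd 2 * y" by simp_all
    hence "l dvd gcd (2 * x) (2 * y)" by simp
    also have "gcd (2 * x) (2 * y) = 2" using that(4) by (simp add: gcd_mult_distrib_int[symmetric])
    finally show ?thesis .
  qed
  have e: "(u + q) * (u - q) = int N * v\<^sup>2" "(p + u) * (p - u) = int N * v\<^sup>2"
    "(p + q) * (p - q) = (2 * int N) * v\<^sup>2"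
    using eqs by (simp_all add: power2_eq_square algebra_simps)
  have "k1 dvd int N * 2" unfolding k
    by (rule squarefree_part_dvd[OF e(1) N0 v _ two[OF _ _ _ cop(3)]]) simp
  moreover have "k2 dvd int N * 2" unfolding k
    by (rule squarefree_part_dvd[OF e(2) N0 v _ two[OF _ _ _ cop(1)]]) simp
  moreover have "k3 dvd 2 * int N * 2" unfolding k
    by (rule squarefree_part_dvd[OF e(3) _ v _ two[OF _ _ _ cop(2)]]) (use N0 in simp_all)
  moreover have "k dvd 4 * int N" if "k dvd int N * 2" for k
    using dvd_mult2[OF that, of 2] by (simp add: mult.commute)
  ultimately show "{k1, k2, k3} \<subseteq> {k. k dvd 4 * int N}"
    by (simp add: mult.commute)
qed

lemma jacobi_abs_less:
  assumes "t > 0" "(s, c, d) \<in> jacobi t" "s \<noteq> 0"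
  shows "\<bar>c\<bar> < 1" "\<bar>d\<bar> < 1" "c + d \<noteq> 0"
proof -
  have eqs: "c\<^sup>2 = 1 - t * s\<^sup>2" "d\<^sup>2 = 1 - 2 * t * s\<^sup>2" using assms by (auto simp: jacobi_def)
  have "t * s\<^sup>2 > 0" using assms by simp
  hence "c\<^sup>2 < 1" "d\<^sup>2 < 1" "d\<^sup>2 < c\<^sup>2" using eqs by linarith+
  thus "\<bar>c\<bar> < 1" "\<bar>d\<bar> < 1" by (simp_all add: abs_square_less_1)
  show "c + d \<noteq> 0"
  proof
    assume "c + d = 0"
    hence "c = - d" by simp
    with \<open>d\<^sup>2 < c\<^sup>2\<close> show False by simp
  qed
qed

text \<open>If \<open>(s, c, d) = 2 (\<sigma>, \<gamma>, \<delta>)\<close>, then \<open>c + d\<close>, \<open>1 + c\<close>, \<open>1 + d\<close> are proportional to \<open>\<gamma>\<^sup>2 \<delta>\<^sup>2\<close>, \<open>\<gamma>\<^sup>2\<close>, \<open>\<delta>\<^sup>2\<close>.\<close>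

lemma jacobi_halve:
  assumes t: "t > 0" and P: "(s, c, d) \<in> jacobi t" and s: "s \<noteq> 0"
    and x: "c + d = (1 + c) * x\<^sup>2" and y: "c + d = (1 + d) * y\<^sup>2"
  shows "\<exists>Q\<in>jacobi t. jacobi_add t Q Q = (s, c, d)"
proof -
  note lt = jacobi_abs_less[OF t P s]
  have eqs: "c\<^sup>2 = 1 - t * s\<^sup>2" "d\<^sup>2 = 1 - 2 * t * s\<^sup>2" using P by (auto simp: jacobi_def)
  define A B W where "A = 1 + c" and "B = 1 + d" and "W = c + d"
  have pos: "A > 0" "B > 0" "W \<noteq> 0" using lt by (auto simp: A_def B_def W_def)
  have x2: "x\<^sup>2 = W / A" and y2: "y\<^sup>2 = W / B"
    using x y pos by (simp_all add: A_def B_def W_def field_simps)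
  have s2: "t * s\<^sup>2 = (2 - A) * A" "2 * t * s\<^sup>2 = (2 - B) * B"
    using eqs by (simp_all add: A_def B_def power2_eq_square algebra_simps)
  have W: "W = A + B - 2" by (simp add: A_def B_def W_def)
  \<comment> \<open>The duplication formula s D = 2 z y x solved for z, with the value D = 2 W / (A
    B) = 2 x^2 y^2 / W that is verified below.\<close>
  define z where "z = s * y * x / W"
  have z2: "z\<^sup>2 = s\<^sup>2 / (A * B)"
    unfolding z_def power_mult_distrib power_divide x2 y2 using pos by (simp add: power2_eq_square)
  have tz: "t * z\<^sup>2 = (2 - A) / B" "2 * t * z\<^sup>2 = (2 - B) / A"
  proof -
    have "t * z\<^sup>2 = t * s\<^sup>2 / (A * B)" by (simp add: z2)
    thus "t * z\<^sup>2 = (2 - A) / B" unfolding s2(1) using pos by simp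
    have "2 * t * z\<^sup>2 = 2 * t * s\<^sup>2 / (A * B)" by (simp add: z2)
    thus "2 * t * z\<^sup>2 = (2 - B) / A" unfolding s2(2) using pos by simp
  qed
  have mem: "(z, y, x) \<in> jacobi t"
    unfolding jacobi_def using pos by (simp add: tz x2 y2) (simp add: W field_simps)
  have D: "jacobi_den t z z = 2 * W / (A * B)"
  proof -
    have "jacobi_den t z z = 1 - (t * z\<^sup>2) * (2 * t * z\<^sup>2)"
      by (simp add: jacobi_den_def power2_eq_square)
    also have "\<dots> = 2 * W / (A * B)" unfolding tz using pos by (simp add: W field_simps)
    finally show ?thesis .
  qed
  have 1: "z * y * x + z * y * x = s * jacobi_den t z z"
  proof -
    have "z * y * x + z * y * x = 2 * s * y\<^sup>2 * x\<^sup>2 / W"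
      by (simp add: z_def power2_eq_square)
    thus ?thesis unfolding D x2 y2 using pos by (simp add: field_simps)
  qed
  have 2: "y * y - t * z * z * x * x = c * jacobi_den t z z"
  proof -
    have "y * y - t * z * z * x * x = y\<^sup>2 - (t * z\<^sup>2) * x\<^sup>2" by (simp add: power2_eq_square)
    also have "\<dots> = (A - 1) * (2 * W / (A * B))" unfolding tz x2 y2 using pos by (simp add: field_simps)
    finally show ?thesis unfolding D by (simp add: A_def)
  qed
  have 3: "x * x - 2 * t * z * z * y * y = d * jacobi_den t z z"
  proof -
    have "x * x - 2 * t * z * z * y * y = x\<^sup>2 - (2 * t * z\<^sup>2) * y\<^sup>2" by (simp add: power2_eq_square)
    also have "\<dots> = (B - 1) * (2 * W / (A * B))" unfolding tz x2 y2 using pos by (simp add: field_simps)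
    finally show ?thesis unfolding D by (simp add: B_def)
  qed
  have "jacobi_den t z z \<noteq> 0" unfolding D using pos by simp
  hence "jacobi_add t (z, y, x) (z, y, x) = (s, c, d)"
    unfolding jacobi_add.simps 1 2 3 by simp
  with mem show ?thesis by blast
qed

text \<open>Together they say that (c + d) / (1 + c) and (c + d) / (1 + d) are multiplicative modulo
  squares: G G' is a square times (1 + c1)(1 + c2)(1 + d1)(1 + d2) by the last identity, and the
  third and fourth turn the remaining factors into squares.\<close>

lemma class_identities:
  fixes t s1 c1 d1 s2 c2 d2 :: rat
  assumes "c1\<^sup>2 = 1 - t * s1\<^sup>2" "d1\<^sup>2 = 1 - 2 * t * s1\<^sup>2" "c2\<^sup>2 = 1 - t * s2\<^sup>2" "d2\<^sup>2 = 1 - 2 * t * s2\<^sup>2"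
  defines "C \<equiv> c1 * c2 - t * s1 * s2 * d1 * d2" and "D \<equiv> d1 * d2 - 2 * t * s1 * s2 * c1 * c2"
    and "G \<equiv> c1 + d1 + c2 + d2 + (c2 * d1 - c1 * d2)" and "G' \<equiv> c1 + d1 + c2 + d2 - (c2 * d1 - c1 * d2)"
  shows "(C + D) * (G * G') = 2 * (jacobi_den t s1 s2 + C) * (c1 + d1) * (c2 + d2) * (1 + d1 * d2 - 2 * t * s1 * s2)"
    "(C + D) * (G * G') = 2 * (jacobi_den t s1 s2 + D) * (c1 + d1) * (c2 + d2) * (1 + c1 * c2 - t * s1 * s2)"
    "(1 + d1) * (1 + d2) * (2 * (1 + d1 * d2 - 2 * t * s1 * s2)) = ((1 + d1) * (1 + d2) - 2 * t * s1 * s2)\<^sup>2"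
    "(1 + c1) * (1 + c2) * (2 * (1 + c1 * c2 - t * s1 * s2)) = ((1 + c1) * (1 + c2) - t * s1 * s2)\<^sup>2"
    "(1 + c1) * (1 + d2) * G = (1 + c2) * (1 + d1) * G'"
proof -
  note reds = assms(1-4)[THEN square_rewrites(1)] assms(1-4)[THEN square_rewrites(2)]
  note unf = C_def D_def G_def G'_def jacobi_den_def
  show "(C + D) * (G * G') = 2 * (jacobi_den t s1 s2 + C) * (c1 + d1) * (c2 + d2) * (1 + d1 * d2 - 2 * t * s1 * s2)"
    unfolding unf by (simp add: reds power2_eq_square algebra_simps)
  show "(C + D) * (G * G') = 2 * (jacobi_den t s1 s2 + D) * (c1 + d1) * (c2 + d2) * (1 + c1 * c2 - t * s1 * s2)"
    unfolding unf by (simp add: reds power2_eq_square algebra_simps)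
  show "(1 + d1) * (1 + d2) * (2 * (1 + d1 * d2 - 2 * t * s1 * s2)) = ((1 + d1) * (1 + d2) - 2 * t * s1 * s2)\<^sup>2"
    "(1 + c1) * (1 + c2) * (2 * (1 + c1 * c2 - t * s1 * s2)) = ((1 + c1) * (1 + c2) - t * s1 * s2)\<^sup>2"
    "(1 + c1) * (1 + d2) * G = (1 + c2) * (1 + d1) * G'"
    unfolding unf by (simp_all add: reds power2_eq_square algebra_simps)
qed

lemma same_class_halve:
  assumes t: "t > 0" and P: "(s1, c1, d1) \<in> jacobi t" "s1 \<noteq> 0" and Q: "(s2, c2, d2) \<in> jacobi t" "s2 \<noteq> 0"
    and x: "(1 + c1) * (1 + c2) * ((c1 + d1) * (c2 + d2)) = x\<^sup>2"
    and y: "(1 + d1) * (1 + d2) * ((c1 + d1) * (c2 + d2)) = y\<^sup>2"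
    and sum: "jacobi_add t (s1, c1, d1) (s2, c2, d2) = (s3, c3, d3)" "s3 \<noteq> 0"
  shows "\<exists>R\<in>jacobi t. jacobi_add t R R = (s3, c3, d3)"
proof -
  have eqs: "c1\<^sup>2 = 1 - t * s1\<^sup>2" "d1\<^sup>2 = 1 - 2 * t * s1\<^sup>2" "c2\<^sup>2 = 1 - t * s2\<^sup>2" "d2\<^sup>2 = 1 - 2 * t * s2\<^sup>2"
    using P Q by (auto simp: jacobi_def)
  note lt = jacobi_abs_less[OF t P] jacobi_abs_less[OF t Q]
  define A1 A2 B1 B2 where AB: "A1 = 1 + c1" "A2 = 1 + c2" "B1 = 1 + d1" "B2 = 1 + d2"
  have pos: "A1 > 0" "A2 > 0" "B1 > 0" "B2 > 0" using lt by (auto simp: AB)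
  define E where "E = jacobi_den t s1 s2"
  have E: "E > 0" using jacobi_den_pos[OF t P(1) Q(1)] by (simp add: E_def)
  define C D where C: "C = c1 * c2 - t * s1 * s2 * d1 * d2" and D: "D = d1 * d2 - 2 * t * s1 * s2 * c1 * c2"
  have cd: "c3 = C / E" "d3 = D / E" using sum(1) by (auto simp: C D E_def)
  define G G' where G: "G = c1 + d1 + c2 + d2 + (c2 * d1 - c1 * d2)" and G': "G' = c1 + d1 + c2 + d2 - (c2 * d1 - c1 * d2)"
  define W where "W = (c1 + d1) * (c2 + d2)"
  define U V where "U = 2 * (1 + d1 * d2 - 2 * t * s1 * s2)" and "V = 2 * (1 + c1 * c2 - t * s1 * s2)"
  note id = class_identities[OF eqs, folded C D G G' E_def AB, folded U_def V_def]
  have W0: "W > 0"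
  proof -
    have "W \<noteq> 0" using lt by (simp add: W_def)
    moreover have "A1 * A2 * W \<ge> 0" using x by (simp add: AB W_def)
    moreover have "A1 * A2 > 0" using pos by simp
    ultimately show ?thesis by (simp add: zero_le_mult_iff)
  qed
  \<comment> \<open>G = (1 + d1)(1 + c2) - (1 - c1)(1 - d2). Since c1 + d1 and c2 + d2 have the same
    sign, one product exceeds the other factor by factor.\<close>
  have G0: "G \<noteq> 0"
  proof (cases "c1 + d1 > 0")
    case True
    hence "c2 + d2 > 0" using W0 by (simp add: W_def zero_less_mult_iff)
    hence "(1 - c1) * (1 - d2) < B1 * A2"
      using True lt by (intro mult_strict_mono) (auto simp: AB)
    thus ?thesis by (simp add: G AB algebra_simps)
  next
    case False
    hence "c1 + d1 < 0" "c2 + d2 < 0" using W0 by (auto simp: W_def zero_less_mult_iff)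
    hence "B1 * A2 < (1 - c1) * (1 - d2)"
      using lt by (intro mult_strict_mono) (auto simp: AB)
    thus ?thesis by (simp add: G AB algebra_simps)
  qed
  define K where "K = A1 * B2 * G"
  have K0: "K \<noteq> 0" using G0 pos by (simp add: K_def)
  have K2: "K\<^sup>2 = A1 * A2 * B1 * B2 * (G * G')"
  proof -
    have "K\<^sup>2 = (A1 * B2 * G) * (A2 * B1 * G')" using id(5) by (simp add: K_def power2_eq_square)
    thus ?thesis by (simp add: mult_ac)
  qed
  have i1: "(c3 + d3) * (G * G') = (1 + c3) * W * U"
  proof -
    have "(C + D) * (G * G') = (E + C) * W * U"
      unfolding U_def W_def id(1) by (simp only: mult_ac)
    hence "(C + D) * (G * G') / E = (E + C) * W * U / E" by simp
    thus ?thesis using E by (simp add: cd add_divide_distrib[symmetric] field_simps)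
  qed
  have i2: "(c3 + d3) * (G * G') = (1 + d3) * W * V"
  proof -
    have "(C + D) * (G * G') = (E + D) * W * V"
      unfolding V_def W_def id(2) by (simp only: mult_ac)
    hence "(C + D) * (G * G') / E = (E + D) * W * V / E" by simp
    thus ?thesis using E by (simp add: cd add_divide_distrib[symmetric] field_simps)
  qed
  have "(c3 + d3) * K\<^sup>2 = (1 + c3) * ((A1 * A2 * W) * (B1 * B2 * U))"
    unfolding K2 using i1 by (simp add: mult_ac)
  also have "\<dots> = (1 + c3) * (x * (B1 * B2 - 2 * t * s1 * s2))\<^sup>2"
    using x id(3) by (simp add: AB W_def U_def power_mult_distrib)
  finally have 1: "c3 + d3 = (1 + c3) * (x * (B1 * B2 - 2 * t * s1 * s2) / K)\<^sup>2"
    using K0 by (simp add: power_divide field_simps)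
  have "(c3 + d3) * K\<^sup>2 = (1 + d3) * ((B1 * B2 * W) * (A1 * A2 * V))"
    unfolding K2 using i2 by (simp add: mult_ac)
  also have "\<dots> = (1 + d3) * (y * (A1 * A2 - t * s1 * s2))\<^sup>2"
    using y id(4) by (simp add: AB W_def V_def power_mult_distrib)
  finally have 2: "c3 + d3 = (1 + d3) * (y * (A1 * A2 - t * s1 * s2) / K)\<^sup>2"
    using K0 by (simp add: power_divide field_simps)
  have "(s3, c3, d3) \<in> jacobi t"
    using jacobi_add_closed[OF t P(1) Q(1)] sum(1) by simp
  from jacobi_halve[OF t this sum(2) 1 2] show ?thesis .
qed

text \<open>Negation keeps c and d, so P - \<rho> satisfies the halving criterion whenever P and
  \<rho> have equal class. Points with s = 0, at most four, have no class here and are adjoined as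
  representatives.\<close>

lemma weak_mordell:
  fixes N :: nat
  assumes N: "squarefree N"
  defines "t \<equiv> of_nat N :: rat"
  shows "\<exists>R. finite R \<and> R \<subseteq> jacobi t \<and>
    (\<forall>P\<in>jacobi t. \<exists>Q\<in>jacobi t. \<exists>\<rho>\<in>R. P = jacobi_add t (jacobi_add t Q Q) \<rho>)"
proof -
  have t: "t > 0" using N by (cases N) (auto simp: t_def)
  define Z where "Z = {P \<in> jacobi t. fst P = 0}"
  define J where "J = {P \<in> jacobi t. fst P \<noteq> 0}"
  have zero: "(0, 1, 1) \<in> Z" by (simp add: Z_def jacobi_zero)
  have "Z \<subseteq> {0} \<times> {1, -1} \<times> {1, -1}"
    by (auto simp: Z_def jacobi_def power2_eq_1_iff)
  hence finZ: "finite Z" by (rule finite_subset) simp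
  let ?K = "{k. k dvd 4 * int N}"
  have "int N \<noteq> 0" using t by (simp add: t_def)
  hence "finite ?K" by (intro finite_divisors_int) simp
  moreover have "descent_class ` J \<subseteq> ?K \<times> ?K \<times> ?K"
  proof (intro subsetI, elim imageE)
    fix k P assume P: "k = descent_class P" "P \<in> J"
    obtain s c d where P': "P = (s, c, d)" by (metis prod_cases3)
    obtain k1 k2 k3 where k: "k = (k1, k2, k3)" by (metis prod_cases3)
    have "descent_class (s, c, d) = (k1, k2, k3)" "(s, c, d) \<in> jacobi (of_nat N)" "s \<noteq> 0"
      using P by (simp_all only: P' k) (simp_all add: J_def t_def)
    hence "{k1, k2, k3} \<subseteq> ?K" by (intro descent_class_props(2)[OF N])
    thus "k \<in> ?K \<times> ?K \<times> ?K" by (simp add: k)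
  qed
  ultimately have fin: "finite (descent_class ` J)" by (meson finite_SigmaI finite_subset)
  define rep where "rep = inv_into J descent_class"
  define reps where "reps = rep ` descent_class ` J"
  have reps: "finite reps" "reps \<subseteq> J"
    unfolding reps_def rep_def using fin by (blast intro: inv_into_into)+
  \<comment> \<open>The sums with elements of Z serve the case where the difference of P and its
    representative has s = 0.\<close>
  define R where "R = Z \<union> (\<lambda>(T, \<rho>). jacobi_add t T \<rho>) ` (Z \<times> reps)"
  have "finite R" using finZ reps by (simp add: R_def)
  moreover have "R \<subseteq> jacobi t"
    using jacobi_add_closed[OF t] reps(2) unfolding R_def Z_def J_def
    by (auto simp del: jacobi_add.simps)
  moreover have "\<exists>Q\<in>jacobi t. \<exists>\<rho>\<in>R. P = jacobi_add t (jacobi_add t Q Q) \<rho>" if P: "P \<in> jacobi t" for P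
  proof (cases "fst P = 0")
    case True
    have "P = jacobi_add t (jacobi_add t (0, 1, 1) (0, 1, 1)) P"
      by (simp only: jacobi_add_zero jacobi_add_commute[of t "(0, 1, 1)" P])
    moreover have "P \<in> R" using True P by (simp add: R_def Z_def)
    ultimately show ?thesis using jacobi_zero by blast
  next
    case False
    hence PJ: "P \<in> J" using P by (simp add: J_def)
    define \<rho> where "\<rho> = rep (descent_class P)"
    have \<rho>: "\<rho> \<in> reps" "descent_class \<rho> = descent_class P"
      using PJ by (auto simp: \<rho>_def reps_def rep_def f_inv_into_f)
    have \<rho>J: "\<rho> \<in> jacobi t" "fst \<rho> \<noteq> 0" using \<rho>(1) reps(2) by (auto simp: J_def)
    define S where "S = jacobi_add t P (jacobi_minus \<rho>)"
    have \<rho>m: "jacobi_minus \<rho> \<in> jacobi t" by (rule jacobi_minus_closed[OF \<rho>J(1)])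
    have S: "S \<in> jacobi t" unfolding S_def by (rule jacobi_add_closed[OF t P \<rho>m])
    have PS: "P = jacobi_add t S \<rho>"
      unfolding S_def jacobi_add_assoc[OF t P \<rho>m \<rho>J(1)] jacobi_add_commute[of t "jacobi_minus \<rho>"]
        jacobi_add_minus[OF t \<rho>J(1)] jacobi_add_zero ..
    show ?thesis
    proof (cases "fst S = 0")
      case True
      have "P = jacobi_add t (jacobi_add t (0, 1, 1) (0, 1, 1)) (jacobi_add t S \<rho>)"
        by (simp only: jacobi_add_zero jacobi_add_commute[of t "(0, 1, 1)" "jacobi_add t S \<rho>"] PS)
      moreover have "jacobi_add t S \<rho> \<in> R" using True S \<rho>(1) by (force simp: R_def Z_def)
      ultimately show ?thesis using jacobi_zero by blast
    next
      case False
      obtain s1 c1 d1 where P': "P = (s1, c1, d1)" by (metis prod_cases3)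
      obtain s2 c2 d2 where \<rho>': "\<rho> = (s2, c2, d2)" by (metis prod_cases3)
      obtain s3 c3 d3 where S': "S = (s3, c3, d3)" by (metis prod_cases3)
      obtain k1 k2 k3 where k: "descent_class P = (k1, k2, k3)" by (metis prod_cases3)
      obtain p e1 e2 e3 where e: "p \<noteq> 0" "p * (c1 + d1) = of_int k1 * e1\<^sup>2"
        "p * (1 + c1) = of_int k2 * e2\<^sup>2" "p * (1 + d1) = of_int k3 * e3\<^sup>2"
        using descent_class_props(1)[OF N, of s1 c1 d1 k1 k2 k3] PJ k by (auto simp: J_def P' t_def)
      obtain p' e1' e2' e3' where e': "p' \<noteq> 0" "p' * (c2 + d2) = of_int k1 * e1'\<^sup>2"
        "p' * (1 + c2) = of_int k2 * e2'\<^sup>2" "p' * (1 + d2) = of_int k3 * e3'\<^sup>2"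
        using descent_class_props(1)[OF N, of s2 c2 d2 k1 k2 k3] \<rho>J k \<rho>(2) by (auto simp: \<rho>' t_def)
      have "(p * (1 + c1)) * (p' * (1 + c2)) * ((p * (c1 + d1)) * (p' * (c2 + d2))) =
          (of_int k1 * of_int k2 * e1 * e1' * e2 * e2')\<^sup>2"
        unfolding e e' by (simp add: power2_eq_square mult_ac)
      hence x: "(1 + c1) * (1 + c2) * ((c1 + d1) * (c2 + d2)) =
          (of_int k1 * of_int k2 * e1 * e1' * e2 * e2' / (p * p'))\<^sup>2"
        using e(1) e'(1) by (simp add: power_divide field_simps power2_eq_square)
      have "(p * (1 + d1)) * (p' * (1 + d2)) * ((p * (c1 + d1)) * (p' * (c2 + d2))) =
          (of_int k1 * of_int k3 * e1 * e1' * e3 * e3')\<^sup>2"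
        unfolding e e' by (simp add: power2_eq_square mult_ac)
      hence y: "(1 + d1) * (1 + d2) * ((c1 + d1) * (c2 + d2)) =
          (of_int k1 * of_int k3 * e1 * e1' * e3 * e3' / (p * p'))\<^sup>2"
        using e(1) e'(1) by (simp add: power_divide field_simps power2_eq_square)
      have "\<exists>Q\<in>jacobi t. jacobi_add t Q Q = (s3, c3, d3)"
      proof (rule same_class_halve[OF t _ _ _ _ x y])
        show "(s1, c1, d1) \<in> jacobi t" "s1 \<noteq> 0" using PJ by (auto simp: J_def P')
        show "(- s2, c2, d2) \<in> jacobi t" "- s2 \<noteq> 0" using \<rho>m \<rho>J by (auto simp: \<rho>')
        show "jacobi_add t (s1, c1, d1) (- s2, c2, d2) = (s3, c3, d3)"
          using S' by (simp add: S_def P' \<rho>' del: jacobi_add.simps)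
        show "s3 \<noteq> 0" using False by (simp add: S')
      qed
      then obtain Q where Q: "Q \<in> jacobi t" "jacobi_add t Q Q = S" by (auto simp: S')
      have "\<rho> = jacobi_add t (0, 1, 1) \<rho>"
        using jacobi_add_zero jacobi_add_commute by simp
      hence "\<rho> \<in> R" using zero \<rho>(1) unfolding R_def by force
      thus ?thesis using Q PS by blast
    qed
  qed
  ultimately show ?thesis by blast
qed

section \<open>Counting primitive triangles\<close>

definition curve_height :: "nat \<Rightarrow> rat ec_point \<Rightarrow> real" where
  "curve_height N P = ln (real (height (to_jacobi (of_nat N) P)))"

lemma ln_height_nonneg: "0 \<le> ln (real (height P))"
  using height_pos[of P] by simp

text \<open>The constant ln 4 is the logarithm of the factor 4 lost in
  \<open>height_double\<close>.\<close>

lemma height_group_congruent_curve: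
  assumes N: "squarefree N"
  shows "\<exists>R. height_group (congruent_curve N) (curve_height N) (ln 4) R"
proof -
  define t :: rat where "t = of_nat N"
  have N0: "N > 0" using N by (cases N) auto
  hence t: "t > 0" by (simp add: t_def)
  define G where "G = congruent_curve N"
  have G: "G = congruent_rat_curve t" by (simp add: G_def congruent_curve_def t_def)
  interpret comm_group G unfolding G by (rule comm_group_congruent_curve[OF t])
  have car: "carrier G = curve t" and add: "mult G = ec_add (- (t\<^sup>2))" and one: "\<one>\<^bsub>G\<^esub> = Infinity"
    by (simp_all only: G ec_group_sel)
  have hom: "to_jacobi t (P \<otimes>\<^bsub>G\<^esub> Q) = jacobi_add t (to_jacobi t P) (to_jacobi t Q)"
    if "P \<in> carrier G" "Q \<in> carrier G" for P Q
    using ec_add_to_jacobi[OF t] that unfolding car add by blast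
  have mem: "to_jacobi t P \<in> jacobi t" if "P \<in> carrier G" for P
    using to_jacobi_closed[OF t] that unfolding car by blast
  have inj: "P = Q" if "to_jacobi t P = to_jacobi t Q" "P \<in> carrier G" "Q \<in> carrier G" for P Q
    using to_jacobi_eq_iff[OF t] that unfolding car by blast
  have inv: "to_jacobi t (inv\<^bsub>G\<^esub> P) = jacobi_minus (to_jacobi t P)" if P: "P \<in> carrier G" for P
  proof -
    have minus: "jacobi_minus (to_jacobi t P) \<in> jacobi t" by (rule jacobi_minus_closed[OF mem[OF P]])
    define Q where "Q = from_jacobi t (jacobi_minus (to_jacobi t P))"
    have Q: "Q \<in> carrier G" "to_jacobi t Q = jacobi_minus (to_jacobi t P)"
      using from_jacobi_closed[OF t minus] by (auto simp: Q_def car)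
    have "to_jacobi t (Q \<otimes>\<^bsub>G\<^esub> P) = to_jacobi t \<one>\<^bsub>G\<^esub>"
      unfolding hom[OF Q(1) P] Q(2) one
      using jacobi_add_minus[OF t mem[OF P]] jacobi_add_commute by simp
    hence "Q \<otimes>\<^bsub>G\<^esub> P = \<one>\<^bsub>G\<^esub>" by (rule inj) (use Q P in auto)
    hence "inv\<^bsub>G\<^esub> P = Q" using Q(1) P by (simp add: inv_equality)
    thus ?thesis using Q by simp
  qed
  obtain R where R: "finite R" "R \<subseteq> jacobi t"
    "\<And>P. P \<in> jacobi t \<Longrightarrow> \<exists>Q\<in>jacobi t. \<exists>\<rho>\<in>R. P = jacobi_add t (jacobi_add t Q Q) \<rho>"
    using weak_mordell[OF N] unfolding t_def by blast
  have "height_group G (curve_height N) (ln 4) (from_jacobi t ` R)"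
  proof (intro height_group.intro height_group_axioms.intro)
    show "comm_group G" by (rule comm_group_axioms)
  next
    fix P show "0 \<le> curve_height N P" unfolding curve_height_def by (rule ln_height_nonneg)
  next
    fix B :: real
    have "finite {Q \<in> jacobi t. height Q \<le> nat \<lfloor>exp B\<rfloor>}"
      unfolding t_def by (rule finite_height_le[OF N0])
    hence "finite (from_jacobi t ` {Q \<in> jacobi t. height Q \<le> nat \<lfloor>exp B\<rfloor>})" by simp
    moreover have "{P \<in> carrier G. curve_height N P \<le> B} \<subseteq>
        from_jacobi t ` {Q \<in> jacobi t. height Q \<le> nat \<lfloor>exp B\<rfloor>}"
    proof
      fix P assume P: "P \<in> {P \<in> carrier G. curve_height N P \<le> B}"
      hence "exp (ln (real (height (to_jacobi t P)))) \<le> exp B"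
        unfolding exp_le_cancel_iff by (simp add: curve_height_def t_def)
      hence "real (height (to_jacobi t P)) \<le> exp B"
        using height_pos[of "to_jacobi t P"] by simp
      hence "height (to_jacobi t P) \<le> nat \<lfloor>exp B\<rfloor>" by (simp add: le_nat_floor)
      moreover have "P = from_jacobi t (to_jacobi t P)" using from_to_jacobi[OF t] P car by auto
      ultimately show "P \<in> from_jacobi t ` {Q \<in> jacobi t. height Q \<le> nat \<lfloor>exp B\<rfloor>}"
        using mem P by blast
    qed
    ultimately show "finite {P \<in> carrier G. curve_height N P \<le> B}" by (rule finite_subset[rotated])
  next
    fix P Q assume P: "P \<in> carrier G" and Q: "Q \<in> carrier G"
    let ?p = "to_jacobi t P" and ?q = "to_jacobi t Q"
    have "height (jacobi_add t ?p ?q) * height (jacobi_add t ?p (jacobi_minus ?q)) \<le> (height ?p)\<^sup>2 * (height ?q)\<^sup>2"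
      unfolding t_def by (rule height_parallelogram[OF N0]) (use mem P Q in \<open>auto simp: t_def\<close>)
    hence "real (height (jacobi_add t ?p ?q)) * real (height (jacobi_add t ?p (jacobi_minus ?q))) \<le>
        (real (height ?p))\<^sup>2 * (real (height ?q))\<^sup>2"
      by (metis of_nat_le_iff of_nat_mult of_nat_power)
    hence "ln (real (height (jacobi_add t ?p ?q)) * real (height (jacobi_add t ?p (jacobi_minus ?q)))) \<le>
        ln ((real (height ?p))\<^sup>2 * (real (height ?q))\<^sup>2)"
      using height_pos by (subst ln_le_cancel_iff) auto
    thus "curve_height N (P \<otimes>\<^bsub>G\<^esub> Q) + curve_height N (P \<otimes>\<^bsub>G\<^esub> inv\<^bsub>G\<^esub> Q) \<le>
        2 * curve_height N P + 2 * curve_height N Q"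
      using P Q height_pos
      by (simp add: curve_height_def ln_mult ln_realpow hom inv flip: t_def)
  next
    fix P assume P: "P \<in> carrier G"
    let ?p = "to_jacobi t P"
    have "height ?p ^ 4 \<le> 4 * height (jacobi_add t ?p ?p)"
      unfolding t_def by (rule height_double[OF N]) (use mem P in \<open>auto simp: t_def\<close>)
    hence "real (height ?p) ^ 4 \<le> 4 * real (height (jacobi_add t ?p ?p))"
      by (metis of_nat_le_iff of_nat_mult of_nat_numeral of_nat_power)
    hence "ln (real (height ?p) ^ 4) \<le> ln (4 * real (height (jacobi_add t ?p ?p)))"
      using height_pos by (subst ln_le_cancel_iff) auto
    thus "4 * curve_height N P \<le> curve_height N (P \<otimes>\<^bsub>G\<^esub> P) + ln 4"
      using P height_pos by (simp add: curve_height_def ln_mult ln_realpow hom flip: t_def)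
  next
    show "finite (from_jacobi t ` R)" "from_jacobi t ` R \<subseteq> carrier G"
      using R(1,2) from_jacobi_closed[OF t] by (auto simp: car)
  next
    fix P assume P: "P \<in> carrier G"
    obtain Q \<rho> where Q: "Q \<in> jacobi t" "\<rho> \<in> R" "to_jacobi t P = jacobi_add t (jacobi_add t Q Q) \<rho>"
      using R(3)[OF mem[OF P]] by blast
    have r: "\<rho> \<in> jacobi t" using Q(2) R(2) by blast
    let ?Q = "from_jacobi t Q" and ?r = "from_jacobi t \<rho>"
    have c: "?Q \<in> carrier G" "?r \<in> carrier G" using from_jacobi_closed(1)[OF t] Q(1) r by (auto simp: car)
    have "to_jacobi t P = to_jacobi t (?Q \<otimes>\<^bsub>G\<^esub> ?Q \<otimes>\<^bsub>G\<^esub> ?r)"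
      using c Q from_jacobi_closed(2)[OF t] r by (simp add: hom)
    hence "P = ?Q \<otimes>\<^bsub>G\<^esub> ?Q \<otimes>\<^bsub>G\<^esub> ?r" by (rule inj) (use P c in auto)
    thus "\<exists>Q\<in>carrier G. \<exists>\<rho>\<in>from_jacobi t ` R. P = Q \<otimes>\<^bsub>G\<^esub> Q \<otimes>\<^bsub>G\<^esub> \<rho>" using c Q by blast
  qed
  thus ?thesis unfolding G_def by blast
qed

text \<open>Height at most B means root height at most sqrt (ln B); the square root is the origin of
  the exponent r/2.\<close>

lemma count_jacobi:
  assumes N: "squarefree N"
  shows "\<exists>K\<ge>0. \<forall>B\<ge>1. real (card {P \<in> jacobi (of_nat N). real (height P) \<le> B}) \<le>
    K * (1 + sqrt (ln B)) ^ group_rank (congruent_curve N)"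
proof -
  define t :: rat where "t = of_nat N"
  have N0: "N > 0" using N by (cases N) auto
  hence t: "t > 0" by (simp add: t_def)
  obtain R where "height_group (congruent_curve N) (curve_height N) (ln 4) R"
    using height_group_congruent_curve[OF N] by blast
  then interpret height_group "congruent_curve N" "curve_height N" "ln 4" R .
  have car: "carrier (congruent_curve N) = curve t"
    unfolding congruent_curve_def t_def by (rule ec_group_sel(1))
  obtain K where K: "K \<ge> 0" "\<And>b. b \<ge> 0 \<Longrightarrow> real (card {P \<in> curve t. root_height P \<le> b}) \<le>
      K * (1 + b) ^ group_rank (congruent_curve N)"
    using count_points unfolding car by blast
  have "real (card {P \<in> jacobi t. real (height P) \<le> B}) \<le>
    K * (1 + sqrt (ln B)) ^ group_rank (congruent_curve N)" if B: "B \<ge> 1" for B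
  proof -
    let ?A = "{P \<in> jacobi t. real (height P) \<le> B}" and ?C = "{P \<in> curve t. root_height P \<le> sqrt (ln B)}"
    have "inj_on (from_jacobi t) ?A"
      using from_jacobi_closed(2)[OF t] by (intro inj_on_inverseI[of _ "to_jacobi t"]) auto
    moreover have "from_jacobi t ` ?A \<subseteq> ?C"
    proof (intro subsetI, elim imageE)
      fix Q P assume Q: "Q = from_jacobi t P" and P: "P \<in> ?A"
      have "ln (real (height P)) \<le> ln B"
        using P height_pos[of P] B by (subst ln_le_cancel_iff) auto
      hence "root_height Q \<le> sqrt (ln B)"
        using from_jacobi_closed(2)[OF t] P by (simp add: root_height_def curve_height_def Q flip: t_def)
      thus "Q \<in> ?C" using from_jacobi_closed(1)[OF t] P Q by auto
    qed
    moreover have "finite ?C" using finite_root_height[of "sqrt (ln B)"] by (simp add: car)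
    ultimately have "card ?A \<le> card ?C" by (rule card_inj_on_le)
    also have "real (card ?C) \<le> K * (1 + sqrt (ln B)) ^ group_rank (congruent_curve N)"
      using B by (intro K) simp
    finally show ?thesis by simp
  qed
  thus ?thesis using K(1) unfolding t_def by blast
qed

text \<open>A triangle \<open>(a, b, c)\<close> of area \<open>N k\<^sup>2\<close> gives the arithmetic progression \<open>(b - a)\<^sup>2, c\<^sup>2, (a + b)\<^sup>2\<close>
  with difference \<open>N (2 k)\<^sup>2\<close>, which is a point of the quadric model.\<close>

fun triangle_point :: "nat \<times> nat \<times> nat \<Rightarrow> rat \<times> rat \<times> rat" where
  "triangle_point (a, b, c) =
    (of_nat (2 * square_part (a * b div 2)) / of_nat (a + b), of_nat c / of_nat (a + b),
     (of_nat b - of_nat a) / of_nat (a + b))"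

text \<open>Two odd squares sum to 2 modulo 4. Evenness makes \<open>a * b div 2\<close> the exact
  area.\<close>

lemma pythagorean_even:
  fixes a b c :: nat
  assumes "a\<^sup>2 + b\<^sup>2 = c\<^sup>2"
  shows "even (a * b)"
proof (rule ccontr)
  assume "odd (a * b)"
  hence ab: "odd a" "odd b" by auto
  have sq: "n\<^sup>2 mod 4 = (if odd n then 1 else 0)" for n :: nat
  proof (cases "odd n")
    case True
    then obtain k where "n = 2 * k + 1" by (elim oddE)
    hence "n\<^sup>2 = 4 * (k\<^sup>2 + k) + 1" by (simp add: power2_eq_square algebra_simps)
    thus ?thesis using True by presburger
  next
    case False
    then obtain k where "n = 2 * k" by auto
    thus ?thesis using False by (simp add: power2_eq_square)
  qed
  have "c\<^sup>2 mod 4 = (a\<^sup>2 mod 4 + b\<^sup>2 mod 4) mod 4" by (simp add: mod_add_eq flip: assms)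
  hence "c\<^sup>2 mod 4 = 2" using ab by (simp add: sq)
  thus False using sq[of c] by (auto split: if_splits)
qed

lemma triangle_area:
  assumes "(a, b, c) \<in> primitive_triangles N"
  shows "a * b = 2 * (N * (square_part (a * b div 2))\<^sup>2)"
proof -
  have "even (a * b)" using pythagorean_even assms by (auto simp: primitive_triangles_def)
  hence "a * b = 2 * (a * b div 2)" by simp
  also have "a * b div 2 = N * (square_part (a * b div 2))\<^sup>2"
    using squarefree_decompose[of "a * b div 2"] assms by (simp add: primitive_triangles_def)
  finally show ?thesis .
qed

lemma triangle_point_in_jacobi:
  assumes "T \<in> primitive_triangles N"
  shows "triangle_point T \<in> jacobi (of_nat N)"
proof -
  obtain a b c where T: "T = (a, b, c)" by (metis prod_cases3)
  have abc: "a > 0" "a\<^sup>2 + b\<^sup>2 = c\<^sup>2" using assms by (auto simp: T primitive_triangles_def)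
  define k where "k = square_part (a * b div 2)"
  define a' b' c' k' N' :: rat where r: "a' = of_nat a" "b' = of_nat b" "c' = of_nat c" "k' = of_nat k" "N' = of_nat N"
  have area: "a' * b' = 2 * N' * k'\<^sup>2"
    using arg_cong[OF triangle_area[OF assms[unfolded T]], of "of_nat :: nat \<Rightarrow> rat"] by (simp add: r k_def)
  have pyth: "a'\<^sup>2 + b'\<^sup>2 = c'\<^sup>2"
    using arg_cong[OF abc(2), of "of_nat :: nat \<Rightarrow> rat"] by (simp add: r)
  have p: "a' + b' \<noteq> 0" using abc by (simp add: r add_nonneg_eq_0_iff)
  have "c'\<^sup>2 = (a' + b')\<^sup>2 - N' * (2 * k')\<^sup>2" "(b' - a')\<^sup>2 = (a' + b')\<^sup>2 - (2 * N') * (2 * k')\<^sup>2"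
    using area pyth by (simp_all add: power2_eq_square algebra_simps)
  from this[THEN divide_power2_eq[OF p]] show ?thesis
    by (simp add: T jacobi_def r k_def)
qed

lemma height_triangle_point:
  assumes "(a, b, c) \<in> primitive_triangles N"
  shows "height (triangle_point (a, b, c)) \<le> 2 * c"
proof -
  have abc: "a > 0" "a < c" "b < c" using assms by (auto simp: primitive_triangles_def)
  have "denominator (triangle_point (a, b, c)) (int (a + b))"
  proof -
    have "(of_nat (a + b) :: rat) \<noteq> 0" using abc by (simp only: of_nat_eq_0_iff)
    hence e: "of_int (int (a + b)) * (x / of_nat (a + b)) = x" for x :: rat by simp
    show ?thesis
      unfolding triangle_point.simps denominator.simps e by (intro conjI Ints_diff Ints_of_nat)
  qed
  hence "int (height (triangle_point (a, b, c))) \<le> int (a + b)"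
    using abc by (intro height_le) auto
  thus ?thesis using abc by simp
qed

text \<open>The last coordinate (b - a) / (a + b) determines the ratio of the legs, and coprimality
  determines the legs.\<close>

lemma inj_on_triangle_point: "inj_on triangle_point (primitive_triangles N)"
proof (rule inj_onI)
  fix T T' assume T: "T \<in> primitive_triangles N" "T' \<in> primitive_triangles N"
    and eq: "triangle_point T = triangle_point T'"
  obtain a b c where abc: "T = (a, b, c)" by (metis prod_cases3)
  obtain a' b' c' where abc': "T' = (a', b', c')" by (metis prod_cases3)
  have pos: "a + b > 0" "a' + b' > 0" and cop: "coprime a b" "coprime a' b'"
    using T by (auto simp: abc abc' primitive_triangles_def)
  define p p' :: rat where p: "p = of_nat (a + b)" "p' = of_nat (a' + b')"
  have p0: "p > 0" "p' > 0" using pos unfolding p by (simp_all only: of_nat_0_less_iff)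
  have "of_nat c / p = of_nat c' / p'" "(of_nat b - of_nat a) / p = (of_nat b' - of_nat a') / p'"
    using eq unfolding abc abc' p by simp_all
  hence c: "of_nat c * p' = of_nat c' * p" and "(of_nat b - of_nat a) * p' = (of_nat b' - of_nat a') * p"
    using p0 by (simp_all add: field_simps)
  hence "(of_nat (a * b') :: rat) = of_nat (a' * b)"
    unfolding p by (simp add: algebra_simps)
  hence ab: "a * b' = a' * b" by (simp only: of_nat_eq_iff)
  have "a dvd a' * b" "a' dvd a * b'" using ab by (metis dvd_triv_left)+
  hence "a dvd a'" "a' dvd a" using cop by (simp_all add: coprime_dvd_mult_left_iff)
  hence a: "a = a'" by (simp add: dvd_antisym)
  moreover have "b = b'" 
    using ab a T by (auto simp: abc primitive_triangles_def)
  ultimately show "T = T'" using c p0 by (simp add: abc abc' p)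
qed

text \<open>The argument 2 Y appears because the point of a triangle has denominator a + b < 2
  c.\<close>

lemma count_triangles:
  assumes N: "squarefree N"
  shows "\<exists>K\<ge>0. \<forall>Y\<ge>1. finite {T \<in> primitive_triangles N. real (snd (snd T)) \<le> Y} \<and>
    real (card {T \<in> primitive_triangles N. real (snd (snd T)) \<le> Y}) \<le>
      K * (1 + sqrt (ln (2 * Y))) ^ group_rank (congruent_curve N)"
proof -
  obtain K where K: "K \<ge> 0" "\<And>B. B \<ge> 1 \<Longrightarrow> real (card {P \<in> jacobi (of_nat N). real (height P) \<le> B}) \<le>
    K * (1 + sqrt (ln B)) ^ group_rank (congruent_curve N)" using count_jacobi[OF N] by blast
  have N0: "N > 0" using N by (cases N) auto
  have "finite {T \<in> primitive_triangles N. real (snd (snd T)) \<le> Y} \<and>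
      real (card {T \<in> primitive_triangles N. real (snd (snd T)) \<le> Y}) \<le>
      K * (1 + sqrt (ln (2 * Y))) ^ group_rank (congruent_curve N)" if Y: "Y \<ge> 1" for Y
  proof -
    let ?A = "{T \<in> primitive_triangles N. real (snd (snd T)) \<le> Y}"
      and ?B = "{P \<in> jacobi (of_nat N). real (height P) \<le> 2 * Y}"
    have inj: "inj_on triangle_point ?A"
      by (rule inj_on_subset[OF inj_on_triangle_point]) blast
    have sub: "triangle_point ` ?A \<subseteq> ?B"
    proof (intro subsetI, elim imageE)
      fix P T assume P: "P = triangle_point T" and T: "T \<in> ?A"
      obtain a b c where abc: "T = (a, b, c)" by (metis prod_cases3)
      have "real (height P) \<le> real (2 * c)"
        using height_triangle_point[of a b c N] T unfolding P abc by (intro of_nat_mono) simp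
      also have "\<dots> \<le> 2 * Y" using T by (simp add: abc)
      finally show "P \<in> ?B" using triangle_point_in_jacobi[of T N] T P by simp
    qed
    have "?B \<subseteq> {P \<in> jacobi (of_nat N). height P \<le> nat \<lfloor>2 * Y\<rfloor>}"
      by (auto simp: le_nat_floor)
    hence fin: "finite ?B" by (rule finite_subset) (rule finite_height_le[OF N0])
    have "card ?A \<le> card ?B" using inj sub fin by (rule card_inj_on_le)
    also have "real (card ?B) \<le> K * (1 + sqrt (ln (2 * Y))) ^ group_rank (congruent_curve N)"
      using Y by (intro K) simp
    finally have "real (card ?A) \<le> K * (1 + sqrt (ln (2 * Y))) ^ group_rank (congruent_curve N)" by simp
    moreover have "finite ?A" using inj_on_finite[OF inj sub fin] .
    ultimately show ?thesis by blast
  qed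
  thus ?thesis using K(1) by blast
qed

section \<open>Summation over the hypotenuses\<close>

lemma summable_polynomial_over_power: "summable (\<lambda>j. (real j + 2) ^ r / 2 ^ j)"
proof (rule summable_comparison_test_ev)
  show "eventually (\<lambda>j. norm ((real j + 2) ^ r / 2 ^ j) \<le> (3 / 4) ^ j) sequentially"
  proof -
    have "eventually (\<lambda>j. (real j + 2) ^ r \<le> (3 / 2) ^ j) sequentially"
      by real_asymp
    thus ?thesis
    proof eventually_elim
      case (elim j)
      hence "(real j + 2) ^ r / 2 ^ j \<le> (3 / 2) ^ j / 2 ^ j" by (rule divide_right_mono) simp
      also have "\<dots> = (3 / 4) ^ j" by (simp flip: power_divide)
      finally show ?case by simp
    qed
  qed
  show "summable (\<lambda>j. (3 / 4 :: real) ^ j)" by (intro summable_geometric) simp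
qed

text \<open>The range of \<open>c\<close> is decomposed dyadically, starting at \<open>Y\<close>.\<close>

lemma reciprocal_sum_tail:
  fixes c :: "'a \<Rightarrow> nat" and K :: real and r :: nat
  assumes K: "K \<ge> 0"
    and count: "\<And>Y. Y \<ge> 1 \<Longrightarrow> finite {x \<in> A. real (c x) \<le> Y} \<and>
      real (card {x \<in> A. real (c x) \<le> Y}) \<le> K * (1 + sqrt (ln (2 * Y))) ^ r"
    and Y: "Y \<ge> 1" and F: "finite F" "F \<subseteq> {x \<in> A. real (c x) > Y}"
  shows "(\<Sum>x\<in>F. 1 / real (c x)) \<le> K * (\<Sum>j. (real j + 2) ^ r / 2 ^ j) * (1 + sqrt (ln (2 * Y))) ^ r / Y"
proof -
  define L where "L = sqrt (ln (2 * Y))"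
  have L: "L \<ge> 0" using Y by (simp add: L_def)
  \<comment> \<open>Bound for the block between 2^j Y and 2^(j+1) Y. The logarithmic factor at
    2^(j+1) Y is at most (1 + L)(j + 2), so the dependence on Y leaves the series over j.\<close>
  define g where "g j = K * (1 + L) ^ r / Y * ((real j + 2) ^ r / 2 ^ j)" for j :: nat
  have count_le: "real (card {x \<in> A. real (c x) \<le> 2 ^ Suc j * Y}) / (2 ^ j * Y) \<le> g j" for j
  proof -
    have Y': "1 \<le> 2 ^ Suc j * Y"
      using mult_mono[of 1 "2 ^ Suc j" 1 Y] Y one_le_power[of "2::real" "Suc j"] by simp
    have "ln (2 * (2 ^ Suc j * Y)) = ln ((2 * Y) * 2 ^ Suc j)" by (simp add: mult_ac)
    also have "\<dots> = ln (2 * Y) + ln (2 ^ Suc j)" using Y by (intro ln_mult_pos) auto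
    also have "ln (2 ^ Suc j :: real) = real (Suc j) * ln 2" by (rule ln_realpow)
    also have "ln (2 * Y) + real (Suc j) * ln 2 \<le> ln (2 * Y) + real (Suc j) * 1"
      using ln_le_minus_one[of 2] by (intro add_left_mono mult_left_mono) auto
    finally have "sqrt (ln (2 * (2 ^ Suc j * Y))) \<le> sqrt (ln (2 * Y) + real (Suc j))" by simp
    also have "\<dots> \<le> L + sqrt (real (Suc j))"
      unfolding L_def using Y by (intro sqrt_add_le_add_sqrt) auto
    also have "sqrt (real (Suc j)) \<le> real (Suc j)"
      by (rule real_le_lsqrt) (auto simp: power2_eq_square)
    finally have "1 + sqrt (ln (2 * (2 ^ Suc j * Y))) \<le> real j + 2 + L" by simp
    also have "\<dots> \<le> (1 + L) * (real j + 2)" using L by (simp add: algebra_simps)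
    finally have le: "1 + sqrt (ln (2 * (2 ^ Suc j * Y))) \<le> (1 + L) * (real j + 2)" .
    have "real (card {x \<in> A. real (c x) \<le> 2 ^ Suc j * Y}) \<le> K * (1 + sqrt (ln (2 * (2 ^ Suc j * Y)))) ^ r"
      using count[OF Y'] by blast
    also have "\<dots> \<le> K * ((1 + L) * (real j + 2)) ^ r"
      using le K Y' by (intro mult_left_mono power_mono) auto
    finally have "real (card {x \<in> A. real (c x) \<le> 2 ^ Suc j * Y}) / (2 ^ j * Y) \<le>
        K * ((1 + L) * (real j + 2)) ^ r / (2 ^ j * Y)"
      using Y by (intro divide_right_mono) auto
    also have "K * ((1 + L) * (real j + 2)) ^ r / (2 ^ j * Y) = g j"
      unfolding g_def power_mult_distrib by (simp add: mult.commute[of Y])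
    finally show ?thesis .
  qed
  have part: "(\<Sum>x | x \<in> F \<and> real (c x) \<le> 2 ^ J * Y. 1 / real (c x)) \<le> (\<Sum>j<J. g j)" for J
  proof (induction J)
    case 0
    have empty: "{x. x \<in> F \<and> real (c x) \<le> 2 ^ 0 * Y} = {}" using F by auto
    show ?case unfolding empty by simp
  next
    case (Suc J)
    let ?S = "\<lambda>J. {x. x \<in> F \<and> real (c x) \<le> 2 ^ J * Y}"
    let ?D = "{x. x \<in> F \<and> 2 ^ J * Y < real (c x) \<and> real (c x) \<le> 2 ^ Suc J * Y}"
    have "?S (Suc J) = ?S J \<union> ?D"
    proof -
      have "2 ^ J * Y \<le> 2 ^ Suc J * Y" using Y by simp
      thus ?thesis by auto
    qed
    hence split: "(\<Sum>x\<in>?S (Suc J). 1 / real (c x)) = (\<Sum>x\<in>?S J. 1 / real (c x)) + (\<Sum>x\<in>?D. 1 / real (c x))"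
      using F(1) by (simp only:) (intro sum.union_disjoint, auto)
    have "(\<Sum>x\<in>?D. 1 / real (c x)) \<le> (\<Sum>x\<in>?D. 1 / (2 ^ J * Y))"
      using Y by (intro sum_mono frac_le) auto
    also have "\<dots> = real (card ?D) / (2 ^ J * Y)" by simp
    also have "\<dots> \<le> real (card {x \<in> A. real (c x) \<le> 2 ^ Suc J * Y}) / (2 ^ J * Y)"
    proof (intro divide_right_mono of_nat_mono card_mono)
      have "1 \<le> 2 ^ Suc J * Y"
        using mult_mono[of 1 "2 ^ Suc J" 1 Y] Y one_le_power[of "2::real" "Suc J"] by simp
      thus "finite {x \<in> A. real (c x) \<le> 2 ^ Suc J * Y}" using count by blast
    qed (use F Y in auto)
    also have "\<dots> \<le> g J" by (rule count_le)
    finally show ?case unfolding split using Suc by simp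
  qed
  have g_nonneg: "g j \<ge> 0" for j using K L Y by (simp add: g_def)
  have "summable g" unfolding g_def by (intro summable_mult summable_polynomial_over_power)
  obtain J :: nat where J: "real (Max (insert 0 (c ` F))) < 2 ^ J"
    using real_arch_pow[of 2 "real (Max (insert 0 (c ` F)))"] by auto
  have "real (c x) \<le> 2 ^ J * Y" if "x \<in> F" for x
  proof -
    have "c x \<le> Max (insert 0 (c ` F))" using that F(1) by (intro Max_ge) auto
    hence "real (c x) \<le> 2 ^ J" using J by linarith
    also have "\<dots> \<le> 2 ^ J * Y" using Y by simp
    finally show ?thesis .
  qed
  hence "{x. x \<in> F \<and> real (c x) \<le> 2 ^ J * Y} = F" by auto
  hence "(\<Sum>x\<in>F. 1 / real (c x)) \<le> (\<Sum>j<J. g j)" using part[of J] by simp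
  also have "\<dots> \<le> suminf g" using \<open>summable g\<close> g_nonneg by (intro sum_le_suminf) auto
  also have "suminf g = K * (1 + L) ^ r / Y * (\<Sum>j. (real j + 2) ^ r / 2 ^ j)"
    unfolding g_def by (intro suminf_mult summable_polynomial_over_power)
  finally show ?thesis by (simp add: L_def mult_ac)
qed

text \<open>Each quotient differs from Y / c by at most 1, at a total cost bounded by the count up
  to Y; completing the series costs Y times its tail. The tail bound at Y = 1 covers all of A, since
  c > 1, and gives summability.\<close>

lemma lattice_count_asymptotics:
  fixes c :: "'a \<Rightarrow> nat" and K :: real and r :: nat
  assumes K: "K \<ge> 0" and c1: "\<And>x. x \<in> A \<Longrightarrow> c x > 1"
    and count: "\<And>Y. Y \<ge> 1 \<Longrightarrow> finite {x \<in> A. real (c x) \<le> Y} \<and>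
      real (card {x \<in> A. real (c x) \<le> Y}) \<le> K * (1 + sqrt (ln (2 * Y))) ^ r"
  shows "(\<lambda>x. 1 / real (c x)) summable_on A"
    and "\<exists>K'. \<forall>Y\<ge>1. \<bar>(\<Sum>x | x \<in> A \<and> real (c x) \<le> Y. real (nat \<lfloor>Y\<rfloor> div c x)) - Y * infsum (\<lambda>x. 1 / real (c x)) A\<bar>
      \<le> K' * (1 + sqrt (ln (2 * Y))) ^ r"
proof -
  let ?f = "\<lambda>x. 1 / real (c x)"
  define M where "M = K * (\<Sum>j. (real j + 2) ^ r / 2 ^ j)"
  note tail = reciprocal_sum_tail[OF K count, folded M_def]
  have "{x \<in> A. real (c x) > 1} = A" using c1 by auto
  hence "(\<Sum>x\<in>F. ?f x) \<le> M * (1 + sqrt (ln (2 * 1))) ^ r / 1" if "finite F" "F \<subseteq> A" for F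
    using tail[of 1 F] that by simp
  hence "bdd_above (sum ?f ` {F. F \<subseteq> A \<and> finite F})" unfolding bdd_above_def by blast
  thus sm: "?f summable_on A"
    by (intro nonneg_bdd_above_summable_on) auto
  have "\<bar>(\<Sum>x | x \<in> A \<and> real (c x) \<le> Y. real (nat \<lfloor>Y\<rfloor> div c x)) - Y * infsum ?f A\<bar>
      \<le> (K + M) * (1 + sqrt (ln (2 * Y))) ^ r" if Y: "Y \<ge> 1" for Y
  proof -
    let ?B = "{x \<in> A. real (c x) \<le> Y}" and ?T = "{x \<in> A. real (c x) > Y}"
    have fin: "finite ?B" using count[OF Y] by blast
    have smT: "?f summable_on ?T" by (rule summable_on_subset_banach[OF sm]) auto
    have smB: "?f summable_on ?B" using fin by simp
    have "infsum ?f A = infsum ?f (?B \<union> ?T)" by (rule arg_cong[of _ _ "infsum ?f"]) auto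
    also have "\<dots> = infsum ?f ?B + infsum ?f ?T" using smB smT by (intro infsum_Un_disjoint) auto
    also have "infsum ?f ?B = (\<Sum>x\<in>?B. ?f x)" using fin by simp
    finally have split: "infsum ?f A = (\<Sum>x\<in>?B. ?f x) + infsum ?f ?T" .
    have T0: "infsum ?f ?T \<ge> 0" by (intro infsum_nonneg) auto
    have "infsum ?f ?T \<le> M * (1 + sqrt (ln (2 * Y))) ^ r / Y"
      using tail[OF _ Y] by (intro infsum_le_finite_sums[OF smT]) auto
    hence T1: "Y * infsum ?f ?T \<le> M * (1 + sqrt (ln (2 * Y))) ^ r"
      using Y by (simp add: field_simps)
    have floor_div: "0 \<le> Y * ?f x - real (nat \<lfloor>Y\<rfloor> div c x) \<and> Y * ?f x - real (nat \<lfloor>Y\<rfloor> div c x) \<le> 1"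
      if "x \<in> ?B" for x
    proof -
      have cx: "c x > 0" using c1[of x] that by auto
      have "0 \<le> \<lfloor>Y\<rfloor> div int (c x)" using Y cx by (simp add: pos_imp_zdiv_nonneg_iff)
      hence "real (nat \<lfloor>Y\<rfloor> div c x) = of_int (\<lfloor>Y\<rfloor> div int (c x))" using Y by (simp add: nat_div_as_int)
      also have "\<lfloor>Y\<rfloor> div int (c x) = \<lfloor>Y / real (c x)\<rfloor>"
        using floor_divide_real_eq_div[of "int (c x)" Y] by simp
      finally show ?thesis by simp linarith
    qed
    define S where "S = (\<Sum>x\<in>?B. real (nat \<lfloor>Y\<rfloor> div c x))"
    have diff: "Y * (\<Sum>x\<in>?B. ?f x) - S = (\<Sum>x\<in>?B. Y * ?f x - real (nat \<lfloor>Y\<rfloor> div c x))"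
      by (simp add: S_def sum_subtractf sum_distrib_left)
    have "0 \<le> Y * (\<Sum>x\<in>?B. ?f x) - S" unfolding diff using floor_div by (intro sum_nonneg) blast
    moreover have "Y * (\<Sum>x\<in>?B. ?f x) - S \<le> (\<Sum>x\<in>?B. 1)" unfolding diff using floor_div by (intro sum_mono) blast
    moreover have "(\<Sum>x\<in>?B. 1) \<le> K * (1 + sqrt (ln (2 * Y))) ^ r" using count[OF Y] by simp
    moreover have "Y * infsum ?f A = Y * (\<Sum>x\<in>?B. ?f x) + Y * infsum ?f ?T"
      unfolding split by (simp add: distrib_left)
    moreover have "Y * infsum ?f ?T \<ge> 0" using T0 Y by simp
    ultimately have "\<bar>S - Y * infsum ?f A\<bar> \<le> (K + M) * (1 + sqrt (ln (2 * Y))) ^ r"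
      using T1 by (simp add: distrib_right)
    thus ?thesis by (simp only: S_def)
  qed
  thus "\<exists>K'. \<forall>Y\<ge>1. \<bar>(\<Sum>x | x \<in> A \<and> real (c x) \<le> Y. real (nat \<lfloor>Y\<rfloor> div c x)) - Y * infsum ?f A\<bar>
      \<le> K' * (1 + sqrt (ln (2 * Y))) ^ r" by blast
qed

section \<open>Progressions of squares and multiples of primitive triangles\<close>

lemma squarefree_part_eqI:
  fixes N e w :: nat
  assumes N: "squarefree N" and e: "e > 0" and eq: "N * e = w\<^sup>2"
  shows "squarefree_part e = N"
proof -
  have N0: "N > 0" using N by (cases N) auto
  have w: "w > 0" using N0 e eq by (cases w) auto
  have "multiplicity p (squarefree_part e) = multiplicity p N" if p: "prime p" for p
  proof -
    have "multiplicity p (N * e) = multiplicity p N + multiplicity p e"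
      using p N0 e by (subst prime_elem_multiplicity_mult_distrib) auto
    moreover have "multiplicity p (w\<^sup>2) = 2 * multiplicity p w"
      using p w by (subst prime_elem_multiplicity_power_distrib) auto
    ultimately have sum: "multiplicity p N + multiplicity p e = 2 * multiplicity p w" using eq by simp
    have le: "multiplicity p N \<le> 1"
      using N p N0 by (simp add: squarefree_factorial_semiring'')
    have "j mod 2 = i" if "i + j = 2 * l" "i \<le> 1" for i j l :: nat
      using that by presburger
    from this[OF sum le] show ?thesis
      unfolding prime_multiplicity_squarefree_part[OF p] .
  qed
  moreover have "squarefree_part e > 0" using squarefree_part_nonzero[of e] by blast
  ultimately show ?thesis using N0 multiplicity_eq_nat by blast
qed

lemma double_square_not_square:
  fixes x y :: nat
  assumes "y\<^sup>2 = 2 * x\<^sup>2"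
  shows "x = 0"
proof (rule ccontr)
  assume x: "x \<noteq> 0"
  have "(of_nat y :: rat)\<^sup>2 = 2 * (of_nat x)\<^sup>2"
    using arg_cong[OF assms, of "of_nat :: nat \<Rightarrow> rat"] by simp
  hence "((of_nat y :: rat) / of_nat x)\<^sup>2 = 2" using x by (simp add: power_divide)
  thus False using rat_power2_ne_2 by blast
qed

lemma primitive_scaling:
  fixes A B C :: nat
  assumes A: "0 < A" "A < B" and pyth: "A\<^sup>2 + B\<^sup>2 = C\<^sup>2"
  obtains k a b c where "k > 0" "A = k * a" "B = k * b" "C = k * c" "0 < a" "a < b" "b < c"
    "a\<^sup>2 + b\<^sup>2 = c\<^sup>2" "coprime a b" "coprime a c" "coprime b c"
proof -
  define k where "k = gcd A B"
  have k: "k > 0" using A by (simp add: k_def)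
  obtain a b where ab: "A = k * a" "B = k * b" "coprime a b"
    using gcd_coprime_exists[of A B] A unfolding k_def by (auto simp: mult.commute)
  have "k\<^sup>2 dvd C\<^sup>2" unfolding pyth[symmetric] ab by (simp add: power_mult_distrib)
  hence "k dvd C" by (simp add: pow_divides_pow_iff)
  then obtain c where c: "C = k * c" by auto
  have "k\<^sup>2 * (a\<^sup>2 + b\<^sup>2) = k\<^sup>2 * c\<^sup>2"
    using pyth unfolding ab c by (simp add: power_mult_distrib distrib_left)
  hence eq: "a\<^sup>2 + b\<^sup>2 = c\<^sup>2" using k by simp
  have "0 < a" "a < b" using A k unfolding ab by simp_all
  moreover have "b < c"
  proof (rule power_less_imp_less_base)
    show "b\<^sup>2 < c\<^sup>2" using \<open>0 < a\<close> by (simp flip: eq)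
  qed simp
  moreover have cop: "coprime (x\<^sup>2) (x\<^sup>2 + y\<^sup>2)" if "coprime x y" for x y :: nat
  proof -
    have "coprime (x\<^sup>2) (y\<^sup>2)" using that by simp
    thus ?thesis by (simp only: coprime_iff_gcd_eq_1 gcd_add2)
  qed
  have "coprime (a\<^sup>2) (c\<^sup>2)" "coprime (b\<^sup>2) (c\<^sup>2)"
    using cop[of a b] cop[of b a] ab(3) by (simp_all only: coprime_commute[of b a] add.commute[of "b\<^sup>2"] eq)
  ultimately show ?thesis using that[OF k ab(1,2) c] eq ab(3) by simp
qed

text \<open>The difference is formed in the integers: truncated subtraction would give 0, a square,
  for m < n.\<close>

definition square_progressions :: "nat \<Rightarrow> nat \<Rightarrow> (nat \<times> nat) set" where
  "square_progressions N M = {(m, n). m \<in> {1..M} \<and> n \<in> {1..M} \<and> is_square (int m + int n) \<and>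
     is_square (int m - int n) \<and> is_square (int m) \<and> is_square (int N * int n)}"

lemma is_square_int_iff: "is_square (x :: int) \<longleftrightarrow> (\<exists>y::nat. x = int y ^ 2)"
proof
  assume "is_square x"
  then obtain z where "x = z ^ 2" by (auto elim: is_nth_powerE)
  hence "x = int (nat \<bar>z\<bar>) ^ 2" by simp
  thus "\<exists>y::nat. x = int y ^ 2" by blast
qed (auto intro: is_nth_powerI)

lemma shifted_sum_eq_card: "shifted_sum N X = card (square_progressions N (nat \<lfloor>X\<rfloor>))"
proof -
  let ?I = "{1..\<lfloor>X\<rfloor>}"
  let ?Q = "\<lambda>m n. is_square (m + n) \<and> is_square (m - n) \<and> is_square m \<and> is_square (int N * n)"
  have "shifted_sum N X = (\<Sum>(m, n)\<in>?I \<times> ?I. if ?Q m n then 1 else 0)"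
    unfolding shifted_sum_def sum.cartesian_product[symmetric]
    by (intro sum.cong refl) (auto simp: tau_def)
  also have "\<dots> = card {p \<in> ?I \<times> ?I. ?Q (fst p) (snd p)}"
    by (simp add: sum.If_cases case_prod_beta' Int_def)
  also have "{p \<in> ?I \<times> ?I. ?Q (fst p) (snd p)} = (\<lambda>(m, n). (int m, int n)) ` square_progressions N (nat \<lfloor>X\<rfloor>)"
    (is "?L = ?R")
  proof (intro equalityI subsetI)
    fix p assume p: "p \<in> ?L"
    then obtain m n where mn: "p = (m, n)" "m \<in> ?I" "n \<in> ?I" "?Q m n" by auto
    hence "(nat m, nat n) \<in> square_progressions N (nat \<lfloor>X\<rfloor>)"
      by (auto simp: square_progressions_def)
    moreover have "p = (\<lambda>(m, n). (int m, int n)) (nat m, nat n)" using mn by auto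
    ultimately show "p \<in> ?R" by blast
  next
    fix p assume "p \<in> ?R"
    thus "p \<in> ?L" by (auto simp: square_progressions_def)
  qed
  also have "card \<dots> = card (square_progressions N (nat \<lfloor>X\<rfloor>))"
    by (intro card_image inj_onI) auto
  finally show ?thesis .
qed

text \<open>The progression attached to the \<open>k\<close>-fold multiple of the triangle \<open>(a, b, c)\<close> is
  \<open>(k (b - a))\<^sup>2, (k c)\<^sup>2, (k (a + b))\<^sup>2\<close>.\<close>

fun progression :: "(nat \<times> nat \<times> nat) \<times> nat \<Rightarrow> nat \<times> nat" where
  "progression ((a, b, c), k) = ((k * c)\<^sup>2, 2 * (k * a) * (k * b))"

text \<open>Bounding the middle square is enough: the difference 2 A B of the progression is less
  than A^2 + B^2 = C^2, as A and B differ.\<close>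

definition scaled_triangles :: "nat \<Rightarrow> nat \<Rightarrow> ((nat \<times> nat \<times> nat) \<times> nat) set" where
  "scaled_triangles N M = {((a, b, c), k). (a, b, c) \<in> primitive_triangles N \<and> k > 0 \<and> (k * c)\<^sup>2 \<le> M}"

lemma progression_mem:
  assumes N: "squarefree N" and T: "((a, b, c), k) \<in> scaled_triangles N M"
  shows "progression ((a, b, c), k) \<in> square_progressions N M"
proof -
  have abc: "0 < a" "a < b" "b < c" "a\<^sup>2 + b\<^sup>2 = c\<^sup>2" and k: "k > 0" "(k * c)\<^sup>2 \<le> M"
    and prim: "(a, b, c) \<in> primitive_triangles N"
    using T by (auto simp: scaled_triangles_def primitive_triangles_def)
  define A B C where ABC: "A = k * a" "B = k * b" "C = k * c"
  have A: "0 < A" "A < B" and pyth: "A\<^sup>2 + B\<^sup>2 = C\<^sup>2"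
    using abc k by (auto simp: ABC power_mult_distrib simp flip: distrib_left)
  have pyth': "int C ^ 2 = int A ^ 2 + int B ^ 2"
    using arg_cong[OF pyth, of int] by simp
  have "(int B - int A) ^ 2 > 0" using A by simp
  hence "2 * int A * int B < int A ^ 2 + int B ^ 2" by (simp add: power2_eq_square algebra_simps)
  hence "2 * int A * int B < int C ^ 2" by (simp only: pyth')
  hence "int (2 * A * B) < int (C\<^sup>2)" by simp
  hence "2 * A * B < C\<^sup>2" by (simp only: of_nat_less_iff)
  moreover have "C\<^sup>2 \<le> M" using k by (simp add: ABC)
  moreover have "2 * A * B \<ge> 1" using A by (simp add: Suc_le_eq)
  moreover have "is_square (int (C\<^sup>2) + int (2 * A * B))"
    by (rule is_nth_powerI[of _ "int A + int B"], simp only: of_nat_power pyth') (simp add: power2_eq_square algebra_simps)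
  moreover have "is_square (int (C\<^sup>2) - int (2 * A * B))"
    by (rule is_nth_powerI[of _ "int B - int A"], simp only: of_nat_power pyth') (simp add: power2_eq_square algebra_simps)
  moreover have "is_square (int (C\<^sup>2))" by (rule is_nth_powerI[of _ "int C"]) simp
  moreover have "is_square (int N * int (2 * A * B))"
  proof -
    define e where "e = square_part (a * b div 2)"
    have "a * b = 2 * (N * e\<^sup>2)" unfolding e_def by (rule triangle_area[OF prim])
    hence "N * (2 * A * B) = (2 * N * k * e)\<^sup>2"
      by (simp add: ABC power2_eq_square mult_ac) (simp add: mult.assoc[symmetric])?
    hence "int N * int (2 * A * B) = int (2 * N * k * e) ^ 2"
      by (simp only: flip: of_nat_mult of_nat_power)
    thus ?thesis by (rule is_nth_powerI)
  qed
  ultimately show ?thesis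
    unfolding progression.simps ABC[symmetric] square_progressions_def by auto
qed

text \<open>m + n and m - n are the squares of A + B and B - A, which determine the scaled legs A <
  B; the scaling factor is their gcd.\<close>

lemma inj_on_progression: "inj_on progression (scaled_triangles N M)"
proof (rule inj_onI)
  fix S T assume "S \<in> scaled_triangles N M" "T \<in> scaled_triangles N M" and eq: "progression S = progression T"
  then obtain a b c k a' b' c' k' where S: "S = ((a, b, c), k)" "(a, b, c) \<in> primitive_triangles N" "k > 0"
    and T: "T = ((a', b', c'), k')" "(a', b', c') \<in> primitive_triangles N" "k' > 0"
    by (auto simp: scaled_triangles_def)
  have abc: "0 < a" "a < b" "a\<^sup>2 + b\<^sup>2 = c\<^sup>2" "coprime a b" "0 < a'" "a' < b'" "a'\<^sup>2 + b'\<^sup>2 = c'\<^sup>2" "coprime a' b'"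
    using S T by (auto simp: primitive_triangles_def)
  define A B C where ABC: "A = int (k * a)" "B = int (k * b)" "C = int (k * c)"
  define A' B' C' where ABC': "A' = int (k' * a')" "B' = int (k' * b')" "C' = int (k' * c')"
  have lt: "0 < A" "A < B" "0 < A'" "A' < B'" using abc S(3) T(3) by (simp_all add: ABC ABC')
  have pyth: "A\<^sup>2 + B\<^sup>2 = C\<^sup>2" "A'\<^sup>2 + B'\<^sup>2 = C'\<^sup>2"
    unfolding ABC ABC' using abc(3,7)
    by (simp_all add: power_mult_distrib flip: distrib_left of_nat_add of_nat_power)
  have eq': "C\<^sup>2 = C'\<^sup>2" "A * B = A' * B'"
  proof -
    have "(k * c)\<^sup>2 = (k' * c')\<^sup>2" "(k * a) * (k * b) = (k' * a') * (k' * b')" using eq by (simp_all add: S T)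
    thus "C\<^sup>2 = C'\<^sup>2" "A * B = A' * B'" unfolding ABC ABC' by (simp_all only: flip: of_nat_mult of_nat_power)
  qed
  have "(A + B)\<^sup>2 = (A' + B')\<^sup>2" "(B - A)\<^sup>2 = (B' - A')\<^sup>2"
    using eq' pyth by (simp_all add: power2_eq_square algebra_simps)
  hence "A + B = A' + B'" "B - A = B' - A'" using lt by (auto simp: power2_eq_iff)
  hence "A = A'" "B = B'" by simp_all
  hence kk: "k * a = k' * a'" "k * b = k' * b'" by (simp_all only: ABC ABC' of_nat_eq_iff)
  have "k = gcd (k * a) (k * b)" using abc(4) by (simp flip: gcd_mult_distrib_nat)
  also have "\<dots> = k'" unfolding kk using abc(8) by (simp flip: gcd_mult_distrib_nat)
  finally have "k = k'" .
  moreover from this have "a = a'" "b = b'" using kk S(3) by simp_all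
  moreover from this have "c = c'" using abc(3,7) by (metis power2_eq_imp_eq zero_le)
  ultimately show "S = T" by (simp add: S T)
qed

text \<open>The legs are half the difference and half the sum of the outer roots z < y, which have
  equal parity. That N n is a square, with n four times the area of the scaled triangle, identifies
  the squarefree part.\<close>

lemma progression_surj:
  assumes N: "squarefree N" and mn: "(m, n) \<in> square_progressions N M"
  shows "(m, n) \<in> progression ` scaled_triangles N M"
proof -
  have bounds: "1 \<le> m" "m \<le> M" "1 \<le> n" using mn by (auto simp: square_progressions_def)
  obtain x y z w :: nat where *: "int m = int x ^ 2" "int m + int n = int y ^ 2"
    "int m - int n = int z ^ 2" "int N * int n = int w ^ 2"
    using mn unfolding square_progressions_def is_square_int_iff by blast
  have x: "m = x\<^sup>2" and y: "m + n = y\<^sup>2" and z: "m = z\<^sup>2 + n" and w: "N * n = w\<^sup>2"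
  proof -
    have "int m = int (x\<^sup>2)" "int (m + n) = int (y\<^sup>2)" "int m = int (z\<^sup>2 + n)" "int (N * n) = int (w\<^sup>2)"
      using * by simp_all
    thus "m = x\<^sup>2" "m + n = y\<^sup>2" "m = z\<^sup>2 + n" "N * n = w\<^sup>2" by (simp_all only: of_nat_eq_iff)
  qed
  have yz: "y\<^sup>2 + z\<^sup>2 = 2 * x\<^sup>2" using x y z by simp
  have "z\<^sup>2 < y\<^sup>2" using y z bounds by simp
  hence "z < y" by (rule power_less_imp_less_base) simp
  have "even (y\<^sup>2 + z\<^sup>2)" by (simp add: yz)
  hence "even (y - z)" using \<open>z < y\<close> by simp
  then obtain A where A: "y - z = 2 * A" by (rule evenE)
  define B where "B = A + z"
  have yB: "y = A + B" using A \<open>z < y\<close> by (simp add: B_def)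
  \<comment> \<open>If z = 0, then y^2 = 2 x^2 with x positive. This excludes the degenerate
    triangle with A = B.\<close>
  have "z > 0"
  proof (rule ccontr)
    assume "\<not> z > 0"
    hence "y\<^sup>2 = 2 * x\<^sup>2" using yz by simp
    hence "x = 0" by (rule double_square_not_square)
    thus False using x bounds by simp
  qed
  hence AB: "0 < A" "A < B" using A \<open>z < y\<close> by (auto simp: B_def)
  have "(A + B)\<^sup>2 + z\<^sup>2 = 2 * (A\<^sup>2 + B\<^sup>2)" by (simp add: B_def power2_eq_square algebra_simps)
  hence pyth: "A\<^sup>2 + B\<^sup>2 = x\<^sup>2" using yz by (simp add: yB)
  have "2 * n + z\<^sup>2 = y\<^sup>2" using y z by simp
  moreover have "(A + B)\<^sup>2 = 4 * (A * B) + z\<^sup>2" by (simp add: B_def power2_eq_square algebra_simps)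
  ultimately have n: "n = 2 * A * B" by (simp add: yB)
  obtain k a b c where k: "k > 0" "A = k * a" "B = k * b" "x = k * c" and abc: "0 < a" "a < b" "b < c"
    "a\<^sup>2 + b\<^sup>2 = c\<^sup>2" "coprime a b" "coprime a c" "coprime b c"
    using primitive_scaling[OF AB pyth] .
  define e where "e = a * b div 2"
  have e: "a * b = 2 * e" using pythagorean_even[OF abc(4)] by (simp add: e_def)
  have "w\<^sup>2 = (2 * k)\<^sup>2 * (N * e)"
  proof -
    have "n = 2 * (k * k) * (a * b)" by (simp add: n k mult_ac)
    thus ?thesis unfolding w[symmetric] e by (simp add: power2_eq_square mult_ac)
  qed
  moreover from this have "(2 * k)\<^sup>2 dvd w\<^sup>2" by simp
  hence "2 * k dvd w" by (simp only: pow_divides_pow_iff)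
  then obtain v where "w = 2 * k * v" by auto
  ultimately have "(2 * k)\<^sup>2 * v\<^sup>2 = (2 * k)\<^sup>2 * (N * e)" by (simp add: power_mult_distrib)
  hence "N * e = v\<^sup>2" using k(1) by simp
  moreover have "e > 0" using e abc by (cases e) auto
  ultimately have "squarefree_part e = N" using N by (intro squarefree_part_eqI)
  hence "(a, b, c) \<in> primitive_triangles N" using abc by (simp add: primitive_triangles_def e_def)
  moreover have "(k * c)\<^sup>2 \<le> M" using bounds(2) x k(4) by simp
  ultimately have "((a, b, c), k) \<in> scaled_triangles N M" using k(1) by (simp add: scaled_triangles_def)
  moreover have "(m, n) = progression ((a, b, c), k)" using x n k by simp
  ultimately show ?thesis by blast
qed

text \<open>For a fixed triangle of hypotenuse c the admissible factors k run from 1 to the quotient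
  of the integer part of sqrt X by c.\<close>

lemma shifted_sum_eq:
  assumes N: "squarefree N" and X: "X \<ge> 1"
    and fin: "finite {T \<in> primitive_triangles N. real (snd (snd T)) \<le> sqrt X}"
  shows "shifted_sum N X =
    (\<Sum>T | T \<in> primitive_triangles N \<and> real (snd (snd T)) \<le> sqrt X. nat \<lfloor>sqrt X\<rfloor> div snd (snd T))"
proof -
  let ?M = "nat \<lfloor>X\<rfloor>" and ?s = "nat \<lfloor>sqrt X\<rfloor>"
  let ?A = "{T \<in> primitive_triangles N. real (snd (snd T)) \<le> sqrt X}"
  have le_iff: "j\<^sup>2 \<le> ?M \<longleftrightarrow> j \<le> ?s" for j :: nat
  proof -
    have "j\<^sup>2 \<le> ?M \<longleftrightarrow> real (j\<^sup>2) \<le> X" using X by (simp add: le_nat_floor nat_le_iff le_nat_iff le_floor_iff)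
    also have "\<dots> \<longleftrightarrow> real j \<le> sqrt X" using X by (simp add: real_le_rsqrt sqrt_ge_absD real_le_lsqrt) (metis abs_of_nat real_sqrt_le_iff real_sqrt_abs)
    also have "\<dots> \<longleftrightarrow> j \<le> ?s" using X by (simp add: le_nat_iff le_floor_iff)
    finally show ?thesis .
  qed
  have "progression ` scaled_triangles N ?M = square_progressions N ?M"
    using progression_mem[OF N] progression_surj[OF N] by (auto simp del: progression.simps)
  hence "shifted_sum N X = card (scaled_triangles N ?M)"
    unfolding shifted_sum_eq_card using card_image[OF inj_on_progression[of N ?M]] by simp
  also have "scaled_triangles N ?M = Sigma ?A (\<lambda>T. {1..?s div snd (snd T)})"
  proof (rule Set.set_eqI)
    fix S :: "(nat \<times> nat \<times> nat) \<times> nat"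
    obtain a b c k where S: "S = ((a, b, c), k)" by (metis prod.exhaust)
    have "k * c \<le> ?s \<longleftrightarrow> k \<le> ?s div c" if "c > 0"
      using that by (simp add: less_eq_div_iff_mult_less_eq)
    moreover have "real c \<le> sqrt X" if "k * c \<le> ?s" "k > 0"
    proof -
      have "c \<le> ?s" using that by (metis le_trans mult_le_mono1 nat_mult_1 Suc_leI One_nat_def)
      thus ?thesis using X by (simp add: le_nat_iff le_floor_iff)
    qed
    moreover have "c > 0" if "(a, b, c) \<in> primitive_triangles N" using that by (auto simp: primitive_triangles_def)
    ultimately show "S \<in> scaled_triangles N ?M \<longleftrightarrow> S \<in> Sigma ?A (\<lambda>T. {1..?s div snd (snd T)})"
      unfolding S scaled_triangles_def le_iff by auto
  qed
  also have "card \<dots> = (\<Sum>T\<in>?A. ?s div snd (snd T))" using fin by simp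
  finally show ?thesis .
qed

theorem theorem1:
  fixes t :: nat
  assumes "squarefree t"
  shows "recip_hyp summable_on primitive_triangles t \<and>
    (\<lambda>X. real (shifted_sum t X) - infsum recip_hyp (primitive_triangles t) * X powr (1/2))
      \<in> O[at_top](\<lambda>X. ln X powr (real (group_rank (congruent_curve t)) / 2))"
proof -
  define r where "r = group_rank (congruent_curve t)"
  let ?A = "primitive_triangles t" and ?c = "\<lambda>T :: nat \<times> nat \<times> nat. snd (snd T)"
  obtain K where K: "K \<ge> 0" and count: "\<And>Y. Y \<ge> 1 \<Longrightarrow> finite {T \<in> ?A. real (?c T) \<le> Y} \<and>
      real (card {T \<in> ?A. real (?c T) \<le> Y}) \<le> K * (1 + sqrt (ln (2 * Y))) ^ r"
    using count_triangles[OF assms] unfolding r_def by blast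
  have c1: "?c T > 1" if "T \<in> ?A" for T
    using that by (auto simp: primitive_triangles_def)
  have recip: "recip_hyp = (\<lambda>T. 1 / real (?c T))"
    by (auto simp: recip_hyp_def fun_eq_iff)
  define C where "C = infsum recip_hyp ?A"
  note asymp = lattice_count_asymptotics[where c = ?c and A = ?A, OF K c1 count, folded recip]
  obtain K' where K': "\<And>Y. Y \<ge> 1 \<Longrightarrow>
      \<bar>(\<Sum>T | T \<in> ?A \<and> real (?c T) \<le> Y. real (nat \<lfloor>Y\<rfloor> div ?c T)) - Y * C\<bar> \<le> K' * (1 + sqrt (ln (2 * Y))) ^ r"
    using asymp(2) unfolding C_def by blast
  have "(\<lambda>X. real (shifted_sum t X) - C * X powr (1/2)) \<in> O[at_top](\<lambda>X. ln X powr (real r / 2))"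
  \<comment> \<open>For X >= 4 and Y = sqrt X one has 2 Y <= Y^2 = X and ln X >= 1, so 1 + sqrt (ln
    (2 Y)) <= 2 sqrt (ln X); this yields the factor 2^r.\<close>
  proof (rule bigoI[where c = "\<bar>K'\<bar> * 2 ^ r"])
    show "eventually (\<lambda>X. norm (real (shifted_sum t X) - C * X powr (1/2)) \<le>
        \<bar>K'\<bar> * 2 ^ r * norm (ln X powr (real r / 2))) at_top"
      using eventually_ge_at_top[of 4]
    proof eventually_elim
      case (elim X)
      define Y where "Y = sqrt X"
      have Y: "Y \<ge> 2" using elim by (simp add: Y_def real_le_rsqrt)
      have X: "X = Y\<^sup>2" using elim by (simp add: Y_def)
      have powr: "X powr (1/2) = Y" using elim by (simp add: Y_def powr_half_sqrt)
      have "exp 1 \<le> X" using elim e_less_272 by simp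
      hence ln1: "1 \<le> ln X" using elim by (subst ln_ge_iff) auto
      have "real (shifted_sum t X) =
          (\<Sum>T | T \<in> ?A \<and> real (?c T) \<le> Y. real (nat \<lfloor>Y\<rfloor> div ?c T))"
        using shifted_sum_eq[OF assms, of X] count[of Y] Y elim by (simp add: Y_def)
      hence "\<bar>real (shifted_sum t X) - C * X powr (1/2)\<bar> \<le> K' * (1 + sqrt (ln (2 * Y))) ^ r"
        using K'[of Y] Y by (simp add: powr mult.commute)
      also have "\<dots> \<le> \<bar>K'\<bar> * (2 * sqrt (ln X)) ^ r"
      proof -
        have "2 * Y \<le> X" using Y by (simp add: X power2_eq_square)
        hence "ln (2 * Y) \<le> ln X" using Y by simp
        moreover have "0 \<le> ln (2 * Y)" using Y by simp
        moreover have "1 \<le> sqrt (ln X)" using ln1 by simp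
        ultimately have "1 + sqrt (ln (2 * Y)) \<le> 2 * sqrt (ln X)"
          using real_sqrt_le_mono[of "ln (2 * Y)" "ln X"] by linarith
        moreover have "0 \<le> 1 + sqrt (ln (2 * Y))" using \<open>0 \<le> ln (2 * Y)\<close> by (simp add: add_nonneg_nonneg)
        ultimately show ?thesis by (intro mult_mono power_mono) auto
      qed
      also have "(2 * sqrt (ln X)) ^ r = 2 ^ r * ln X powr (real r / 2)"
        using ln1 by (simp add: power_mult_distrib powr_half_sqrt[symmetric] powr_powr flip: powr_realpow)
      finally show ?case by simp
    qed
  qed
  thus ?thesis using asymp(1) unfolding C_def r_def by blast
qed

end
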